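(* For every integer $n\ge1$, one has $C_n\in\Lambda^{-4n}$. In particular, $C_n$ is primitive in $\Lambda$ (i.e. not divisible in $\Lambda$ by any integer greater than $1$).
   Context: $\Omega_U^*=MU^*(\mathrm{pt})$ is the complex cobordism ring (torsion-free). $F(u,v)\in\Omega_U^*[[u,v]]$ is the universal one-dimensional commutative formal group law, $g$ its logarithm, $f=g^{-1}$, and $\bar u=f(-g(u))$ the formal inverse. The series $B(x)=x+\sum_{n\ge1}b_nx^{n+1}\in(\Omega_U^*\otimes\mathbb Q)[[x]]$ is the unique one with $B(u\bar u)=-g(u)^2$. Put $d_n=\frac{n+1}{2}\operatorname{lcm}(1,\ldots,2n+2)$ and $C_n=d_nb_n$; this class lies in $\Omega_U^{-4n}$. The universal two-valued law $z^2-\Theta_1(x,y)z+\Theta_2(x,y)=0$ has coefficients $\Theta_1,\Theta_2\in\Omega_U^*[[x,y]]$ determined, under $x=u\bar u$, $y=v\bar v$, by $$\Theta_1(x,y)=z_++z_-,\quad\Theta_2(x,y)=z_+z_-,\qquad z_+=F(u,v)F(\bar u,\bar v),\quad z_-=F(u,\bar v)F(\bar u,v).$$ $\Lambda\subset\Omega_U^*$ is the subring generated over $\mathbb Z$ by all coefficients of $\Theta_1$ and $\Theta_2$, and $\Lambda^{-4n}=\Lambda\cap\Omega_U^{-4n}$. *)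

theory Defs
  imports "HOL-Library.Poly_Mapping" "HOL-Computational_Algebra.Formal_Power_Series"
begin

unbundle fps_syntax

section \<open>Power series in several variables\<close>

text \<open>
  \<^typ>\<open>'a fps fps\<close> stands for \<open>R[[u,v]]\<close>: \<open>H $ i $ j\<close> is the coefficient of \<open>u\<^sup>i v\<^sup>j\<close>.
  Similarly \<open>H $ i $ j $ k\<close> in \<^typ>\<open>'a fps fps fps\<close> is the coefficient of \<open>u\<^sup>i v\<^sup>j w\<^sup>k\<close>.
\<close>

definition map_fps :: "('a \<Rightarrow> 'b) \<Rightarrow> 'a fps \<Rightarrow> 'b fps"
  where "map_fps h A = Abs_fps (\<lambda>i. h (A $ i))"

definition in_u :: "'a::zero fps \<Rightarrow> 'a fps fps"
  where "in_u h = map_fps fps_const h"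

definition in_v :: "'a::zero fps \<Rightarrow> 'a fps fps"
  where "in_v h = fps_const h"

text \<open>
  The substitutions \<open>h(X)\<close> and \<open>H(X,Y)\<close> are meant for \<open>X\<close>, \<open>Y\<close> without constant term.
  Then \<open>X\<^sup>p Y\<^sup>q\<close> has order at least \<open>p + q\<close>, so that cutting off the sums at the total degree
  of the coefficient in question loses nothing.
\<close>

definition subst1 :: "'a::comm_ring_1 fps \<Rightarrow> 'a fps fps \<Rightarrow> 'a fps fps"
  where "subst1 h X = Abs_fps (\<lambda>i. Abs_fps (\<lambda>j. \<Sum>p\<le>i+j. h $ p * (X ^ p) $ i $ j))"

definition subst2 :: "'a::comm_ring_1 fps fps \<Rightarrow> 'a fps fps \<Rightarrow> 'a fps fps \<Rightarrow> 'a fps fps"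
  where "subst2 H X Y = Abs_fps (\<lambda>i. Abs_fps (\<lambda>j.
    \<Sum>p\<le>i+j. \<Sum>q\<le>i+j. H $ p $ q * (X ^ p * Y ^ q) $ i $ j))"

definition subst3 :: "'a::comm_ring_1 fps fps \<Rightarrow> 'a fps fps fps \<Rightarrow> 'a fps fps fps \<Rightarrow> 'a fps fps fps"
  where "subst3 H X Y = Abs_fps (\<lambda>i. Abs_fps (\<lambda>j. Abs_fps (\<lambda>k.
    \<Sum>p\<le>i+j+k. \<Sum>q\<le>i+j+k. H $ p $ q * (X ^ p * Y ^ q) $ i $ j $ k)))"

definition assoc_left :: "'a::comm_ring_1 fps fps \<Rightarrow> 'a fps fps fps"
  where "assoc_left F =
    subst3 F (subst3 F fps_X (fps_const fps_X)) (fps_const (fps_const fps_X))"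

definition assoc_right :: "'a::comm_ring_1 fps fps \<Rightarrow> 'a fps fps fps"
  where "assoc_right F =
    subst3 F fps_X (subst3 F (fps_const fps_X) (fps_const (fps_const fps_X)))"

definition formal_group_law :: "'a::comm_ring_1 fps fps \<Rightarrow> bool"
  where "formal_group_law F \<longleftrightarrow>
    subst2 F (in_u fps_X) 0 = in_u fps_X \<and>
    subst2 F 0 (in_v fps_X) = in_v fps_X \<and>
    subst2 F (in_v fps_X) (in_u fps_X) = F \<and>
    assoc_left F = assoc_right F"

definition is_ring_hom :: "('a::comm_ring_1 \<Rightarrow> 'b::comm_ring_1) \<Rightarrow> bool"
  where "is_ring_hom h \<longleftrightarrow>
    h 1 = 1 \<and> (\<forall>x y. h (x + y) = h x + h y) \<and> (\<forall>x y. h (x * y) = h x * h y)"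

lemma map_fps_nth [simp]: "map_fps h A $ i = h (A $ i)"
  by (simp add: map_fps_def)

lemma is_ring_hom_0: "is_ring_hom h \<Longrightarrow> h 0 = 0"
  unfolding is_ring_hom_def by (metis add_cancel_right_right)

lemma is_ring_hom_diff: "is_ring_hom h \<Longrightarrow> h (x - y) = h x - h y"
  unfolding is_ring_hom_def by (metis add_diff_cancel diff_add_cancel)

lemma is_ring_hom_sum: "is_ring_hom h \<Longrightarrow> h (sum f A) = (\<Sum>x\<in>A. h (f x))"
  by (induction A rule: infinite_finite_induct) (auto simp: is_ring_hom_0, simp add: is_ring_hom_def)

lemma is_ring_hom_power: "is_ring_hom h \<Longrightarrow> h (x ^ n) = h x ^ n"
  by (induction n) (auto simp: is_ring_hom_def)

lemma is_ring_hom_mult: "is_ring_hom h \<Longrightarrow> h (x * y) = h x * h y"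
  by (auto simp: is_ring_hom_def)

lemma is_ring_hom_map_fps: "is_ring_hom h \<Longrightarrow> is_ring_hom (map_fps h)"
  by (subst is_ring_hom_def)
    (auto simp: fps_eq_iff fps_mult_nth is_ring_hom_sum is_ring_hom_mult is_ring_hom_0,
     auto simp: is_ring_hom_def)

lemma map_fps_X: "is_ring_hom h \<Longrightarrow> map_fps h fps_X = fps_X"
  by (auto simp: fps_eq_iff fps_X_def is_ring_hom_0, simp add: is_ring_hom_def)

lemma map_fps_const: "is_ring_hom h \<Longrightarrow> map_fps h (fps_const c) = fps_const (h c)"
  by (auto simp: fps_eq_iff is_ring_hom_0)

lemma map_in_u_X: "is_ring_hom h \<Longrightarrow> map_fps (map_fps h) (in_u fps_X) = in_u fps_X"
  by (auto simp: fps_eq_iff in_u_def fps_X_def is_ring_hom_0, simp add: is_ring_hom_def)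

lemma map_subst2:
  assumes "is_ring_hom h"
  shows "map_fps (map_fps h) (subst2 H X Y) =
    subst2 (map_fps (map_fps h) H) (map_fps (map_fps h) X) (map_fps (map_fps h) Y)"
proof -
  note * = is_ring_hom_map_fps[OF is_ring_hom_map_fps[OF assms]]
  show ?thesis
    unfolding subst2_def is_ring_hom_power[OF *, symmetric] is_ring_hom_mult[OF *, symmetric]
    by (simp add: fps_eq_iff is_ring_hom_sum[OF assms] is_ring_hom_mult[OF assms])
qed

lemma map_subst3:
  assumes "is_ring_hom h"
  shows "map_fps (map_fps (map_fps h)) (subst3 H X Y) =
    subst3 (map_fps (map_fps h) H)
      (map_fps (map_fps (map_fps h)) X) (map_fps (map_fps (map_fps h)) Y)"
proof -
  note * = is_ring_hom_map_fps[OF is_ring_hom_map_fps[OF is_ring_hom_map_fps[OF assms]]]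
  show ?thesis
    unfolding subst3_def is_ring_hom_power[OF *, symmetric] is_ring_hom_mult[OF *, symmetric]
    by (simp add: fps_eq_iff is_ring_hom_sum[OF assms] is_ring_hom_mult[OF assms])
qed

lemma map_assoc:
  assumes "is_ring_hom h"
  shows "map_fps (map_fps (map_fps h)) (assoc_left H) = assoc_left (map_fps (map_fps h) H)"
    and "map_fps (map_fps (map_fps h)) (assoc_right H) = assoc_right (map_fps (map_fps h) H)"
  by (simp_all add: assoc_left_def assoc_right_def map_subst3 map_fps_X map_fps_const
      is_ring_hom_map_fps assms)

lemma formal_group_law_map:
  assumes h: "is_ring_hom h" and F: "formal_group_law F"
  shows "formal_group_law (map_fps (map_fps h) F)"
proof -
  note hh = is_ring_hom_map_fps[OF is_ring_hom_map_fps[OF h]]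
  have v: "map_fps (map_fps h) (in_v fps_X) = in_v fps_X"
    by (simp add: in_v_def map_fps_const map_fps_X h is_ring_hom_map_fps)
  show ?thesis
    using F unfolding formal_group_law_def
    by (metis map_subst2[OF h] map_in_u_X[OF h] v is_ring_hom_0[OF hh] map_assoc[OF h])
qed


section \<open>The universal formal group law\<close>

text \<open>
  \<open>\<int>[a\<^sub>i\<^sub>j]\<close>: polynomials are finitely supported maps from monomials to \<open>\<int>\<close>, and monomials are
  finitely supported exponent functions on the index pairs.
\<close>

type_synonym lazard_poly = "((nat \<times> nat) \<Rightarrow>\<^sub>0 nat) \<Rightarrow>\<^sub>0 int"

definition generic_series :: "lazard_poly fps fps"
  where "generic_series = Abs_fps (\<lambda>i. Abs_fps (\<lambda>j.
    Poly_Mapping.single (Poly_Mapping.single (i, j) 1) 1))"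

definition lazard_relations :: "lazard_poly set"
  where "lazard_relations =
    range (\<lambda>(i, j). (subst2 generic_series (in_u fps_X) 0 - in_u fps_X) $ i $ j) \<union>
    range (\<lambda>(i, j). (subst2 generic_series 0 (in_v fps_X) - in_v fps_X) $ i $ j) \<union>
    range (\<lambda>(i, j). (subst2 generic_series (in_v fps_X) (in_u fps_X) - generic_series) $ i $ j) \<union>
    range (\<lambda>(i, j, k). (assoc_left generic_series - assoc_right generic_series) $ i $ j $ k)"

abbreviation lazard_ideal :: "lazard_poly set"
  where "lazard_ideal \<equiv> module.span (*) lazard_relations"

lemma module_mult: "module ((*) :: 'a::comm_ring_1 \<Rightarrow> 'a \<Rightarrow> 'a)"
  by standard (auto simp: algebra_simps)

definition lazard_rel :: "lazard_poly \<Rightarrow> lazard_poly \<Rightarrow> bool"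
  where "lazard_rel p q \<longleftrightarrow> p - q \<in> lazard_ideal"

quotient_type lazard = lazard_poly / lazard_rel
proof (rule equivpI)
  note ideal = module_mult[where 'a = lazard_poly]
  show "reflp lazard_rel"
    by (simp add: reflp_def lazard_rel_def module.span_zero[OF ideal])
  show "symp lazard_rel"
  proof (rule sympI)
    fix p q
    assume "lazard_rel p q"
    from module.span_neg[OF ideal this[unfolded lazard_rel_def]]
    show "lazard_rel q p" by (simp add: lazard_rel_def)
  qed
  show "transp lazard_rel"
  proof (rule transpI)
    fix p q r
    assume "lazard_rel p q" "lazard_rel q r"
    from module.span_add[OF ideal this[unfolded lazard_rel_def]]
    show "lazard_rel p r" by (simp add: lazard_rel_def)
  qed
qed

subsection \<open>Evaluation of polynomials\<close>

definition eval_monom :: "(nat \<times> nat \<Rightarrow> 'b::comm_ring_1) \<Rightarrow> ((nat \<times> nat) \<Rightarrow>\<^sub>0 nat) \<Rightarrow> 'b"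
  where "eval_monom c m = (\<Prod>a\<in>Poly_Mapping.keys m. c a ^ Poly_Mapping.lookup m a)"

definition eval_lazard_poly :: "(nat \<times> nat \<Rightarrow> 'b::comm_ring_1) \<Rightarrow> lazard_poly \<Rightarrow> 'b"
  where "eval_lazard_poly c p =
    (\<Sum>m\<in>Poly_Mapping.keys p. of_int (Poly_Mapping.lookup p m) * eval_monom c m)"

lemma eval_monom_superset:
  assumes "finite S" "Poly_Mapping.keys m \<subseteq> S"
  shows "eval_monom c m = (\<Prod>a\<in>S. c a ^ Poly_Mapping.lookup m a)"
  unfolding eval_monom_def using assms
  by (intro prod.mono_neutral_left) (auto simp: in_keys_iff)

lemma eval_monom_add: "eval_monom c (m + m') = eval_monom c m * eval_monom c m'"
proof -
  let ?S = "Poly_Mapping.keys m \<union> Poly_Mapping.keys m'"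
  have "Poly_Mapping.keys (m + m') \<subseteq> ?S"
    by (rule Poly_Mapping.keys_add)
  then show ?thesis
    by (simp add: eval_monom_superset[where S = ?S] lookup_add power_add prod.distrib)
qed

lemma eval_superset:
  assumes "finite S" "Poly_Mapping.keys p \<subseteq> S"
  shows "eval_lazard_poly c p = (\<Sum>m\<in>S. of_int (Poly_Mapping.lookup p m) * eval_monom c m)"
  unfolding eval_lazard_poly_def using assms
  by (intro sum.mono_neutral_left) (auto simp: in_keys_iff)

lemma eval_add: "eval_lazard_poly c (p + q) = eval_lazard_poly c p + eval_lazard_poly c q"
proof -
  let ?S = "Poly_Mapping.keys p \<union> Poly_Mapping.keys q"
  have "Poly_Mapping.keys (p + q) \<subseteq> ?S"
    by (rule Poly_Mapping.keys_add)
  then show ?thesis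
    by (simp add: eval_superset[where S = ?S] lookup_add distrib_right sum.distrib)
qed

lemma eval_0: "eval_lazard_poly c 0 = 0"
  by (simp add: eval_lazard_poly_def)

lemma eval_sum: "eval_lazard_poly c (sum f A) = (\<Sum>x\<in>A. eval_lazard_poly c (f x))"
  by (induction A rule: infinite_finite_induct) (auto simp: eval_0 eval_add)

lemma eval_single: "eval_lazard_poly c (Poly_Mapping.single m k) = of_int k * eval_monom c m"
  by (simp add: eval_lazard_poly_def)

lemma sum_singles: "p = (\<Sum>m\<in>Poly_Mapping.keys p. Poly_Mapping.single m (Poly_Mapping.lookup p m))"
  by (rule poly_mapping_eqI) (auto simp: lookup_sum lookup_single when_def in_keys_iff)

lemma eval_mult: "eval_lazard_poly c (p * q) = eval_lazard_poly c p * eval_lazard_poly c q"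
proof -
  let ?s = "\<lambda>p. \<lambda>m. Poly_Mapping.single m (Poly_Mapping.lookup p m)"
  have "p * q = (\<Sum>m\<in>Poly_Mapping.keys p. \<Sum>m'\<in>Poly_Mapping.keys q. ?s p m * ?s q m')"
    by (subst sum_singles[of p], subst sum_singles[of q]) (rule sum_product)
  then have "eval_lazard_poly c (p * q) =
    (\<Sum>m\<in>Poly_Mapping.keys p. \<Sum>m'\<in>Poly_Mapping.keys q.
      (of_int (Poly_Mapping.lookup p m) * eval_monom c m) *
      (of_int (Poly_Mapping.lookup q m') * eval_monom c m'))"
    by (simp only: eval_sum mult_single eval_single eval_monom_add of_int_mult) (simp add: ac_simps)
  then show ?thesis
    by (simp add: eval_lazard_poly_def sum_product)
qed

lemma eval_1: "eval_lazard_poly c 1 = 1"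
  using eval_single[of c 0 1] by (simp add: eval_monom_def flip: single_one)

lemma is_ring_hom_eval: "is_ring_hom (eval_lazard_poly c)"
  by (simp add: is_ring_hom_def eval_add eval_mult eval_1)

lemma eval_generic:
  "map_fps (map_fps (eval_lazard_poly (\<lambda>(i, j). G $ i $ j))) generic_series = G"
  by (simp add: fps_eq_iff generic_series_def eval_single eval_monom_def)

lemma eval_ideal:
  assumes G: "formal_group_law G" and p: "p \<in> lazard_ideal"
  shows "eval_lazard_poly (\<lambda>(i, j). G $ i $ j) p = 0"
proof -
  define h where "h = eval_lazard_poly (\<lambda>(i, j). G $ i $ j)"
  have h: "is_ring_hom h" by (simp add: h_def is_ring_hom_eval)
  note hh = is_ring_hom_map_fps[OF is_ring_hom_map_fps[OF h]]
  note hhh = is_ring_hom_map_fps[OF hh]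
  have gen: "map_fps (map_fps h) generic_series = G"
    unfolding h_def by (rule eval_generic)
  have v: "map_fps (map_fps h) (in_v fps_X) = in_v fps_X"
    by (simp add: in_v_def map_fps_const map_fps_X h is_ring_hom_map_fps)
  have 2: "h ((A - B) $ i $ j) = 0" if "map_fps (map_fps h) A = map_fps (map_fps h) B" for A B i j
    using that by (simp add: fps_eq_iff is_ring_hom_diff[OF h])
  have 3: "h ((A - B) $ i $ j $ k) = 0"
    if "map_fps (map_fps (map_fps h)) A = map_fps (map_fps (map_fps h)) B" for A B i j k
    using that by (simp add: fps_eq_iff is_ring_hom_diff[OF h])
  have rel: "h r = 0" if "r \<in> lazard_relations" for r
    using that G unfolding lazard_relations_def formal_group_law_def
    by (auto simp del: fps_sub_nth
        intro!: 2 3 simp: map_subst2[OF h] map_assoc[OF h] gen v map_in_u_X[OF h] is_ring_hom_0[OF hh])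
  show ?thesis
    unfolding h_def[symmetric] using p
  proof (induction rule: module.span_induct_alt[OF module_mult, consumes 1])
    case 1
    show ?case by (rule is_ring_hom_0[OF h])
  next
    case (2 c x y)
    then show ?case using h rel by (simp add: is_ring_hom_def)
  qed
qed

subsection \<open>Ring structure\<close>

lemma lazard_ideal_mult: "p \<in> lazard_ideal \<Longrightarrow> c * p \<in> lazard_ideal"
  by (rule module.span_scale[OF module_mult])

lemmas lazard_ideal_add = module.span_add[OF module_mult[where 'a = lazard_poly]]
lemmas lazard_ideal_neg = module.span_neg[OF module_mult[where 'a = lazard_poly]]

lemma lazard_rel_refl: "lazard_rel p p"
  by (simp add: lazard_rel_def module.span_zero[OF module_mult])

definition additive_group_law :: "'a::comm_ring_1 fps fps"
  where "additive_group_law = in_u fps_X + in_v fps_X"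

lemma additive_group_law_nth:
  "additive_group_law $ p $ q = (if p = 1 then if q = 0 then 1 else 0 else 0) +
    (if p = 0 then if q = 1 then 1 else 0 else 0)"
  by (auto simp: additive_group_law_def in_u_def in_v_def fps_X_def)

lemma additive_sum:
  fixes c :: "nat \<Rightarrow> nat \<Rightarrow> 'a::comm_ring_1"
  assumes "N = 0 \<Longrightarrow> c 1 0 + c 0 1 = 0"
  shows "(\<Sum>p\<le>N. \<Sum>q\<le>N. additive_group_law $ p $ q * c p q) = c 1 0 + c 0 1"
proof -
  have "(\<Sum>p\<le>N. \<Sum>q\<le>N. additive_group_law $ p $ q * c p q) =
    (\<Sum>p\<le>N. if p = 1 then \<Sum>q\<le>N. if q = 0 then c p q else 0 else 0) +
    (\<Sum>p\<le>N. if p = 0 then \<Sum>q\<le>N. if q = 1 then c p q else 0 else 0)"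
    unfolding sum.distrib[symmetric] additive_group_law_nth
    by (intro sum.cong refl) (auto simp: mult_delta_left sum.delta)
  also have "\<dots> = (if N = 0 then 0 else c 1 0 + c 0 1)"
    by (simp add: sum.delta Suc_le_eq)
  finally show ?thesis
    using assms by auto
qed

lemma additive_subst2:
  "(X + Y) $ 0 $ 0 = 0 \<Longrightarrow> subst2 additive_group_law X Y = X + Y"
  by (auto simp: fps_eq_iff subst2_def intro!: trans[OF additive_sum])

lemma additive_subst3:
  "(X + Y) $ 0 $ 0 $ 0 = 0 \<Longrightarrow> subst3 additive_group_law X Y = X + Y"
  by (auto simp: fps_eq_iff subst3_def intro!: trans[OF additive_sum])

lemma formal_group_law_additive: "formal_group_law additive_group_law"
proof -
  have *: "in_u fps_X $ 0 $ 0 = 0" "in_v fps_X $ 0 $ 0 = 0"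
    by (simp_all add: in_u_def in_v_def)
  show ?thesis
    unfolding formal_group_law_def assoc_left_def assoc_right_def
    by (simp add: additive_subst2 additive_subst3 *) (simp add: additive_group_law_def add_ac)
qed

instantiation lazard :: comm_ring_1
begin

lift_definition zero_lazard :: lazard is 0 .
lift_definition one_lazard :: lazard is 1 .

lift_definition plus_lazard :: "lazard \<Rightarrow> lazard \<Rightarrow> lazard" is "(+)"
proof -
  fix p p' q q' :: lazard_poly
  assume "lazard_rel p p'" "lazard_rel q q'"
  then have "(p - p') + (q - q') \<in> lazard_ideal"
    unfolding lazard_rel_def by (rule lazard_ideal_add)
  then show "lazard_rel (p + q) (p' + q')"
    unfolding lazard_rel_def by (simp add: algebra_simps)
qed

lift_definition uminus_lazard :: "lazard \<Rightarrow> lazard" is uminus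
proof -
  fix p p' :: lazard_poly
  assume "lazard_rel p p'"
  then have "- (p - p') \<in> lazard_ideal"
    unfolding lazard_rel_def by (rule lazard_ideal_neg)
  then show "lazard_rel (- p) (- p')"
    unfolding lazard_rel_def by (simp add: algebra_simps)
qed

lift_definition minus_lazard :: "lazard \<Rightarrow> lazard \<Rightarrow> lazard" is "(-)"
proof -
  fix p p' q q' :: lazard_poly
  assume "lazard_rel p p'" "lazard_rel q q'"
  then have "(p - p') + - (q - q') \<in> lazard_ideal"
    unfolding lazard_rel_def by (intro lazard_ideal_add lazard_ideal_neg)
  then show "lazard_rel (p - q) (p' - q')"
    unfolding lazard_rel_def by (simp add: algebra_simps)
qed

lift_definition times_lazard :: "lazard \<Rightarrow> lazard \<Rightarrow> lazard" is "(*)"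
proof -
  fix p p' q q' :: lazard_poly
  assume "lazard_rel p p'" "lazard_rel q q'"
  then have "q * (p - p') + p' * (q - q') \<in> lazard_ideal"
    unfolding lazard_rel_def by (intro lazard_ideal_add lazard_ideal_mult)
  then show "lazard_rel (p * q) (p' * q')"
    unfolding lazard_rel_def by (simp add: algebra_simps)
qed

instance
proof
  fix a b c :: lazard
  have r: "lazard_rel p q" if "p = q" for p q
    using that by (simp add: lazard_rel_refl)
  show "a + b + c = a + (b + c)" by transfer (rule r, rule add.assoc)
  show "a + b = b + a" by transfer (rule r, rule add.commute)
  show "0 + a = a" by transfer (rule r, simp)
  show "- a + a = 0" by transfer (rule r, simp)
  show "a - b = a + - b" by transfer (rule r, simp)
  show "a * b * c = a * (b * c)" by transfer (rule r, rule mult.assoc)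
  show "a * b = b * a" by transfer (rule r, rule mult.commute)
  show "1 * a = a" by transfer (rule r, simp)
  show "(a + b) * c = a * c + b * c" by transfer (rule r, rule distrib_right)
  show "(0::lazard) \<noteq> 1"
  proof
    assume "(0::lazard) = 1"
    then have "(0 :: lazard_poly) - 1 \<in> lazard_ideal"
      by transfer (simp add: lazard_rel_def)
    then have "eval_lazard_poly (\<lambda>(i, j). (additive_group_law :: int fps fps) $ i $ j) (0 - 1) = 0"
      by (rule eval_ideal[OF formal_group_law_additive])
    then have "(0 :: int) - 1 = 0"
      by (simp only: is_ring_hom_diff[OF is_ring_hom_eval] is_ring_hom_0[OF is_ring_hom_eval])
        (simp add: eval_1)
    then show False by simp
  qed
qed

end

subsection \<open>Universality\<close>

lemma is_ring_hom_abs_lazard: "is_ring_hom abs_lazard"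
  by (simp add: is_ring_hom_def one_lazard_def plus_lazard.abs_eq times_lazard.abs_eq)

lemma abs_lazard_eq_iff: "abs_lazard p = abs_lazard q \<longleftrightarrow> p - q \<in> lazard_ideal"
  by (simp add: lazard.abs_eq_iff lazard_rel_def)

definition universal_fgl :: "lazard fps fps"
  where "universal_fgl = map_fps (map_fps abs_lazard) generic_series"

lemma formal_group_law_universal: "formal_group_law universal_fgl"
proof -
  note h = is_ring_hom_abs_lazard
  note hh = is_ring_hom_map_fps[OF is_ring_hom_map_fps[OF h]]
  have v: "map_fps (map_fps abs_lazard) (in_v fps_X) = in_v fps_X"
    by (simp add: in_v_def map_fps_const map_fps_X h is_ring_hom_map_fps)
  have 2: "map_fps (map_fps abs_lazard) A = map_fps (map_fps abs_lazard) B"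
    if "range (\<lambda>(i, j). (A - B) $ i $ j) \<subseteq> lazard_relations" for A B
    using that by (auto simp: fps_eq_iff abs_lazard_eq_iff image_subset_iff
        intro!: module.span_base[OF module_mult])
  have 3: "map_fps (map_fps (map_fps abs_lazard)) A = map_fps (map_fps (map_fps abs_lazard)) B"
    if "range (\<lambda>(i, j, k). (A - B) $ i $ j $ k) \<subseteq> lazard_relations" for A B
    using that by (auto simp: fps_eq_iff abs_lazard_eq_iff image_subset_iff
        intro!: module.span_base[OF module_mult])
  have "map_fps (map_fps abs_lazard) (subst2 generic_series (in_u fps_X) 0) =
      map_fps (map_fps abs_lazard) (in_u fps_X)"
    "map_fps (map_fps abs_lazard) (subst2 generic_series 0 (in_v fps_X)) =
      map_fps (map_fps abs_lazard) (in_v fps_X)"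
    "map_fps (map_fps abs_lazard) (subst2 generic_series (in_v fps_X) (in_u fps_X)) =
      map_fps (map_fps abs_lazard) generic_series"
    "map_fps (map_fps (map_fps abs_lazard)) (assoc_left generic_series) =
      map_fps (map_fps (map_fps abs_lazard)) (assoc_right generic_series)"
    by (rule 2 3, unfold lazard_relations_def, blast)+
  then show ?thesis
    by (simp add: formal_group_law_def universal_fgl_def map_subst2[OF h] map_assoc[OF h]
        map_in_u_X[OF h] v is_ring_hom_0[OF hh])
qed

definition classifying_map :: "'b::comm_ring_1 fps fps \<Rightarrow> lazard \<Rightarrow> 'b"
  where "classifying_map G a = eval_lazard_poly (\<lambda>(i, j). G $ i $ j) (rep_lazard a)"

lemma classifying_map_abs:
  assumes "formal_group_law G"
  shows "classifying_map G (abs_lazard p) = eval_lazard_poly (\<lambda>(i, j). G $ i $ j) p"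
proof -
  have "abs_lazard (rep_lazard (abs_lazard p)) = abs_lazard p"
    by (rule Quotient_abs_rep[OF Quotient_lazard])
  then have "rep_lazard (abs_lazard p) - p \<in> lazard_ideal"
    by (simp add: abs_lazard_eq_iff)
  from eval_ideal[OF assms this] show ?thesis
    by (simp add: classifying_map_def is_ring_hom_diff[OF is_ring_hom_eval])
qed

lemma abs_lazard_cases: obtains p where "a = abs_lazard p"
  using Quotient_abs_rep[OF Quotient_lazard, of a, symmetric] by (rule that)

lemma is_ring_hom_classifying_map:
  assumes "formal_group_law G"
  shows "is_ring_hom (classifying_map G)"
proof -
  note [simp] = classifying_map_abs[OF assms]
  have "classifying_map G 1 = 1"
    by (simp add: one_lazard_def eval_1)
  moreover have "classifying_map G (a + b) = classifying_map G a + classifying_map G b \<and>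
      classifying_map G (a * b) = classifying_map G a * classifying_map G b" for a b
    by (cases a rule: abs_lazard_cases; cases b rule: abs_lazard_cases)
      (simp add: plus_lazard.abs_eq times_lazard.abs_eq eval_add eval_mult)
  ultimately show ?thesis
    by (simp add: is_ring_hom_def)
qed

lemma map_classifying_map:
  assumes "formal_group_law G"
  shows "map_fps (map_fps (classifying_map G)) universal_fgl = G"
  using eval_generic[of G] by (simp add: fps_eq_iff universal_fgl_def classifying_map_abs[OF assms])

lemma single_prod: "finite A \<Longrightarrow>
  Poly_Mapping.single (\<Sum>a\<in>A. f a) (1::int) = (\<Prod>a\<in>A. Poly_Mapping.single (f a) 1)"
proof (induction A rule: finite_induct)
  case (insert x A)
  have "Poly_Mapping.single (f x + (\<Sum>a\<in>A. f a)) (1::int) =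
    Poly_Mapping.single (f x) 1 * Poly_Mapping.single (\<Sum>a\<in>A. f a) 1"
    by (simp add: mult_single)
  with insert show ?case by simp
qed simp

lemma single_power:
  "Poly_Mapping.single (Poly_Mapping.single a n) (1::int) =
    Poly_Mapping.single (Poly_Mapping.single a (1::nat)) 1 ^ n"
proof (induction n)
  case (Suc n)
  have "Poly_Mapping.single (Poly_Mapping.single a (Suc n)) (1::int) =
    Poly_Mapping.single (Poly_Mapping.single a (1::nat)) 1 *
    Poly_Mapping.single (Poly_Mapping.single a n) 1"
    by (simp add: mult_single flip: single_add)
  with Suc show ?case by simp
qed simp

lemma single_monom:
  "Poly_Mapping.single m (1::int) =
    (\<Prod>a\<in>Poly_Mapping.keys m.
      Poly_Mapping.single (Poly_Mapping.single a (1::nat)) 1 ^ Poly_Mapping.lookup m a)"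
proof -
  have "m = (\<Sum>a\<in>Poly_Mapping.keys m. Poly_Mapping.single a (Poly_Mapping.lookup m a))"
    by (rule poly_mapping_eqI) (auto simp: lookup_sum lookup_single when_def in_keys_iff)
  then have "Poly_Mapping.single m (1::int) = Poly_Mapping.single
      (\<Sum>a\<in>Poly_Mapping.keys m. Poly_Mapping.single a (Poly_Mapping.lookup m a)) 1"
    by (rule arg_cong)
  also have "\<dots> = (\<Prod>a\<in>Poly_Mapping.keys m.
      Poly_Mapping.single (Poly_Mapping.single a (Poly_Mapping.lookup m a)) 1)"
    by (rule single_prod) simp
  also have "\<dots> = (\<Prod>a\<in>Poly_Mapping.keys m.
      Poly_Mapping.single (Poly_Mapping.single a (1::nat)) 1 ^ Poly_Mapping.lookup m a)"
    by (intro prod.cong refl) (rule single_power)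
  finally show ?thesis .
qed

lemma is_ring_hom_of_int:
  assumes "is_ring_hom h"
  shows "h (of_int k) = of_int k"
proof -
  have n: "h (of_nat n) = of_nat n" for n
    using assms by (induction n) (auto simp: is_ring_hom_0, auto simp: is_ring_hom_def)
  show ?thesis
  proof (cases "k \<ge> 0")
    case True
    then show ?thesis using n[of "nat k"] by simp
  next
    case False
    have "h (0 - of_nat (nat (- k))) = 0 - of_nat (nat (- k))"
      by (simp only: is_ring_hom_diff[OF assms] is_ring_hom_0[OF assms] n)
    then show ?thesis using False by simp
  qed
qed

lemma single_of_int: "Poly_Mapping.single (m :: (nat \<times> nat) \<Rightarrow>\<^sub>0 nat) k = of_int k * Poly_Mapping.single m 1"
proof -
  have "is_ring_hom (\<lambda>k::int. Poly_Mapping.single (0 :: (nat \<times> nat) \<Rightarrow>\<^sub>0 nat) k)"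
    by (simp add: is_ring_hom_def single_add mult_single)
  from is_ring_hom_of_int[OF this, of k]
  have "Poly_Mapping.single (0 :: (nat \<times> nat) \<Rightarrow>\<^sub>0 nat) k = of_int k"
    by simp
  then have "of_int k * Poly_Mapping.single m (1::int) = Poly_Mapping.single 0 k * Poly_Mapping.single m 1"
    by simp
  also have "\<dots> = Poly_Mapping.single m k"
    by (simp add: mult_single)
  finally show ?thesis by simp
qed

lemma ring_hom_eq_eval:
  assumes k: "is_ring_hom (k :: lazard_poly \<Rightarrow> 'b::comm_ring_1)"
  shows "k p = eval_lazard_poly (\<lambda>a. k (Poly_Mapping.single (Poly_Mapping.single a 1) 1)) p"
proof -
  have prod: "k (prod f A) = (\<Prod>x\<in>A. k (f x))" for f and A :: "(nat \<times> nat) set"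
    using k by (induction A rule: infinite_finite_induct) (auto simp: is_ring_hom_def)
  let ?c = "\<lambda>a. k (Poly_Mapping.single (Poly_Mapping.single a 1) 1)"
  have monom: "k (Poly_Mapping.single m 1) = eval_monom ?c m" for m
    by (subst single_monom) (simp only: eval_monom_def prod is_ring_hom_power[OF k])
  have single: "k (Poly_Mapping.single m c) = of_int c * eval_monom ?c m" for m c
    unfolding monom[symmetric] is_ring_hom_of_int[OF k, symmetric] is_ring_hom_mult[OF k, symmetric]
    by (rule arg_cong[where f = k], rule single_of_int)
  have "k p = k (\<Sum>m\<in>Poly_Mapping.keys p. Poly_Mapping.single m (Poly_Mapping.lookup p m))"
    by (rule arg_cong[where f = k], rule sum_singles)
  also have "\<dots> = eval_lazard_poly ?c p"
    unfolding is_ring_hom_sum[OF k] eval_lazard_poly_def by (intro sum.cong refl single)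
  finally show ?thesis .
qed

theorem universal_property:
  fixes G :: "'b::comm_ring_1 fps fps"
  assumes "formal_group_law G"
  shows "\<exists>!h. is_ring_hom h \<and> map_fps (map_fps h) universal_fgl = G"
proof (intro ex1I conjI)
  show "is_ring_hom (classifying_map G)" "map_fps (map_fps (classifying_map G)) universal_fgl = G"
    by (simp_all add: assms is_ring_hom_classifying_map map_classifying_map)
next
  fix h assume h: "is_ring_hom h \<and> map_fps (map_fps h) universal_fgl = G"
  define k where "k = h \<circ> abs_lazard"
  have k: "is_ring_hom k"
    using h is_ring_hom_abs_lazard by (simp add: is_ring_hom_def k_def)
  have "k (Poly_Mapping.single (Poly_Mapping.single a 1) 1) = (case a of (i, j) \<Rightarrow> G $ i $ j)" for a
    using h by (auto simp: k_def universal_fgl_def generic_series_def split: prod.splits)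
  then have "k p = eval_lazard_poly (\<lambda>(i, j). G $ i $ j) p" for p
    using ring_hom_eq_eval[OF k, of p] by (simp add: case_prod_unfold)
  then have *: "h (abs_lazard p) = classifying_map G (abs_lazard p)" for p
    by (simp add: k_def classifying_map_abs[OF assms])
  show "h = classifying_map G"
  proof
    fix a
    show "h a = classifying_map G a"
      by (cases a rule: abs_lazard_cases) (simp add: *)
  qed
qed

instance lazard :: ring_char_0
proof
  show "inj (of_nat :: nat \<Rightarrow> lazard)"
  proof (rule injI)
    fix m n assume "(of_nat m :: lazard) = of_nat n"
    then have "classifying_map (additive_group_law :: int fps fps) (of_int (int m)) =
        classifying_map additive_group_law (of_int (int n))"
      by simp
    then show "m = n"
      by (simp only: is_ring_hom_of_int[OF is_ring_hom_classifying_map[OF formal_group_law_additive]]) simp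
  qed
qed


section \<open>Rationalization\<close>

text \<open>
  \<open>R \<otimes> \<rat>\<close> as the localization of \<open>R\<close> at the nonzero integers; \<open>(a, m)\<close> represents \<open>a/m\<close>.
\<close>

definition rationalized_rel :: "'a::comm_ring_1 \<times> int \<Rightarrow> 'a \<times> int \<Rightarrow> bool"
  where "rationalized_rel x y \<longleftrightarrow> snd x \<noteq> 0 \<and> snd y \<noteq> 0 \<and>
    (\<exists>k::int. k \<noteq> 0 \<and> of_int k * (of_int (snd y) * fst x - of_int (snd x) * fst y) = 0)"

quotient_type (overloaded) 'a rationalized = "'a::{comm_ring_1, ring_char_0} \<times> int" / partial: rationalized_rel
proof (rule part_equivpI)
  show "\<exists>x. rationalized_rel x (x :: 'a \<times> int)"
    by (rule exI[of _ "(0, 1)"]) (auto simp: rationalized_rel_def intro: exI[of _ 1])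
  show "symp (rationalized_rel :: 'a \<times> int \<Rightarrow> _)"
    unfolding symp_def rationalized_rel_def by (auto simp: algebra_simps)
  show "transp (rationalized_rel :: 'a \<times> int \<Rightarrow> _)"
  proof (rule transpI)
    fix x y z :: "'a \<times> int"
    assume xy: "rationalized_rel x y" and yz: "rationalized_rel y z"
    obtain k l :: int where kl: "k \<noteq> 0" "l \<noteq> 0"
      "of_int k * (of_int (snd y) * fst x - of_int (snd x) * fst y) = 0"
      "of_int l * (of_int (snd z) * fst y - of_int (snd y) * fst z) = 0"
      using xy yz unfolding rationalized_rel_def by blast
    have "of_int (k * l * snd y) * (of_int (snd z) * fst x - of_int (snd x) * fst z) =
      of_int (l * snd z) * (of_int k * (of_int (snd y) * fst x - of_int (snd x) * fst y)) +
      of_int (k * snd x) * (of_int l * (of_int (snd z) * fst y - of_int (snd y) * fst z))"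
      by (simp add: algebra_simps)
    then have "of_int (k * l * snd y) * (of_int (snd z) * fst x - of_int (snd x) * fst z) = 0"
      by (simp only: kl) simp
    moreover have "k * l * snd y \<noteq> 0" "snd x \<noteq> 0" "snd z \<noteq> 0"
      using xy yz kl by (auto simp: rationalized_rel_def)
    ultimately show "rationalized_rel x z"
      unfolding rationalized_rel_def by blast
  qed
qed

lemma rationalized_relI:
  "\<lbrakk>m \<noteq> 0; n \<noteq> 0; of_int n * a = of_int m * b\<rbrakk> \<Longrightarrow> rationalized_rel (a, m) (b, n)"
  unfolding rationalized_rel_def by (auto intro: exI[of _ 1])

lemma rationalized_rel_nz: "rationalized_rel x y \<Longrightarrow> snd x \<noteq> 0 \<and> snd y \<noteq> 0"
  by (simp add: rationalized_rel_def)

lemma rationalized_rel_refl_iff: "rationalized_rel x x \<longleftrightarrow> snd x \<noteq> 0"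
  unfolding rationalized_rel_def by (auto intro: exI[of _ 1])

instantiation rationalized :: ("{comm_ring_1, ring_char_0}") comm_ring_1
begin

lift_definition zero_rationalized :: "'a rationalized" is "(0, 1)"
  by (rule rationalized_relI) auto

lift_definition one_rationalized :: "'a rationalized" is "(1, 1)"
  by (rule rationalized_relI) auto

lift_definition plus_rationalized :: "'a rationalized \<Rightarrow> 'a rationalized \<Rightarrow> 'a rationalized"
  is "\<lambda>x y. (of_int (snd y) * fst x + of_int (snd x) * fst y, snd x * snd y)"
proof -
  fix x x' y y' :: "'a \<times> int"
  assume x: "rationalized_rel x x'" and y: "rationalized_rel y y'"
  obtain k l :: int where kl: "k \<noteq> 0" "l \<noteq> 0"
    "of_int k * (of_int (snd x') * fst x - of_int (snd x) * fst x') = 0"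
    "of_int l * (of_int (snd y') * fst y - of_int (snd y) * fst y') = 0"
    using x y unfolding rationalized_rel_def by blast
  have "of_int (k * l) *
      (of_int (snd x' * snd y') * (of_int (snd y) * fst x + of_int (snd x) * fst y) -
       of_int (snd x * snd y) * (of_int (snd y') * fst x' + of_int (snd x') * fst y')) =
    of_int (l * snd y * snd y') * (of_int k * (of_int (snd x') * fst x - of_int (snd x) * fst x')) +
    of_int (k * snd x * snd x') * (of_int l * (of_int (snd y') * fst y - of_int (snd y) * fst y'))"
    by (simp add: algebra_simps)
  also have "\<dots> = 0"
    by (simp only: kl) simp
  finally show "rationalized_rel
      (of_int (snd y) * fst x + of_int (snd x) * fst y, snd x * snd y)
      (of_int (snd y') * fst x' + of_int (snd x') * fst y', snd x' * snd y')"
    using kl(1,2) rationalized_rel_nz[OF x] rationalized_rel_nz[OF y]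
    unfolding rationalized_rel_def fst_conv snd_conv by (metis mult_eq_0_iff)
qed

lift_definition uminus_rationalized :: "'a rationalized \<Rightarrow> 'a rationalized"
  is "\<lambda>x. (- fst x, snd x)"
proof -
  fix x x' :: "'a \<times> int"
  assume x: "rationalized_rel x x'"
  then obtain k :: int where k: "k \<noteq> 0"
    "of_int k * (of_int (snd x') * fst x - of_int (snd x) * fst x') = 0"
    unfolding rationalized_rel_def by blast
  have "of_int k * (of_int (snd x') * - fst x - of_int (snd x) * - fst x') =
    - (of_int k * (of_int (snd x') * fst x - of_int (snd x) * fst x'))"
    by (simp add: algebra_simps)
  with k have "of_int k * (of_int (snd x') * - fst x - of_int (snd x) * - fst x') = 0"
    by simp
  then show "rationalized_rel (- fst x, snd x) (- fst x', snd x')"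
    using k(1) rationalized_rel_nz[OF x] unfolding rationalized_rel_def fst_conv snd_conv by blast
qed

definition minus_rationalized :: "'a rationalized \<Rightarrow> 'a rationalized \<Rightarrow> 'a rationalized"
  where "minus_rationalized x y = x + - y"

lift_definition times_rationalized :: "'a rationalized \<Rightarrow> 'a rationalized \<Rightarrow> 'a rationalized"
  is "\<lambda>x y. (fst x * fst y, snd x * snd y)"
proof -
  fix x x' y y' :: "'a \<times> int"
  assume x: "rationalized_rel x x'" and y: "rationalized_rel y y'"
  obtain k l :: int where kl: "k \<noteq> 0" "l \<noteq> 0"
    "of_int k * (of_int (snd x') * fst x - of_int (snd x) * fst x') = 0"
    "of_int l * (of_int (snd y') * fst y - of_int (snd y) * fst y') = 0"
    using x y unfolding rationalized_rel_def by blast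
  have "of_int (k * l) *
      (of_int (snd x' * snd y') * (fst x * fst y) - of_int (snd x * snd y) * (fst x' * fst y')) =
    of_int (l * snd y') * fst y * (of_int k * (of_int (snd x') * fst x - of_int (snd x) * fst x')) +
    of_int (k * snd x) * fst x' * (of_int l * (of_int (snd y') * fst y - of_int (snd y) * fst y'))"
    by (simp add: algebra_simps)
  also have "\<dots> = 0"
    by (simp only: kl) simp
  finally show "rationalized_rel (fst x * fst y, snd x * snd y) (fst x' * fst y', snd x' * snd y')"
    using kl(1,2) rationalized_rel_nz[OF x] rationalized_rel_nz[OF y]
    unfolding rationalized_rel_def fst_conv snd_conv by (metis mult_eq_0_iff)
qed

instance
proof
  fix a b c :: "'a rationalized"
  show "a + b + c = a + (b + c)"
    by transfer (auto intro!: rationalized_relI simp: rationalized_rel_refl_iff algebra_simps)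
  show "a + b = b + a"
    by transfer (auto intro!: rationalized_relI simp: rationalized_rel_refl_iff algebra_simps)
  show "0 + a = a"
    by transfer (auto intro!: rationalized_relI simp: rationalized_rel_refl_iff algebra_simps)
  show "- a + a = 0"
    by transfer (auto intro!: rationalized_relI simp: rationalized_rel_refl_iff algebra_simps)
  show "a - b = a + - b"
    by (rule minus_rationalized_def)
  show "a * b * c = a * (b * c)"
    by transfer (auto intro!: rationalized_relI simp: rationalized_rel_refl_iff algebra_simps)
  show "a * b = b * a"
    by transfer (auto intro!: rationalized_relI simp: rationalized_rel_refl_iff algebra_simps)
  show "1 * a = a"
    by transfer (auto intro!: rationalized_relI simp: rationalized_rel_refl_iff algebra_simps)
  show "(a + b) * c = a * c + b * c"
    by transfer (auto intro!: rationalized_relI simp: rationalized_rel_refl_iff algebra_simps)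
  show "(0 :: 'a rationalized) \<noteq> 1"
    by transfer (simp add: rationalized_rel_def)
qed

end

lift_definition to_rationalized :: "'a::{comm_ring_1, ring_char_0} \<Rightarrow> 'a rationalized"
  is "\<lambda>a. (a, 1)"
  by (rule rationalized_relI) auto

lemma is_ring_hom_to_rationalized: "is_ring_hom to_rationalized"
proof -
  have "to_rationalized (a + b) = to_rationalized a + to_rationalized b" for a b :: 'a
    by transfer (auto intro!: rationalized_relI simp: rationalized_rel_refl_iff)
  moreover have "to_rationalized (a * b) = to_rationalized a * to_rationalized b" for a b :: 'a
    by transfer (auto intro!: rationalized_relI simp: rationalized_rel_refl_iff)
  moreover have "to_rationalized (1 :: 'a) = 1"
    by transfer (auto intro!: rationalized_relI simp: rationalized_rel_refl_iff)
  ultimately show ?thesis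
    by (simp add: is_ring_hom_def)
qed

lemma to_rationalized_eq_0_iff:
  "to_rationalized a = 0 \<longleftrightarrow> (\<exists>k::int. k \<noteq> 0 \<and> of_int k * a = 0)"
  by transfer (simp add: rationalized_rel_def)

lift_definition fraction :: "'a::{comm_ring_1, ring_char_0} \<Rightarrow> int \<Rightarrow> 'a rationalized"
  is "\<lambda>a m. if m = 0 then (0, 1) else (a, m)"
  by (auto intro: rationalized_relI)

lemma fraction_mult:
  assumes "m \<noteq> 0"
  shows "of_int m * fraction a m = to_rationalized a"
proof -
  have "to_rationalized (of_int m) * fraction a m = to_rationalized a"
    using assms by transfer (auto intro: rationalized_relI)
  then show ?thesis
    by (simp add: is_ring_hom_of_int[OF is_ring_hom_to_rationalized])
qed

lemma rationalized_cases: obtains a m where "m \<noteq> 0" "x = fraction a m"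
proof -
  have "\<exists>a m. m \<noteq> 0 \<and> x = fraction a m"
  proof transfer
    fix x :: "'a \<times> int"
    assume "rationalized_rel x x"
    then show "\<exists>a m. m \<noteq> 0 \<and> rationalized_rel x (if m = 0 then (0, 1) else (a, m))"
      using rationalized_rel_nz[of x x] by (intro exI[of _ "fst x"] exI[of _ "snd x"]) simp
  qed
  then show ?thesis using that by blast
qed


section \<open>Complex cobordism and the two-valued group law\<close>

text \<open>
  By Quillen's theorem the formal group law of complex cobordism is the universal one, so that
  \<open>\<Omega>\<^sub>U\<^sup>*\<close> is \<^typ>\<open>lazard\<close>. The coefficient \<open>a\<^sub>i\<^sub>j\<close> has degree \<open>2 - 2(i + j)\<close>, because \<open>u\<close>, \<open>v\<close> and
  \<open>F(u,v)\<close> have cohomological degree \<open>2\<close>. Since \<open>\<Omega>\<^sub>U\<^sup>*\<close> is torsion-free, it is identified with its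
  image in \<open>\<Omega>\<^sub>U\<^sup>* \<otimes> \<rat>\<close>, where all the classes below are taken.
\<close>

definition monom_degree :: "((nat \<times> nat) \<Rightarrow>\<^sub>0 nat) \<Rightarrow> int"
  where "monom_degree m =
    (\<Sum>(i, j)\<in>Poly_Mapping.keys m. int (Poly_Mapping.lookup m (i, j)) * (2 - 2 * (int i + int j)))"

definition cobordism_group :: "int \<Rightarrow> lazard rationalized set"
  where "cobordism_group d =
    (\<lambda>p. to_rationalized (abs_lazard p)) ` {p. \<forall>m\<in>Poly_Mapping.keys p. monom_degree m = d}"

definition cobordism_fgl :: "lazard rationalized fps fps"
  where "cobordism_fgl = map_fps (map_fps to_rationalized) universal_fgl"

definition is_logarithm :: "'a::comm_ring_1 fps fps \<Rightarrow> 'a fps \<Rightarrow> bool"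
  where "is_logarithm F g \<longleftrightarrow> g $ 0 = 0 \<and> g $ 1 = 1 \<and> subst1 g F = in_u g + in_v g"

definition z_plus :: "'a::comm_ring_1 fps fps \<Rightarrow> 'a fps \<Rightarrow> 'a fps fps"
  where "z_plus F ubar = subst2 F (in_u fps_X) (in_v fps_X) * subst2 F (in_u ubar) (in_v ubar)"

definition z_minus :: "'a::comm_ring_1 fps fps \<Rightarrow> 'a fps \<Rightarrow> 'a fps fps"
  where "z_minus F ubar = subst2 F (in_u fps_X) (in_v ubar) * subst2 F (in_u ubar) (in_v fps_X)"

text \<open>\<open>\<Theta>\<^sub>i(u \<cdot> ubar(u), v \<cdot> ubar(v))\<close> equals \<open>z\<^sub>+ + z\<^sub>-\<close> for \<open>i = 1\<close> and \<open>z\<^sub>+ z\<^sub>-\<close> for \<open>i = 2\<close>.\<close>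

definition two_valued_law ::
    "'a::comm_ring_1 fps fps \<Rightarrow> 'a fps \<Rightarrow> 'a fps fps \<Rightarrow> 'a fps fps \<Rightarrow> bool"
  where "two_valued_law F ubar Theta1 Theta2 \<longleftrightarrow>
    subst2 Theta1 (in_u (fps_X * ubar)) (in_v (fps_X * ubar)) = z_plus F ubar + z_minus F ubar \<and>
    subst2 Theta2 (in_u (fps_X * ubar)) (in_v (fps_X * ubar)) = z_plus F ubar * z_minus F ubar"

inductive_set generated_subring :: "'a::comm_ring_1 set \<Rightarrow> 'a set" for S
  where
    base: "s \<in> S \<Longrightarrow> s \<in> generated_subring S"
  | one: "1 \<in> generated_subring S"
  | diff: "a \<in> generated_subring S \<Longrightarrow> b \<in> generated_subring S \<Longrightarrow> a - b \<in> generated_subring S"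
  | mult: "a \<in> generated_subring S \<Longrightarrow> b \<in> generated_subring S \<Longrightarrow> a * b \<in> generated_subring S"

definition coefficient_ring :: "'a::comm_ring_1 fps fps \<Rightarrow> 'a fps fps \<Rightarrow> 'a set"
  where "coefficient_ring Theta1 Theta2 =
    generated_subring ({Theta1 $ i $ j |i j. True} \<union> {Theta2 $ i $ j |i j. True})"

text \<open>The division is exact because the least common multiple is even.\<close>

definition d_factor :: "nat \<Rightarrow> nat"
  where "d_factor n = (n + 1) * Lcm {1..2 * n + 2} div 2"

end

(*
The function phi = f(w) f(-w), which expresses x = u ubar in the logarithmic coordinate w, satisfies
B(phi(w)) = -w^2, and
  Theta1(phi(w), phi(t)) = phi(w+t) + phi(w-t),  Theta2(phi(w), phi(t)) = phi(w+t) phi(w-t).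
Odd primes: comparing coefficients of w^2 gives P B'^2 = -4 B with P = S2 - x S1, where Si(y) is the
coefficient of x in Thetai(x, y), so that P is a series over Lambda. Hence B = x L^2, where the
coefficient of x^i in L is K_i / (2i+1) with K_i in Lambda[1/2], and
(i + j + 1) / ((2i+1)(2j+1)) = (1/(2i+1) + 1/(2j+1)) / 2 bounds the denominators.
The prime 2: D(x) = Theta1(x, x) satisfies B(D(x)) = 4 B(x), D = 4x + ..., and its odd coefficients are
even because Theta1 is symmetric; so x D' is even, and the denominator of m times the coefficient of x^m
in B gains a factor 2 only when m passes a power of 2. Both arguments stay within the homogeneous parts
of Lambda.
Primitivity: for each prime p the multiplicative group is twisted so that its phi becomes
sigma(2 - e^w - e^(-w)), where sigma is the inverse of x + t x^(e+1). Its two-valued law is p-integral,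
whereas B(x) = sum 2 (x + t x^(e+1))^k / (k^2 binomial(2k, k)) attains the full denominator at p.
*)
theory Submission
  imports Defs "HOL-Computational_Algebra.Formal_Laurent_Series"
begin

unbundle fps_syntax

section \<open>Substitution of power series\<close>

text \<open>\<open>f\<close>, \<open>g\<close> and \<open>B\<close> have denominators, and
  \<open>Theta1\<close>, \<open>Theta2\<close> are known only after a substitution
  \<open>x = u ubar\<close> or \<open>x = phi(w)\<close>. The way back to \<open>\<Lambda>\<close>
  rests on both substitutions starting with minus a square: at even exponents the unknown
  coefficient occurs with factor 1 or -1 beside earlier ones, so symmetry, weights and integrality
  descend without division. Neither denominator argument suffices alone. The differential equation
  is solved by dividing by 4 and taking a square root, which loses control at 2; duplication divides
  by \<open>1 - 4^(m-1)\<close>, which loses the odd primes. One yields a power of 2 times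
  \<open>C n\<close> in \<open>\<Lambda>\<close>, the other an odd multiple, and Bezout joins them.
  For primitivity the multiplicative group alone is too coarse: it sends \<open>C 3\<close> to 3.
  The twist moves a coefficient with the worst denominator from a lower degree into degree
  \<open>m\<close>, and \<open>t\<close>, being a formal variable, keeps different contributions
  apart. Nothing is claimed about p-integrality of the twisted group law itself: only
  \<open>\<Lambda>\<close> has to land in the p-integral ring.\<close>

locale substitution =
  fixes c :: "'a::comm_ring_1 \<Rightarrow> 'b::comm_ring_1" and J :: "nat \<Rightarrow> 'b set"
    and sb :: "'a fps fps \<Rightarrow> 'b \<Rightarrow> 'b \<Rightarrow> 'b"
  assumes hom: "is_ring_hom c"
    and J_0: "x \<in> J 0"
    and zero_J: "0 \<in> J n"
    and J_diff: "x \<in> J n \<Longrightarrow> y \<in> J n \<Longrightarrow> x - y \<in> J n"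
    and J_mult: "x \<in> J m \<Longrightarrow> y \<in> J n \<Longrightarrow> x * y \<in> J (m + n)"
    and J_Suc: "x \<in> J (Suc n) \<Longrightarrow> x \<in> J n"
    and separated: "(\<And>n. x \<in> J n) \<Longrightarrow> x = 0"
    and approx: "X \<in> J 1 \<Longrightarrow> Y \<in> J 1 \<Longrightarrow>
      sb H X Y - (\<Sum>p<n. \<Sum>q<n. c (H $ p $ q) * (X ^ p * Y ^ q)) \<in> J n"

definition ord2 :: "nat \<Rightarrow> 'a::comm_ring_1 fps fps set"
  where "ord2 n = {H. \<forall>i j. i + j < n \<longrightarrow> H $ i $ j = 0}"

definition monomial2 :: "'a::comm_ring_1 \<Rightarrow> nat \<Rightarrow> nat \<Rightarrow> 'a fps fps"
  where "monomial2 a p q = fps_const (fps_const a) * (fps_X ^ p * fps_const fps_X ^ q)"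

definition truncate2 :: "nat \<Rightarrow> 'a::comm_ring_1 fps fps \<Rightarrow> 'a fps fps"
  where "truncate2 n H = (\<Sum>p<n. \<Sum>q<n. monomial2 (H $ p $ q) p q)"

lemma monomial2_nth: "monomial2 a p q $ i $ j = (if i = p \<and> j = q then a else 0)"
  by (simp add: monomial2_def fps_X_power_nth)

lemma monomial2_mult: "monomial2 a p q * monomial2 b p' q' = monomial2 (a * b) (p + p') (q + q')"
  unfolding monomial2_def power_add fps_const_mult[symmetric] by (simp only: mult_ac)

lemma sum_sum_delta:
  assumes "finite A" "finite B"
  shows "(\<Sum>p\<in>A. \<Sum>q\<in>B. if p = i then (if q = j then x else 0) else 0) =
    (if i \<in> A \<and> j \<in> B then x else (0 :: 'a::comm_monoid_add))"
proof -
  have "(\<Sum>q\<in>B. if p = i then (if q = j then x else 0) else 0) =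
      (if p = i then (if j \<in> B then x else 0) else 0)" for p
    using assms by (simp add: sum.delta)
  then show ?thesis
    using assms by (simp add: sum.delta)
qed

lemma truncate2_nth: "truncate2 n H $ i $ j = (if i < n \<and> j < n then H $ i $ j else 0)"
proof -
  have "truncate2 n H $ i $ j = (\<Sum>p<n. \<Sum>q<n. if p = i then (if q = j then H $ i $ j else 0) else 0)"
    unfolding truncate2_def fps_sum_nth by (intro sum.cong) (auto simp: monomial2_nth)
  also have "\<dots> = (if i < n \<and> j < n then H $ i $ j else 0)"
    by (subst sum_sum_delta) auto
  finally show ?thesis .
qed

lemma truncate2: "H - truncate2 n H \<in> ord2 n"
  by (auto simp: ord2_def truncate2_nth)

lemma ord2_0: "x \<in> ord2 0" by (simp add: ord2_def)
lemma ord2_diff: "x \<in> ord2 n \<Longrightarrow> y \<in> ord2 n \<Longrightarrow> x - y \<in> ord2 n" by (simp add: ord2_def)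
lemma ord2_add: "x \<in> ord2 n \<Longrightarrow> y \<in> ord2 n \<Longrightarrow> x + y \<in> ord2 n" by (simp add: ord2_def)

lemma ord2_mult:
  assumes "x \<in> ord2 m" "y \<in> ord2 n" shows "x * y \<in> ord2 (m + n)"
proof -
  have "x $ k $ l * y $ (i - k) $ (j - l) = 0" if "i + j < m + n" "k \<le> i" "l \<le> j" for i j k l
  proof (cases "k + l < m")
    case False
    then have "(i - k) + (j - l) < n" using that by linarith
    then show ?thesis using assms(2) by (simp add: ord2_def)
  qed (use assms(1) in \<open>simp add: ord2_def\<close>)
  then show ?thesis
    by (auto simp: ord2_def fps_mult_nth fps_sum_nth intro!: sum.neutral)
qed

lemma in_u_nth: "in_u h $ p $ q = (if q = 0 then h $ p else 0)"
  by (simp add: in_u_def)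

lemma in_v_nth: "in_v h $ p $ q = (if p = 0 then h $ q else 0)"
  by (simp add: in_v_def)

context substitution
begin

lemma J_uminus: "x \<in> J n \<Longrightarrow> - x \<in> J n"
  using J_diff[OF zero_J] by fastforce

lemma J_add: "x \<in> J n \<Longrightarrow> y \<in> J n \<Longrightarrow> x + y \<in> J n"
  using J_diff[OF _ J_uminus] by fastforce

lemma J_le: "m \<le> n \<Longrightarrow> x \<in> J n \<Longrightarrow> x \<in> J m"
  by (induction n) (auto simp: le_Suc_eq dest: J_Suc)

lemma J_ideal: "x \<in> J n \<Longrightarrow> y * x \<in> J n"
  using J_mult[OF J_0, of x n y] by simp

lemma J_sum: "(\<And>i. i \<in> A \<Longrightarrow> f i \<in> J n) \<Longrightarrow> sum f A \<in> J n"
  by (induction A rule: infinite_finite_induct) (auto intro: zero_J J_add)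

lemma J_power: "X \<in> J 1 \<Longrightarrow> X ^ p \<in> J p"
  by (induction p) (use J_mult[of _ 1] in \<open>auto simp: J_0\<close>)

text \<open>The pattern behind the identities of substitution: modulo \<open>J n\<close> series are
  replaced by finite truncations, for which the identity is plain algebra, and \<open>n\<close> is
  arbitrary. The locale isolates this filtration so that targets in one, two and three variables
  share the proofs.\<close>

lemma J_eqI: "(\<And>n. x - y \<in> J n) \<Longrightarrow> x = y"
  using separated[of "x - y"] by simp

lemma J_trans: "x - y \<in> J n \<Longrightarrow> y - z \<in> J n \<Longrightarrow> x - z \<in> J n"
  using J_add by fastforce

lemma J_sym: "x - y \<in> J n \<Longrightarrow> y - x \<in> J n"
  using J_uminus by fastforce

lemma J_mult_cong: "x - x' \<in> J n \<Longrightarrow> y - y' \<in> J n \<Longrightarrow> x * y - x' * y' \<in> J n"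
  using J_add[OF J_ideal[of "x - x'" n y] J_ideal[of "y - y'" n x']] by (simp add: algebra_simps)

context
  fixes X Y assumes X: "X \<in> J 1" and Y: "Y \<in> J 1"
begin

lemma sb_ord:
  assumes "H \<in> ord2 n" shows "sb H X Y \<in> J n"
proof -
  have "c (H $ p $ q) * (X ^ p * Y ^ q) \<in> J n" for p q
  proof (cases "p + q < n")
    case True
    then show ?thesis using assms by (simp add: ord2_def is_ring_hom_0[OF hom] zero_J)
  next
    case False
    then show ?thesis
      by (intro J_ideal J_le[OF _ J_mult[OF J_power[OF X] J_power[OF Y]]]) simp
  qed
  then have "(\<Sum>p<n. \<Sum>q<n. c (H $ p $ q) * (X ^ p * Y ^ q)) \<in> J n"
    by (intro J_sum)
  from J_add[OF approx[OF X Y, of H n] this] show ?thesis by simp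
qed

lemma sb_add: "sb (G + H) X Y = sb G X Y + sb H X Y"
proof (rule J_eqI)
  fix n
  have "c (a + b) = c a + c b" for a b using hom by (simp add: is_ring_hom_def)
  then show "sb (G + H) X Y - (sb G X Y + sb H X Y) \<in> J n"
    using J_diff[OF approx[OF X Y, of "G + H" n] J_add[OF approx[OF X Y, of G n] approx[OF X Y, of H n]]]
    by (simp add: distrib_right sum.distrib algebra_simps)
qed

lemma sb_0: "sb 0 X Y = 0"
  using sb_add[of 0 0] by simp

lemma sb_uminus: "sb (- H) X Y = - sb H X Y"
  using sb_add[of H "- H"] by (simp add: sb_0 eq_neg_iff_add_eq_0 add.commute)

lemma sb_diff: "sb (G - H) X Y = sb G X Y - sb H X Y"
  using sb_add[of G "- H"] by (simp add: sb_uminus)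

lemma sb_sum: "sb (sum f A) X Y = (\<Sum>i\<in>A. sb (f i) X Y)"
  by (induction A rule: infinite_finite_induct) (auto simp: sb_0 sb_add)

lemma sb_monomial: "sb (monomial2 a p q) X Y = c a * (X ^ p * Y ^ q)"
proof (rule J_eqI)
  fix n
  define N where "N = Suc (n + p + q)"
  have "(\<Sum>i<N. \<Sum>j<N. c (monomial2 a p q $ i $ j) * (X ^ i * Y ^ j)) =
    (\<Sum>i<N. \<Sum>j<N. if i = p then (if j = q then c a * (X ^ p * Y ^ q) else 0) else 0)"
    by (intro sum.cong) (auto simp: monomial2_nth is_ring_hom_0[OF hom])
  also have "\<dots> = c a * (X ^ p * Y ^ q)"
    by (subst sum_sum_delta) (auto simp: N_def)
  finally show "sb (monomial2 a p q) X Y - c a * (X ^ p * Y ^ q) \<in> J n"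
    using approx[OF X Y, of "monomial2 a p q" N] by (auto intro: J_le[of n N] simp: N_def)
qed

lemma sb_cong_ord: "G - H \<in> ord2 n \<Longrightarrow> sb G X Y - sb H X Y \<in> J n"
  using sb_ord[of "G - H" n] by (simp add: sb_diff)

text \<open>Truncation changes each factor only in order \<open>n\<close>, and for finite sums of
  monomials multiplicativity reduces to \<open>monomial2_mult\<close>.\<close>

lemma sb_mult: "sb (G * H) X Y = sb G X Y * sb H X Y"
proof (rule J_eqI)
  fix n
  let ?G = "truncate2 n G" and ?H = "truncate2 n H"
  have "G * H - ?G * ?H = H * (G - ?G) + ?G * (H - ?H)"
    by (simp add: algebra_simps)
  also have "\<dots> \<in> ord2 n"
    using ord2_mult[OF ord2_0 truncate2[of G n]] ord2_mult[OF ord2_0 truncate2[of H n]]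
    by (auto intro: ord2_add)
  finally have 1: "sb (G * H) X Y - sb (?G * ?H) X Y \<in> J n"
    by (rule sb_cong_ord)
  have "sb (?G * ?H) X Y = sb ?G X Y * sb ?H X Y"
    unfolding truncate2_def sum_product
    by (simp only: sb_sum monomial2_mult sb_monomial is_ring_hom_mult[OF hom])
       (simp add: sum_product power_add mult_ac)
  with 1 J_mult_cong[OF sb_cong_ord[OF truncate2[of G n]] sb_cong_ord[OF truncate2[of H n]]]
  show "sb (G * H) X Y - sb G X Y * sb H X Y \<in> J n"
    by (auto dest: J_sym intro: J_trans)
qed

lemma sb_const: "sb (fps_const (fps_const a)) X Y = c a"
  using sb_monomial[of a 0 0] by (simp add: monomial2_def)

lemma sb_1: "sb 1 X Y = 1"
  using sb_const[of 1] hom by (simp add: is_ring_hom_def)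

lemma sb_power: "sb (H ^ n) X Y = sb H X Y ^ n"
  by (induction n) (simp_all add: sb_1 sb_mult)

lemma sb_u: "sb (in_u fps_X) X Y = X"
proof -
  have "in_u fps_X = monomial2 (1 :: 'a) 1 0"
    by (auto simp: fps_eq_iff in_u_nth monomial2_nth fps_X_def)
  then show ?thesis using sb_monomial[of 1 1 0] hom by (simp add: is_ring_hom_def)
qed

lemma sb_v: "sb (in_v fps_X) X Y = Y"
proof -
  have "in_v fps_X = monomial2 (1 :: 'a) 0 1"
    by (auto simp: fps_eq_iff in_v_nth monomial2_nth fps_X_def)
  then show ?thesis using sb_monomial[of 1 0 1] hom by (simp add: is_ring_hom_def)
qed

end

definition s1 :: "'a fps \<Rightarrow> 'b \<Rightarrow> 'b" where "s1 h X = sb (in_u h) X 0"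

lemma sb_in_u:
  assumes "X \<in> J 1" "Y \<in> J 1" shows "sb (in_u h) X Y = s1 h X"
proof (rule J_eqI)
  fix n
  have *: "(\<Sum>p<n. \<Sum>q<n. c (in_u h $ p $ q) * (X ^ p * Z ^ q)) = (\<Sum>p<n. c (h $ p) * X ^ p)" for Z
  proof (intro sum.cong refl)
    fix p assume "p \<in> {..<n}"
    then have "(\<Sum>q<n. c (in_u h $ p $ q) * (X ^ p * Z ^ q)) =
        (\<Sum>q\<in>{0}. c (in_u h $ p $ q) * (X ^ p * Z ^ q))"
      by (intro sum.mono_neutral_right) (auto simp: in_u_nth is_ring_hom_0[OF hom])
    then show "(\<Sum>q<n. c (in_u h $ p $ q) * (X ^ p * Z ^ q)) = c (h $ p) * X ^ p"
      by (simp add: in_u_nth)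
  qed
  show "sb (in_u h) X Y - s1 h X \<in> J n"
    using J_diff[OF approx[OF assms, of "in_u h" n] approx[OF assms(1) zero_J[of 1], of "in_u h" n]]
    by (simp add: * s1_def)
qed

lemma sb_in_v:
  assumes "X \<in> J 1" "Y \<in> J 1" shows "sb (in_v h) X Y = s1 h Y"
proof (rule J_eqI)
  fix n
  have 1: "(\<Sum>p<n. \<Sum>q<n. c (in_v h $ p $ q) * (X ^ p * Y ^ q)) = (\<Sum>q<n. c (h $ q) * Y ^ q)"
  proof -
    have "(\<Sum>p<n. \<Sum>q<n. c (in_v h $ p $ q) * (X ^ p * Y ^ q)) =
      (\<Sum>p<n. if p = 0 then \<Sum>q<n. c (h $ q) * Y ^ q else 0)"
      by (intro sum.cong) (auto simp: in_v_nth is_ring_hom_0[OF hom])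
    then show ?thesis by (cases "n = 0") (auto simp: sum.delta)
  qed
  have 2: "(\<Sum>p<n. \<Sum>q<n. c (in_u h $ p $ q) * (Y ^ p * 0 ^ q)) = (\<Sum>p<n. c (h $ p) * Y ^ p)"
  proof (intro sum.cong refl)
    fix p assume "p \<in> {..<n}"
    then have "(\<Sum>q<n. c (in_u h $ p $ q) * (Y ^ p * 0 ^ q)) =
        (\<Sum>q\<in>{0}. c (in_u h $ p $ q) * (Y ^ p * 0 ^ q))"
      by (intro sum.mono_neutral_right) (auto simp: in_u_nth is_ring_hom_0[OF hom])
    then show "(\<Sum>q<n. c (in_u h $ p $ q) * (Y ^ p * 0 ^ q)) = c (h $ p) * Y ^ p"
      by (simp add: in_u_nth)
  qed
  show "sb (in_v h) X Y - s1 h Y \<in> J n"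
    using J_diff[OF approx[OF assms, of "in_v h" n] approx[OF assms(2) zero_J[of 1], of "in_u h" n]]
    by (simp add: 1 2 s1_def)
qed

lemma in_u_add: "in_u (h + k) = in_u h + in_u (k :: 'a fps)"
  and in_u_mult: "in_u (h * k) = in_u h * in_u k"
  and in_u_uminus: "in_u (- h) = - in_u h"
  and in_u_const: "in_u (fps_const a) = fps_const (fps_const a)"
  by (auto simp: fps_eq_iff in_u_nth fps_mult_nth fps_sum_nth intro!: sum.neutral)

context
  fixes X assumes X: "X \<in> J 1"
begin

lemma s1_add: "s1 (h + k) X = s1 h X + s1 k X"
  unfolding s1_def in_u_add by (rule sb_add[OF X zero_J])

lemma s1_mult: "s1 (h * k) X = s1 h X * s1 k X"
  unfolding s1_def in_u_mult by (rule sb_mult[OF X zero_J])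

lemma s1_uminus: "s1 (- h) X = - s1 h X"
  unfolding s1_def in_u_uminus by (rule sb_uminus[OF X zero_J])

lemma s1_diff: "s1 (h - k) X = s1 h X - s1 k X"
  using s1_add[of h "- k"] by (simp add: s1_uminus)

lemma s1_const: "s1 (fps_const a) X = c a"
  unfolding s1_def in_u_const by (rule sb_const[OF X zero_J])

lemma s1_1: "s1 1 X = 1"
  using s1_const[of 1] hom by (simp add: is_ring_hom_def)

lemma s1_X: "s1 fps_X X = X"
  unfolding s1_def by (rule sb_u[OF X zero_J])

lemma s1_power: "s1 (h ^ n) X = s1 h X ^ n"
  by (induction n) (simp_all add: s1_1 s1_mult)

lemma s1_J: "h $ 0 = 0 \<Longrightarrow> s1 h X \<in> J 1"
  unfolding s1_def by (rule sb_ord[OF X zero_J]) (simp add: ord2_def in_u_nth)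

end

end

section \<open>Substitution into rings of series in two, three and one variables\<close>

lemma subst2_nth:
  assumes XY: "X \<in> ord2 1" "Y \<in> ord2 1" and N: "i + j \<le> N"
  shows "subst2 H X Y $ i $ j = (\<Sum>p\<le>N. \<Sum>q\<le>N. H $ p $ q * (X ^ p * Y ^ q) $ i $ j)"
proof -
  have pow: "Z ^ p \<in> ord2 p" if "Z \<in> ord2 1" for Z :: "'a fps fps" and p
    by (induction p) (use ord2_mult[of Z 1] that in \<open>auto simp: ord2_0\<close>)
  have 0: "(X ^ p * Y ^ q) $ i $ j = 0" if "i + j < p + q" for p q
    using ord2_mult[OF pow[OF XY(1)] pow[OF XY(2)], of p q] that by (simp add: ord2_def)
  have "(\<Sum>p\<le>i+j. \<Sum>q\<le>i+j. H $ p $ q * (X ^ p * Y ^ q) $ i $ j) =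
      (\<Sum>p\<le>i+j. \<Sum>q\<le>N. H $ p $ q * (X ^ p * Y ^ q) $ i $ j)"
    using N by (intro sum.cong sum.mono_neutral_left) (auto simp: 0)
  also have "\<dots> = (\<Sum>p\<le>N. \<Sum>q\<le>N. H $ p $ q * (X ^ p * Y ^ q) $ i $ j)"
    using N by (intro sum.mono_neutral_left) (auto simp: 0 intro!: sum.neutral)
  finally show ?thesis by (simp add: subst2_def)
qed

interpretation bi: substitution "\<lambda>a. fps_const (fps_const a)" ord2 subst2
proof
  show "is_ring_hom (\<lambda>a. fps_const (fps_const (a :: 'a)))"
    by (simp add: is_ring_hom_def)
  show "x = 0" if "\<And>n. x \<in> ord2 n" for x :: "'a fps fps"
  proof -
    have "x $ i $ j = 0" for i j
      using that[of "Suc (i + j)"] by (simp add: ord2_def)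
    then show ?thesis by (simp add: fps_eq_iff)
  qed
  fix X Y H :: "'a fps fps" and n
  assume XY: "X \<in> ord2 1" "Y \<in> ord2 1"
  have "subst2 H X Y $ i $ j = (\<Sum>p<n. \<Sum>q<n. H $ p $ q * (X ^ p * Y ^ q) $ i $ j)" if "i + j < n" for i j
    using subst2_nth[OF XY, of i j "n - 1" H] that
    by (simp add: lessThan_Suc_atMost[symmetric] del: lessThan_Suc)
  then show "subst2 H X Y - (\<Sum>p<n. \<Sum>q<n. fps_const (fps_const (H $ p $ q)) * (X ^ p * Y ^ q)) \<in> ord2 n"
    by (simp add: ord2_def fps_sum_nth)
qed (auto simp: ord2_0 ord2_diff ord2_mult, auto simp: ord2_def)

definition ord3 :: "nat \<Rightarrow> 'a::comm_ring_1 fps fps fps set"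
  where "ord3 n = {H. \<forall>i j k. i + j + k < n \<longrightarrow> H $ i $ j $ k = 0}"

lemma ord3_mult:
  assumes "x \<in> ord3 m" "y \<in> ord3 n" shows "x * y \<in> ord3 (m + n)"
proof -
  have "x $ a $ b $ d * y $ (i - a) $ (j - b) $ (k - d) = 0"
    if "i + j + k < m + n" "a \<le> i" "b \<le> j" "d \<le> k" for i j k a b d
  proof (cases "a + b + d < m")
    case False
    then have "(i - a) + (j - b) + (k - d) < n" using that by linarith
    then show ?thesis using assms(2) by (simp add: ord3_def)
  qed (use assms(1) in \<open>simp add: ord3_def\<close>)
  then show ?thesis
    by (auto simp: ord3_def fps_mult_nth fps_sum_nth intro!: sum.neutral)
qed

interpretation tri: substitution "\<lambda>a. fps_const (fps_const (fps_const a))" ord3 subst3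
proof
  show "is_ring_hom (\<lambda>a. fps_const (fps_const (fps_const (a :: 'a))))"
    by (simp add: is_ring_hom_def)
  show "x = 0" if "\<And>n. x \<in> ord3 n" for x :: "'a fps fps fps"
  proof -
    have "x $ i $ j $ k = 0" for i j k
      using that[of "Suc (i + j + k)"] by (simp add: ord3_def)
    then show ?thesis by (simp add: fps_eq_iff)
  qed
  fix X Y :: "'a fps fps fps" and H :: "'a fps fps" and n
  assume XY: "X \<in> ord3 1" "Y \<in> ord3 1"
  have pow: "Z ^ p \<in> ord3 p" if "Z \<in> ord3 1" for Z :: "'a fps fps fps" and p
    by (induction p) (use ord3_mult[of Z 1] that in \<open>auto simp: ord3_def\<close>)
  have 0: "(X ^ p * Y ^ q) $ i $ j $ k = 0" if "i + j + k < p + q" for p q i j k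
    using ord3_mult[OF pow[OF XY(1)] pow[OF XY(2)], of p q] that by (simp add: ord3_def)
  have "subst3 H X Y $ i $ j $ k = (\<Sum>p<n. \<Sum>q<n. H $ p $ q * (X ^ p * Y ^ q) $ i $ j $ k)"
    if "i + j + k < n" for i j k
  proof -
    have "(\<Sum>p\<le>i+j+k. \<Sum>q\<le>i+j+k. H $ p $ q * (X ^ p * Y ^ q) $ i $ j $ k) =
        (\<Sum>p\<le>i+j+k. \<Sum>q<n. H $ p $ q * (X ^ p * Y ^ q) $ i $ j $ k)"
      using that by (intro sum.cong sum.mono_neutral_left) (auto simp: 0)
    also have "\<dots> = (\<Sum>p<n. \<Sum>q<n. H $ p $ q * (X ^ p * Y ^ q) $ i $ j $ k)"
      using that by (intro sum.mono_neutral_left) (auto simp: 0 intro!: sum.neutral)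
    finally show ?thesis by (simp add: subst3_def)
  qed
  then show "subst3 H X Y - (\<Sum>p<n. \<Sum>q<n. fps_const (fps_const (fps_const (H $ p $ q))) * (X ^ p * Y ^ q)) \<in> ord3 n"
    by (simp add: ord3_def fps_sum_nth)
qed (auto simp: ord3_mult, auto simp: ord3_def)

definition ord1 :: "nat \<Rightarrow> 'a::comm_ring_1 fps set"
  where "ord1 n = {H. \<forall>i<n. H $ i = 0}"

text \<open>Needed for the diagonal \<open>Theta1(x, x)\<close> and for the root equation
  \<open>F(u, ubar) = 0\<close>, both of which land in one variable.\<close>

definition subst_uni :: "'a::comm_ring_1 fps fps \<Rightarrow> 'a fps \<Rightarrow> 'a fps \<Rightarrow> 'a fps"
  where "subst_uni H X Y = Abs_fps (\<lambda>i. \<Sum>p\<le>i. \<Sum>q\<le>i. H $ p $ q * (X ^ p * Y ^ q) $ i)"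

lemma ord1_mult:
  assumes "x \<in> ord1 m" "y \<in> ord1 n" shows "x * y \<in> ord1 (m + n)"
proof -
  have "x $ a * y $ (i - a) = 0" if "i < m + n" "a \<le> i" for i a
    using assms that by (cases "a < m") (auto simp: ord1_def)
  then show ?thesis
    by (auto simp: ord1_def fps_mult_nth intro!: sum.neutral)
qed

interpretation uni: substitution fps_const ord1 subst_uni
proof
  show "is_ring_hom (fps_const :: 'a \<Rightarrow> _)"
    by (simp add: is_ring_hom_def)
  show "x = 0" if "\<And>n. x \<in> ord1 n" for x :: "'a fps"
  proof -
    have "x $ i = 0" for i
      using that[of "Suc i"] by (simp add: ord1_def)
    then show ?thesis by (simp add: fps_eq_iff)
  qed
  fix X Y :: "'a fps" and H :: "'a fps fps" and n
  assume XY: "X \<in> ord1 1" "Y \<in> ord1 1"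
  have pow: "Z ^ p \<in> ord1 p" if "Z \<in> ord1 1" for Z :: "'a fps" and p
    by (induction p) (use ord1_mult[of Z 1] that in \<open>auto simp: ord1_def\<close>)
  have 0: "(X ^ p * Y ^ q) $ i = 0" if "i < p + q" for p q i
    using ord1_mult[OF pow[OF XY(1)] pow[OF XY(2)], of p q] that by (simp add: ord1_def)
  have "subst_uni H X Y $ i = (\<Sum>p<n. \<Sum>q<n. H $ p $ q * (X ^ p * Y ^ q) $ i)"
    if "i < n" for i
  proof -
    have "(\<Sum>p\<le>i. \<Sum>q\<le>i. H $ p $ q * (X ^ p * Y ^ q) $ i) =
        (\<Sum>p\<le>i. \<Sum>q<n. H $ p $ q * (X ^ p * Y ^ q) $ i)"
      using that by (intro sum.cong sum.mono_neutral_left) (auto simp: 0)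
    also have "\<dots> = (\<Sum>p<n. \<Sum>q<n. H $ p $ q * (X ^ p * Y ^ q) $ i)"
      using that by (intro sum.mono_neutral_left) (auto simp: 0 intro!: sum.neutral)
    finally show ?thesis by (simp add: subst_uni_def)
  qed
  then show "subst_uni H X Y - (\<Sum>p<n. \<Sum>q<n. fps_const (H $ p $ q) * (X ^ p * Y ^ q)) \<in> ord1 n"
    by (simp add: ord1_def fps_sum_nth)
qed (auto simp: ord1_mult, auto simp: ord1_def)

lemma bi_s1: "bi.s1 h X = subst1 h X"
proof -
  have "(\<Sum>q\<le>i+j. in_u h $ p $ q * (X ^ p * 0 ^ q) $ i $ j) = h $ p * (X ^ p) $ i $ j" for p i j
  proof -
    have "(\<Sum>q\<le>i+j. in_u h $ p $ q * (X ^ p * 0 ^ q) $ i $ j) =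
        (\<Sum>q\<in>{0}. in_u h $ p $ q * (X ^ p * 0 ^ q) $ i $ j)"
      by (intro sum.mono_neutral_right) (auto simp: in_u_nth)
    then show ?thesis by (simp add: in_u_nth)
  qed
  then show ?thesis
    by (simp add: bi.s1_def subst2_def subst1_def)
qed

lemma uni_s1: "uni.s1 h X = h oo X"
proof -
  have "(\<Sum>q\<le>i. in_u h $ p $ q * (X ^ p * 0 ^ q) $ i) = h $ p * (X ^ p) $ i" for p i
  proof -
    have "(\<Sum>q\<le>i. in_u h $ p $ q * (X ^ p * 0 ^ q) $ i) =
        (\<Sum>q\<in>{0}. in_u h $ p $ q * (X ^ p * 0 ^ q) $ i)"
      by (intro sum.mono_neutral_right) (auto simp: in_u_nth)
    then show ?thesis by (simp add: in_u_nth)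
  qed
  then show ?thesis
    by (simp add: uni.s1_def subst_uni_def fps_eq_iff fps_compose_nth atMost_atLeast0)
qed

lemma in_u_compose: "in_u (h oo a) = subst1 h (in_u a)"
proof -
  have pow: "in_u a ^ p = in_u (a ^ p)" for p
  proof (induction p)
    case 0
    show ?case by (auto simp: fps_eq_iff in_u_nth)
  next
    case (Suc p)
    then show ?case by (simp add: bi.in_u_mult)
  qed
  show ?thesis
    unfolding fps_eq_iff
  proof (intro allI)
    fix i j
    show "in_u (h oo a) $ i $ j = subst1 h (in_u a) $ i $ j"
      by (cases "j = 0") (auto simp: subst1_def pow in_u_nth fps_compose_nth atMost_atLeast0)
  qed
qed

lemma in_v_compose: "a $ 0 = 0 \<Longrightarrow> in_v (h oo a) = subst1 h (in_v a)"
proof -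
  assume a: "a $ 0 = 0"
  have pow: "in_v a ^ p = in_v (a ^ p)" for p
    by (simp add: in_v_def)
  show ?thesis
    unfolding fps_eq_iff
  proof (intro allI)
    fix i j
    show "in_v (h oo a) $ i $ j = subst1 h (in_v a) $ i $ j"
      by (cases "i = 0") (auto simp: subst1_def pow in_v_nth fps_compose_nth atMost_atLeast0)
  qed
qed

context substitution
begin

text \<open>Modulo \<open>ord2 n\<close> the inner substitution is a polynomial in \<open>A\<close>
  and \<open>B\<close>, which the outer one respects as a ring homomorphism. This allows a change of
  coordinates inside a series that is itself a substitution.\<close>

theorem sb_subst2:
  assumes AB: "A \<in> ord2 1" "B \<in> ord2 1" and XY: "X \<in> J 1" "Y \<in> J 1"
  shows "sb (subst2 H A B) X Y = sb H (sb A X Y) (sb B X Y)"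
proof (rule J_eqI)
  fix n
  let ?T = "\<Sum>p<n. \<Sum>q<n. fps_const (fps_const (H $ p $ q)) * (A ^ p * B ^ q)"
  have "sb ?T X Y = (\<Sum>p<n. \<Sum>q<n. c (H $ p $ q) * (sb A X Y ^ p * sb B X Y ^ q))"
    by (simp only: sb_sum[OF XY] sb_mult[OF XY] sb_const[OF XY] sb_power[OF XY])
  then show "sb (subst2 H A B) X Y - sb H (sb A X Y) (sb B X Y) \<in> J n"
    using J_diff[OF sb_cong_ord[OF XY bi.approx[OF AB, of H n]]
        approx[OF sb_ord[OF XY AB(1)] sb_ord[OF XY AB(2)], of H n]]
    by (simp add: algebra_simps)
qed

lemma sb_subst1:
  assumes "A \<in> ord2 1" and XY: "X \<in> J 1" "Y \<in> J 1"
  shows "sb (subst1 h A) X Y = s1 h (sb A X Y)"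
  unfolding bi_s1[symmetric] bi.s1_def s1_def using sb_subst2[OF assms(1) _ XY, of 0 "in_u h"]
  by (simp add: ord2_def sb_0[OF XY])

lemma s1_compose:
  assumes "a $ 0 = 0" and X: "X \<in> J 1"
  shows "s1 (h oo a) X = s1 h (s1 a X)"
  unfolding s1_def[of "h oo a"] in_u_compose
  by (subst sb_subst1[OF _ X zero_J]) (auto simp: ord2_def in_u_nth assms s1_def)

end

context substitution
begin

text \<open>Applying \<open>g\<close> to \<open>F(X, Y)\<close> gives \<open>g(X) + g(Y)\<close>,
  and \<open>f\<close> undoes \<open>g\<close>. Every later computation with a group law passes to
  addition in this way.\<close>

lemma sb_logarithm:
  assumes g: "g $ 0 = 0" "f oo g = fps_X" and log: "subst1 g F = in_u g + in_v g"
    and F: "F \<in> ord2 1" and XY: "X \<in> J 1" "Y \<in> J 1"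
  shows "sb F X Y = s1 f (s1 g X + s1 g Y)"
proof -
  have FJ: "sb F X Y \<in> J 1"
    by (rule sb_ord[OF XY F])
  have "s1 g (sb F X Y) = s1 g X + s1 g Y"
    by (simp add: sb_subst1[OF F XY, symmetric] log sb_add[OF XY] sb_in_u[OF XY] sb_in_v[OF XY])
  then show ?thesis
    using s1_compose[OF g(1) FJ, of f] by (simp add: g(2) s1_X[OF FJ])
qed

end

section \<open>Composition of one-variable series over a commutative ring\<close>

lemma compose_assoc:
  fixes h :: "'a::comm_ring_1 fps"
  assumes "a $ 0 = 0" "b $ 0 = 0" shows "(h oo a) oo b = h oo (a oo b)"
  using uni.s1_compose[of a b h] assms by (simp add: uni_s1 ord1_def)

lemma compose_mult:
  fixes h k :: "'a::comm_ring_1 fps"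
  assumes "a $ 0 = 0" shows "(h * k) oo a = (h oo a) * (k oo a)"
  using uni.s1_mult[of a h k] assms by (simp add: uni_s1 ord1_def)

lemma compose_power:
  fixes h :: "'a::comm_ring_1 fps"
  assumes "a $ 0 = 0" shows "(h ^ n) oo a = (h oo a) ^ n"
  using uni.s1_power[of a h n] assms by (simp add: uni_s1 ord1_def)

lemma X_compose:
  fixes a :: "'a::comm_ring_1 fps"
  assumes "a $ 0 = 0" shows "fps_X oo a = a"
  using uni.s1_X[of a] assms by (simp add: uni_s1 ord1_def)

lemma compose_const: "fps_const c oo (a :: 'a::comm_ring_1 fps) = fps_const c"
  by (simp add: fps_eq_iff fps_compose_nth)

lemma chain_rule:
  fixes h :: "'a::comm_ring_1 fps"
  assumes "a $ 0 = 0" shows "fps_deriv (h oo a) = (fps_deriv h oo a) * fps_deriv a"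
proof (rule fps_ext)
  fix n
  have pow: "(a ^ p) $ i = 0" if "i < p" for p i
    using startsby_zero_power_prefix[OF assms] that by blast
  have "fps_deriv (h oo a) $ n = (\<Sum>p\<in>{0..Suc n}. h $ p * fps_deriv (a ^ p) $ n)"
    by (simp only: fps_deriv_nth fps_compose_nth sum_distrib_left Suc_eq_plus1[symmetric])
       (intro sum.cong refl mult.left_commute)
  also have "\<dots> = (\<Sum>p\<in>{0..n}. h $ Suc p * fps_deriv (a ^ Suc p) $ n)"
    by (subst sum.atLeast0_atMost_Suc_shift) (simp del: power_Suc fps_deriv_nth)
  also have "\<dots> = (\<Sum>p\<in>{0..n}. fps_deriv h $ p * (\<Sum>i=0..n. (a ^ p) $ i * fps_deriv a $ (n - i)))"
  proof (intro sum.cong refl)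
    fix p
    have "fps_deriv (a ^ Suc p) = fps_const (of_nat (Suc p)) * (a ^ p * fps_deriv a)"
      by (simp only: fps_deriv_power diff_Suc_1 mult_ac)
    then have "fps_deriv (a ^ Suc p) $ n = of_nat (Suc p) * (a ^ p * fps_deriv a) $ n"
      by (simp only: fps_mult_left_const_nth)
    then show "h $ Suc p * fps_deriv (a ^ Suc p) $ n =
        fps_deriv h $ p * (\<Sum>i=0..n. (a ^ p) $ i * fps_deriv a $ (n - i))"
      unfolding fps_mult_nth[symmetric]
      by (simp only: fps_deriv_nth[of h] Suc_eq_plus1 mult_ac)
  qed
  also have "\<dots> = (\<Sum>i=0..n. (\<Sum>p\<in>{0..n}. fps_deriv h $ p * (a ^ p) $ i) * fps_deriv a $ (n - i))"
    unfolding sum_distrib_left sum_distrib_right by (subst sum.swap) (simp add: mult_ac)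
  also have "\<dots> = (\<Sum>i=0..n. (fps_deriv h oo a) $ i * fps_deriv a $ (n - i))"
  proof (intro sum.cong refl)
    fix i assume "i \<in> {0..n}"
    then have "(\<Sum>p\<in>{0..n}. fps_deriv h $ p * (a ^ p) $ i) = (\<Sum>p\<in>{0..i}. fps_deriv h $ p * (a ^ p) $ i)"
      by (intro sum.mono_neutral_right) (auto simp: pow)
    then show "(\<Sum>p\<in>{0..n}. fps_deriv h $ p * (a ^ p) $ i) * fps_deriv a $ (n - i) =
        (fps_deriv h oo a) $ i * fps_deriv a $ (n - i)"
      by (simp only: fps_compose_nth)
  qed
  finally show "fps_deriv (h oo a) $ n = ((fps_deriv h oo a) * fps_deriv a) $ n"
    by (simp only: fps_mult_nth)
qed

section \<open>Series starting with minus a square\<close>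

definition quadratic_start :: "'a::comm_ring_1 fps \<Rightarrow> bool"
  where "quadratic_start x \<longleftrightarrow> x $ 0 = 0 \<and> x $ 1 = 0 \<and> x $ 2 = - 1"

lemma quadratic_start_power:
  assumes "quadratic_start x"
  shows "i < 2 * p \<Longrightarrow> (x ^ p) $ i = 0" "(x ^ p) $ (2 * p) = (- 1) ^ p"
proof -
  define y where "y = fps_shift 2 x"
  have "x = y * fps_X ^ 2"
  proof (rule fps_ext)
    fix n :: nat
    have "n = 0 \<or> n = 1 \<or> n = (n - 2) + 2" by arith
    then consider "n = 0" | "n = 1" | m where "n = m + 2" by blast
    then show "x $ n = (y * fps_X ^ 2) $ n"
      using assms by cases (auto simp: y_def quadratic_start_def fps_X_power_mult_right_nth)
  qed
  then have "x ^ p = y ^ p * fps_X ^ (2 * p)"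
    by (simp add: power_mult_distrib power_mult)
  moreover have "y $ 0 = - 1"
    using assms by (simp add: y_def quadratic_start_def numeral_2_eq_2)
  ultimately show "i < 2 * p \<Longrightarrow> (x ^ p) $ i = 0" "(x ^ p) $ (2 * p) = (- 1) ^ p"
    by (simp_all add: fps_X_power_mult_right_nth fps_power_zeroth)
qed

text \<open>Degree \<open>2 * n\<close> is the first in which \<open>h $ n\<close> enters
  \<open>h oo x\<close>, and there it has the unit factor \<open>(- 1) ^ n\<close>. Identities
  verified in the logarithmic coordinate can thus be stripped of \<open>phi\<close>.\<close>

lemma compose_quadratic_inj:
  assumes x: "quadratic_start x" and eq: "h oo x = k oo x"
  shows "h = k"
proof -
  have "h $ n = k $ n" for n
  proof (induction n rule: less_induct)
    case (less n)
    have *: "(l oo x) $ (2 * n) = (\<Sum>p<n. l $ p * (x ^ p) $ (2 * n)) + l $ n * (- 1) ^ n" for l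
    proof -
      have "(l oo x) $ (2 * n) = (\<Sum>p\<le>n. l $ p * (x ^ p) $ (2 * n))"
        unfolding fps_compose_nth
        by (intro sum.mono_neutral_right) (auto simp: quadratic_start_power(1)[OF x])
      then show ?thesis
        by (simp add: lessThan_Suc_atMost[symmetric] quadratic_start_power(2)[OF x])
    qed
    have "h $ n * (- 1) ^ n = k $ n * (- 1) ^ n"
      using arg_cong[OF eq, of "\<lambda>s. s $ (2 * n)"] less by (simp add: *)
    then have "h $ n * (- 1) ^ n * (- 1) ^ n = k $ n * (- 1) ^ n * (- 1) ^ n"
      by simp
    then show ?case
      by (simp add: mult.assoc flip: power_mult_distrib)
  qed
  then show ?thesis by (simp add: fps_eq_iff)
qed

lemma in_u_power: "in_u (h ^ p) = in_u h ^ p" for h :: "'a::comm_ring_1 fps"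
proof (induction p)
  case (Suc p)
  then show ?case by (simp add: bi.in_u_mult)
qed (auto simp: fps_eq_iff in_u_nth)

lemma in_v_power: "in_v (h ^ p) = in_v h ^ p" for h :: "'a::comm_ring_1 fps"
  by (simp add: in_v_def)

lemma in_u_in_v_nth: "(in_u h * in_v k) $ i $ j = h $ i * k $ j" for h :: "'a::comm_ring_1 fps"
  by (simp add: in_u_def in_v_def)

lemma subst2_split_nth:
  fixes x :: "'a::comm_ring_1 fps"
  assumes x: "x $ 0 = 0" "y $ 0 = 0"
  shows "subst2 H (in_u x) (in_v y) $ i $ j = (\<Sum>p\<le>i. \<Sum>q\<le>j. H $ p $ q * ((x ^ p) $ i * (y ^ q) $ j))"
proof -
  have pow: "(z ^ p) $ i = 0" if "i < p" "z $ 0 = 0" for p i and z :: "'a fps"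
    using startsby_zero_power_prefix[OF that(2)] that(1) by blast
  have "subst2 H (in_u x) (in_v y) $ i $ j =
      (\<Sum>p\<le>i+j. \<Sum>q\<le>i+j. H $ p $ q * ((x ^ p) $ i * (y ^ q) $ j))"
    by (simp add: subst2_def in_u_in_v_nth flip: in_u_power in_v_power)
  also have "\<dots> = (\<Sum>p\<le>i+j. \<Sum>q\<le>j. H $ p $ q * ((x ^ p) $ i * (y ^ q) $ j))"
    by (intro sum.cong sum.mono_neutral_right) (auto simp: pow x)
  also have "\<dots> = (\<Sum>p\<le>i. \<Sum>q\<le>j. H $ p $ q * ((x ^ p) $ i * (y ^ q) $ j))"
    by (intro sum.mono_neutral_right) (auto simp: pow x intro!: sum.neutral)
  finally show ?thesis .
qed

text \<open>A triangular system read off at even exponents: the diagonal entry is the sign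
  \<open>(- 1) ^ (p + q)\<close>, so solving for \<open>H $ p $ q\<close> introduces no denominator.
  Symmetry, weights and p-integrality of the two-valued law are all obtained from this
  recursion.\<close>

lemma subst2_quadratic_nth:
  fixes x :: "'a::comm_ring_1 fps"
  assumes x: "quadratic_start x"
  shows "H $ p $ q = (- 1) ^ (p + q) * (subst2 H (in_u x) (in_v x) $ (2 * p) $ (2 * q) -
    (\<Sum>(p', q')\<in>{..p} \<times> {..q} - {(p, q)}. H $ p' $ q' * ((x ^ p') $ (2 * p) * (x ^ q') $ (2 * q))))"
proof -
  have "subst2 H (in_u x) (in_v x) $ (2 * p) $ (2 * q) =
      (\<Sum>p'\<le>2 * p. \<Sum>q'\<le>2 * q. H $ p' $ q' * ((x ^ p') $ (2 * p) * (x ^ q') $ (2 * q)))"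
    using x by (intro subst2_split_nth) (auto simp: quadratic_start_def)
  also have "\<dots> = (\<Sum>p'\<le>2 * p. \<Sum>q'\<le>q. H $ p' $ q' * ((x ^ p') $ (2 * p) * (x ^ q') $ (2 * q)))"
    by (intro sum.cong sum.mono_neutral_right) (auto simp: quadratic_start_power(1)[OF x])
  also have "\<dots> = (\<Sum>p'\<le>p. \<Sum>q'\<le>q. H $ p' $ q' * ((x ^ p') $ (2 * p) * (x ^ q') $ (2 * q)))"
    by (intro sum.mono_neutral_right) (auto simp: quadratic_start_power(1)[OF x] intro!: sum.neutral)
  also have "\<dots> = (\<Sum>(p', q')\<in>{..p} \<times> {..q}. H $ p' $ q' * ((x ^ p') $ (2 * p) * (x ^ q') $ (2 * q)))"
    by (rule sum.cartesian_product)
  also have "\<dots> = H $ p $ q * ((- 1) ^ p * (- 1) ^ q) +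
      (\<Sum>(p', q')\<in>{..p} \<times> {..q} - {(p, q)}. H $ p' $ q' * ((x ^ p') $ (2 * p) * (x ^ q') $ (2 * q)))"
    by (subst sum.remove[of _ "(p, q)"]) (auto simp: quadratic_start_power(2)[OF x])
  finally have "subst2 H (in_u x) (in_v x) $ (2 * p) $ (2 * q) -
      (\<Sum>(p', q')\<in>{..p} \<times> {..q} - {(p, q)}. H $ p' $ q' * ((x ^ p') $ (2 * p) * (x ^ q') $ (2 * q))) =
      H $ p $ q * (- 1) ^ (p + q)"
    by (simp add: power_add)
  moreover have "(- 1 :: 'a) ^ (p + q) * (- 1) ^ (p + q) = 1"
    by (simp flip: power_mult_distrib)
  ultimately show ?thesis
    by (simp add: mult.left_commute)
qed

lemma subst2_quadratic_symmetric:
  fixes x :: "'a::comm_ring_1 fps"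
  assumes x: "quadratic_start x"
    and Z: "\<And>i j. subst2 H (in_u x) (in_v x) $ i $ j = subst2 H (in_u x) (in_v x) $ j $ i"
  shows "H $ p $ q = H $ q $ p"
proof (induction "p + q" arbitrary: p q rule: less_induct)
  case less
  have "(\<Sum>(p', q')\<in>{..p} \<times> {..q} - {(p, q)}. H $ p' $ q' * ((x ^ p') $ (2 * p) * (x ^ q') $ (2 * q))) =
      (\<Sum>(q', p')\<in>{..q} \<times> {..p} - {(q, p)}. H $ q' $ p' * ((x ^ q') $ (2 * q) * (x ^ p') $ (2 * p)))"
  proof (rule sum.reindex_bij_witness[where i = prod.swap and j = prod.swap])
    fix a assume "a \<in> {..p} \<times> {..q} - {(p, q)}"
    then obtain p' q' where a: "a = (p', q')" "p' \<le> p" "q' \<le> q" "(p', q') \<noteq> (p, q)" by auto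
    then have "p' + q' < p + q" by auto
    from less[OF this] show "(case prod.swap a of (q', p') \<Rightarrow> H $ q' $ p' * ((x ^ q') $ (2 * q) * (x ^ p') $ (2 * p))) =
      (case a of (p', q') \<Rightarrow> H $ p' $ q' * ((x ^ p') $ (2 * p) * (x ^ q') $ (2 * q)))"
      by (simp add: a mult_ac)
  qed auto
  then show ?case
    unfolding subst2_quadratic_nth[OF x, of H p q] subst2_quadratic_nth[OF x, of H q p]
    by (simp add: Z[of "2 * p"] add.commute)
qed

lemma in_u_X: "in_u fps_X = (fps_X :: 'a::comm_ring_1 fps fps)"
  by (auto simp: fps_eq_iff in_u_nth fps_X_def)

text \<open>The binomial theorem; \<open>s = 1\<close> and \<open>s = - 1\<close> produce the two
  arguments \<open>w + t\<close> and \<open>w - t\<close> of the addition formulas.\<close>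

lemma subst1_linear_nth:
  fixes h :: "'a::comm_ring_1 fps"
  shows "subst1 h (in_u fps_X + fps_const (fps_const s) * in_v fps_X) $ i $ j =
    of_nat ((i + j) choose i) * s ^ j * h $ (i + j)"
proof -
  have pow: "((in_u fps_X + fps_const (fps_const s) * in_v fps_X) ^ p) $ i $ j =
      (if p = i + j then of_nat (p choose i) * s ^ j else 0)" for p i j
  proof -
    have "(in_u fps_X + fps_const (fps_const s) * in_v fps_X) ^ p =
        (\<Sum>k\<le>p. monomial2 (of_nat (p choose k) * s ^ (p - k)) k (p - k))"
      unfolding binomial_ring
    proof (intro sum.cong refl)
      fix k
      have "of_nat (p choose k) = (fps_const (fps_const (of_nat (p choose k))) :: 'a fps fps)"
        by (simp only: fps_of_nat)
      then show "of_nat (p choose k) * in_u fps_X ^ k * (fps_const (fps_const s) * in_v fps_X) ^ (p - k) =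
          monomial2 (of_nat (p choose k) * s ^ (p - k)) k (p - k)"
        by (simp only: monomial2_def in_u_X in_v_def power_mult_distrib fps_const_power
            fps_const_mult[symmetric] mult_ac)
    qed
    then have "((in_u fps_X + fps_const (fps_const s) * in_v fps_X) ^ p) $ i $ j =
        (\<Sum>k\<le>p. if k = i then if j = p - i then of_nat (p choose i) * s ^ j else 0 else 0)"
      by (simp only: fps_sum_nth monomial2_nth) (intro sum.cong, auto)
    then show ?thesis by (auto simp: sum.delta)
  qed
  show ?thesis
    by (simp add: subst1_def pow if_distrib[of "\<lambda>x. _ * x"] cong: if_cong)
qed

section \<open>The law in logarithmic coordinates\<close>

lemma formal_group_law_nth_0:
  assumes "formal_group_law F"
  shows "F $ i $ 0 = (if i = 1 then 1 else 0)" "F $ 0 $ i = (if i = 1 then 1 else 0)"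
proof -
  have u: "subst2 F (in_u fps_X) 0 = in_u fps_X" and v: "subst2 F 0 (in_v fps_X) = in_v fps_X"
    using assms by (simp_all add: formal_group_law_def)
  have 0: "in_v 0 = (0 :: 'a fps fps)" "in_u 0 = (0 :: 'a fps fps)"
    by (simp_all add: fps_eq_iff in_v_nth in_u_nth)
  have "subst2 F (in_u fps_X) 0 $ i $ 0 = F $ i $ 0"
    using subst2_split_nth[of fps_X 0 F i 0] by (simp add: 0 fps_X_power_nth sum.delta if_distrib[of "\<lambda>x. _ * x"] cong: if_cong)
  then show "F $ i $ 0 = (if i = 1 then 1 else 0)"
    by (simp add: u in_u_nth)
  have "subst2 F 0 (in_v fps_X) $ 0 $ i = F $ 0 $ i"
    using subst2_split_nth[of 0 fps_X F 0 i] by (simp add: 0 fps_X_power_nth sum.delta if_distrib[of "\<lambda>x. _ * x"] cong: if_cong)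
  then show "F $ 0 $ i = (if i = 1 then 1 else 0)"
    by (simp add: v in_v_nth)
qed

lemma ord2_1: "H \<in> ord2 (Suc 0) \<longleftrightarrow> H $ 0 $ 0 = 0"
  by (auto simp: ord2_def)

lemma ord1_1: "h \<in> ord1 (Suc 0) \<longleftrightarrow> h $ 0 = 0"
  by (auto simp: ord1_def)

text \<open>Stated over any ring in which nonzero integers are invertible, because it is used twice:
  over the rationalized cobordism ring for membership, and over Laurent series for
  primitivity.\<close>

locale two_valued_group =
  fixes F :: "'a::comm_ring_1 fps fps" and g f ubar B :: "'a fps" and Theta1 Theta2 :: "'a fps fps"
  assumes units: "\<And>k::int. k \<noteq> 0 \<Longrightarrow> (of_int k :: 'a) dvd 1"
    and F0: "F $ 0 $ 0 = 0"
    and log: "is_logarithm F g"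
    and exp: "f $ 0 = 0" "f oo g = fps_X" "g oo f = fps_X"
    and inverse: "ubar = f oo (- g)"
    and B: "B $ 0 = 0" "B $ 1 = 1" "B oo (fps_X * ubar) = - (g ^ 2)"
    and two_valued: "two_valued_law F ubar Theta1 Theta2"
begin

lemma of_int_cancel: "k \<noteq> 0 \<Longrightarrow> of_int k * x = of_int k * (y :: 'a) \<Longrightarrow> x = y"
  using units[of k] by (metis dvdE mult.commute mult.left_commute mult.left_neutral)

lemma g0: "g $ 0 = 0" and g1: "g $ 1 = 1" and log_sum: "subst1 g F = in_u g + in_v g"
  using log by (simp_all add: is_logarithm_def)

lemma f1: "f $ 1 = 1"
  using arg_cong[OF exp(2), of "\<lambda>h. h $ 1"] g0 g1 exp(1) by (simp add: fps_compose_nth)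

lemma F_ord: "F \<in> ord2 1"
  by (simp add: ord2_1 F0)

definition phi :: "'a fps" where "phi = f * (f oo - fps_X)"

lemma ubar_f: "ubar oo f = f oo - fps_X"
  by (simp add: inverse compose_assoc g0 exp fps_compose_uminus)

lemma ubar0: "ubar $ 0 = 0"
  by (simp add: inverse exp)

lemma xf: "(fps_X * ubar) oo f = phi"
  by (simp add: compose_mult X_compose exp(1) ubar_f phi_def)

lemma B_phi: "B oo phi = - (fps_X ^ 2)"
proof -
  have "B oo phi = (B oo (fps_X * ubar)) oo f"
    by (simp add: compose_assoc exp(1) flip: xf)
  then show ?thesis
    by (simp add: B fps_compose_uminus compose_power exp)
qed

lemma phi_start: "quadratic_start phi"
  using exp(1) f1
  by (simp add: quadratic_start_def phi_def fps_compose_uminus' fps_mult_nth numeral_2_eq_2)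

lemma phi0: "phi $ 0 = 0"
  using phi_start by (simp add: quadratic_start_def)

lemma phi_odd: "odd n \<Longrightarrow> phi $ n = 0"
proof -
  assume n: "odd n"
  have "phi oo - fps_X = (f oo - fps_X) * (f oo (- fps_X oo - fps_X))"
    by (simp add: phi_def compose_mult compose_assoc)
  also have "- fps_X oo - fps_X = (fps_X :: 'a fps)"
    by (simp add: fps_compose_uminus X_compose)
  finally have "phi oo - fps_X = phi"
    by (simp add: phi_def mult.commute)
  from arg_cong[OF this, of "\<lambda>h. h $ n"] n have "- phi $ n = phi $ n"
    by (simp add: fps_compose_uminus')
  then have "of_int 2 * phi $ n = of_int 2 * 0"
    by (simp add: eq_neg_iff_add_eq_0 neg_eq_iff_add_eq_0)
  then show ?thesis by (rule of_int_cancel[rotated]) simp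
qed

section \<open>The law as an addition theorem for \<open>phi\<close>\<close>

abbreviation "sum_uv \<equiv> (in_u fps_X + in_v fps_X :: 'a fps fps)"
abbreviation "diff_uv \<equiv> (in_u fps_X - in_v fps_X :: 'a fps fps)"

lemma ord2_uv: "in_u h \<in> ord2 (Suc 0) \<longleftrightarrow> h $ 0 = 0" "in_v h \<in> ord2 (Suc 0) \<longleftrightarrow> h $ 0 = 0"
    "sum_uv \<in> ord2 (Suc 0)" "diff_uv \<in> ord2 (Suc 0)"
  by (simp_all add: ord2_1 in_u_nth in_v_nth)

lemma subst2_F_exp:
  assumes a: "a $ 0 = 0" and b: "b $ 0 = 0"
  shows "subst2 (subst2 F (in_u a) (in_v b)) (in_u f) (in_v f) =
    subst1 f (in_u (g oo (a oo f)) + in_v (g oo (b oo f)))"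
proof -
  have f: "in_u f \<in> ord2 1" "in_v f \<in> ord2 1"
    by (simp_all add: ord2_uv exp)
  have "subst2 (subst2 F (in_u a) (in_v b)) (in_u f) (in_v f) =
      subst2 F (in_u (a oo f)) (in_v (b oo f))"
    by (simp add: bi.sb_subst2 ord2_uv a b f bi.sb_in_u bi.sb_in_v bi_s1 in_u_compose in_v_compose exp(1))
  also have "\<dots> = subst1 f (subst1 g (in_u (a oo f)) + subst1 g (in_v (b oo f)))"
    using a b by (subst bi.sb_logarithm[OF g0 exp(2) log_sum F_ord]) (simp_all add: ord2_uv bi_s1)
  finally show ?thesis
    using a b by (simp add: in_u_compose[of g] in_v_compose[of _ g])
qed

lemma subst1_uminus:
  assumes "Z \<in> ord2 1"
  shows "subst1 f (- Z) = subst1 (f oo - fps_X) Z"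
  using bi.s1_compose[OF _ assms, of "- fps_X" f] bi.s1_uminus[OF assms, of fps_X] bi.s1_X[OF assms]
  by (simp add: bi_s1)

lemma subst1_phi: "Z \<in> ord2 (Suc 0) \<Longrightarrow> subst1 f Z * subst1 f (- Z) = subst1 phi Z"
  using bi.s1_mult[of Z f "f oo - fps_X"] by (simp add: subst1_uminus bi_s1 phi_def)

lemma g_ubar_f: "g oo (ubar oo f) = - fps_X"
  using compose_assoc[of f "- fps_X" g] by (simp add: ubar_f exp X_compose)

lemma in_uminus: "in_u (- h) = - in_u (h :: 'a fps)" "in_v (- h) = - in_v h"
  by (simp_all add: fps_eq_iff in_u_nth in_v_nth)

text \<open>With \<open>u = f(w)\<close> and \<open>v = f(t)\<close> the two factors become
  \<open>f(w + t)\<close> and \<open>f(- (w + t))\<close>, whose product is \<open>phi\<close> at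
  \<open>w + t\<close>.\<close>

lemma z_plus_f: "subst2 (z_plus F ubar) (in_u f) (in_v f) = subst1 phi sum_uv"
proof -
  have f: "in_u f \<in> ord2 1" "in_v f \<in> ord2 1"
    by (simp_all add: ord2_uv exp)
  show ?thesis
    using subst1_phi[OF ord2_uv(3)]
    by (simp add: z_plus_def bi.sb_mult[OF f] subst2_F_exp ubar0 X_compose exp g_ubar_f in_uminus add.commute)
qed

lemma z_minus_f: "subst2 (z_minus F ubar) (in_u f) (in_v f) = subst1 phi diff_uv"
proof -
  have f: "in_u f \<in> ord2 1" "in_v f \<in> ord2 1"
    by (simp_all add: ord2_uv exp)
  show ?thesis
    using subst1_phi[OF ord2_uv(4)]
    by (simp add: z_minus_def bi.sb_mult[OF f] subst2_F_exp ubar0 X_compose exp g_ubar_f in_uminus add.commute)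
qed

lemma Theta_f:
  "subst2 (subst2 Theta (in_u (fps_X * ubar)) (in_v (fps_X * ubar))) (in_u f) (in_v f) =
    subst2 Theta (in_u phi) (in_v phi)"
  by (subst bi.sb_subst2)
     (simp_all add: ord2_uv exp bi.sb_in_u bi.sb_in_v bi_s1 flip: in_u_compose in_v_compose xf)

theorem Theta1_phi: "subst2 Theta1 (in_u phi) (in_v phi) = subst1 phi sum_uv + subst1 phi diff_uv"
proof -
  have f: "in_u f \<in> ord2 1" "in_v f \<in> ord2 1"
    by (simp_all add: ord2_uv exp)
  show ?thesis
    using two_valued unfolding two_valued_law_def
    by (simp add: Theta_f[symmetric] bi.sb_add[OF f] z_plus_f z_minus_f)
qed

theorem Theta2_phi: "subst2 Theta2 (in_u phi) (in_v phi) = subst1 phi sum_uv * subst1 phi diff_uv"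
proof -
  have f: "in_u f \<in> ord2 1" "in_v f \<in> ord2 1"
    by (simp_all add: ord2_uv exp)
  show ?thesis
    using two_valued unfolding two_valued_law_def
    by (simp add: Theta_f[symmetric] bi.sb_mult[OF f] z_plus_f z_minus_f)
qed

lemma phi_sum_nth: "subst1 phi sum_uv $ i $ j = of_nat ((i + j) choose i) * phi $ (i + j)"
  using subst1_linear_nth[of phi 1 i j] by simp

lemma phi_diff_nth: "subst1 phi diff_uv $ i $ j = of_nat ((i + j) choose i) * (- 1) ^ j * phi $ (i + j)"
  using subst1_linear_nth[of phi "- 1" i j] by (simp flip: fps_const_neg)

text \<open>The summand \<open>phi(w - t)\<close> is symmetric because \<open>phi\<close> is even,
  and the triangular recursion carries symmetry over to the coefficients.\<close>

lemma Theta1_symmetric: "Theta1 $ p $ q = Theta1 $ q $ p"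
proof (rule subst2_quadratic_symmetric[OF phi_start])
  fix i j
  show "subst2 Theta1 (in_u phi) (in_v phi) $ i $ j = subst2 Theta1 (in_u phi) (in_v phi) $ j $ i"
  proof (cases "even (i + j)")
    case True
    then have "(- 1 :: 'a) ^ i = (- 1) ^ j"
      by (auto simp: minus_one_power_iff)
    moreover have "(i + j) choose i = (i + j) choose j"
      by (metis add_diff_cancel_left' binomial_symmetric le_add1)
    ultimately show ?thesis
      by (simp add: Theta1_phi phi_sum_nth phi_diff_nth add.commute[of j])
  next
    case False
    then show ?thesis
      by (simp add: Theta1_phi phi_sum_nth phi_diff_nth phi_odd add.commute[of j])
  qed
qed

section \<open>The differential equation for \<open>B\<close>\<close>

lemma row_2: "subst2 H (in_u phi) (in_v phi) $ 2 = - (H $ 1 oo phi)"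
proof (rule fps_ext)
  fix j
  \<comment> \<open>Only the first power of \<open>phi\<close> contributes in degree 2: the zeroth
    is constant and the square already starts in degree 4.\<close>
  have "phi $ 0 = 0" "phi $ Suc 0 = 0" "phi $ 2 = - 1"
    using phi_start by (simp_all add: quadratic_start_def)
  then have "\<And>q. (phi ^ q) $ 0 = 0 ^ q" "(phi ^ 2) $ 2 = 0"
    by (simp_all add: fps_power_zeroth power2_eq_square fps_mult_nth numeral_2_eq_2)
  then show "subst2 H (in_u phi) (in_v phi) $ 2 $ j = (- (H $ 1 oo phi)) $ j"
    using phi_start
    by (subst subst2_split_nth)
       (simp_all add: phi0 numeral_2_eq_2 quadratic_start_def fps_compose_nth sum_negf atMost_atLeast0)
qed

text \<open>The series \<open>P\<close> of the overview. Up to the common sign of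
  \<open>row_2\<close>, the coefficient of \<open>w^2\<close> gives
  \<open>phi phi'' - phi'^2\<close> for the product and \<open>phi''\<close> for the sum.
  Subtracting \<open>x\<close> times the row of \<open>Theta1\<close> cancels the second
  derivative.\<close>

definition "quartic = Theta2 $ 1 - fps_X * Theta1 $ 1"

lemma second_deriv_nth:
  "fps_deriv (fps_deriv phi) $ j = of_nat 2 * (of_nat (Suc (Suc j) choose 2) * phi $ Suc (Suc j))"
proof -
  have "2 * (Suc (Suc j) choose 2) = (j + 1) * (j + 2)"
    by (simp add: choose_two)
  then have "of_nat 2 * of_nat (Suc (Suc j) choose 2) = (of_nat (j + 1) * of_nat (j + 2) :: 'a)"
    by (metis of_nat_mult)
  then have "of_nat 2 * (of_nat (Suc (Suc j) choose 2) * phi $ Suc (Suc j)) =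
      of_nat (j + 1) * of_nat (j + 2) * phi $ Suc (Suc j)"
    by (simp only: mult.assoc[symmetric])
  then show ?thesis by (simp add: mult.assoc del: of_nat_Suc)
qed

lemma Theta1_row: "Theta1 $ 1 oo phi = - fps_deriv (fps_deriv phi)"
proof -
  have "subst2 Theta1 (in_u phi) (in_v phi) $ 2 = fps_deriv (fps_deriv phi)"
  proof (rule fps_ext)
    fix j
    show "subst2 Theta1 (in_u phi) (in_v phi) $ 2 $ j = fps_deriv (fps_deriv phi) $ j"
    proof (cases "even j")
      case True
      then show ?thesis
        unfolding second_deriv_nth by (simp add: Theta1_phi phi_sum_nth phi_diff_nth)
    next
      case False
      then show ?thesis
        unfolding second_deriv_nth by (simp add: Theta1_phi phi_sum_nth phi_diff_nth phi_odd)
    qed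
  qed
  then show ?thesis by (simp add: row_2 minus_equation_iff)
qed

text \<open>Taylor expansion in the first variable. By evenness
  \<open>phi(w - t) = phi(t - w)\<close>, which among the first three terms flips only the linear
  one.\<close>

lemma phi_rows:
  "subst1 phi sum_uv $ 0 = phi" "subst1 phi diff_uv $ 0 = phi"
  "subst1 phi sum_uv $ 1 = fps_deriv phi" "subst1 phi diff_uv $ 1 = - fps_deriv phi"
  "subst1 phi diff_uv $ 2 = subst1 phi sum_uv $ 2"
  "of_nat 2 * subst1 phi sum_uv $ 2 = fps_deriv (fps_deriv phi)"
proof -
  have *: "(- 1) ^ j * phi $ (i + j) = (- 1) ^ i * phi $ (i + j)" for i j
    by (cases "even (i + j)") (auto simp: phi_odd minus_one_power_iff)
  show "subst1 phi sum_uv $ 0 = phi" "subst1 phi diff_uv $ 0 = phi"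
    using *[of _ 0] by (auto simp: fps_eq_iff phi_sum_nth phi_diff_nth)
  show "subst1 phi sum_uv $ 1 = fps_deriv phi" "subst1 phi diff_uv $ 1 = - fps_deriv phi"
    using *[of _ 1] by (auto simp: fps_eq_iff phi_sum_nth phi_diff_nth mult.assoc)
  show "subst1 phi diff_uv $ 2 = subst1 phi sum_uv $ 2"
    using *[of _ 2] by (auto simp: fps_eq_iff phi_sum_nth phi_diff_nth mult.assoc)
  show "of_nat 2 * subst1 phi sum_uv $ 2 = fps_deriv (fps_deriv phi)"
  proof (rule fps_ext)
    fix j
    show "(of_nat 2 * subst1 phi sum_uv $ 2) $ j = fps_deriv (fps_deriv phi) $ j"
      unfolding second_deriv_nth fps_of_nat[symmetric] fps_mult_left_const_nth by (simp add: phi_sum_nth)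
  qed
qed

lemma quartic_phi: "quartic oo phi = (fps_deriv phi) ^ 2"
proof -
  have "subst2 Theta2 (in_u phi) (in_v phi) $ 2 = phi * fps_deriv (fps_deriv phi) - (fps_deriv phi) ^ 2"
  proof -
    have "{0..2::nat} = {0, 1, 2}" by auto
    then show ?thesis
      unfolding Theta2_phi fps_mult_nth
      by (simp add: phi_rows phi_rows[unfolded One_nat_def] phi_rows(6)[symmetric])
         (simp add: algebra_simps power2_eq_square)
  qed
  then have "Theta2 $ 1 oo phi = (fps_deriv phi) ^ 2 - phi * fps_deriv (fps_deriv phi)"
    unfolding row_2 by (metis minus_diff_eq minus_minus)
  then show ?thesis
    by (simp add: quartic_def fps_compose_sub_distrib compose_mult X_compose phi0 Theta1_row[unfolded One_nat_def])
qed

text \<open>Differentiating \<open>B(phi(w)) = - w^2\<close> gives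
  \<open>B'(phi) phi' = - 2 w\<close>; after squaring, \<open>phi'^2\<close> is
  \<open>P(phi)\<close> and \<open>w^2\<close> is \<open>- B(phi)\<close>.\<close>

theorem quartic_ode: "quartic * (fps_deriv B) ^ 2 = - (fps_const 4 * B)"
proof (rule compose_quadratic_inj[OF phi_start])
  have "(fps_deriv B oo phi) * fps_deriv phi = - (fps_const 2 * fps_X)"
    using arg_cong[OF B_phi, of fps_deriv]
    by (simp add: chain_rule phi0 fps_deriv_power flip: fps_const_neg) 
  then have "((fps_deriv B oo phi) * fps_deriv phi) ^ 2 = (fps_const 2 * fps_X) ^ 2"
    by simp
  then have "(fps_deriv B oo phi) ^ 2 * (fps_deriv phi) ^ 2 = fps_const 4 * fps_X ^ 2"
    by (simp add: power_mult_distrib fps_const_power)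
  then show "(quartic * (fps_deriv B) ^ 2) oo phi = - (fps_const 4 * B) oo phi"
    by (simp add: compose_mult compose_power phi0 quartic_phi fps_compose_uminus B_phi compose_const mult.commute)
qed

section \<open>Duplication\<close>

definition "doubling = Abs_fps (\<lambda>n. \<Sum>p\<le>n. Theta1 $ p $ (n - p))"

text \<open>On the diagonal \<open>w = t\<close> the summand \<open>phi(w - t)\<close> becomes
  \<open>phi(0) = 0\<close>, and only \<open>phi(2 w)\<close> remains.\<close>

lemma doubling_phi: "doubling oo phi = phi oo (fps_const 2 * fps_X)"
proof -
  have *: "subst2 Theta1 (in_u fps_X) (in_u fps_X) = in_u doubling"
  proof (intro fps_ext)
    fix i j
    have "subst2 Theta1 (in_u fps_X) (in_u fps_X) $ i $ j =
        (\<Sum>p\<le>i+j. \<Sum>q\<le>i+j. if p + q = i \<and> j = 0 then Theta1 $ p $ q else 0)"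
      by (simp add: subst2_def in_u_X fps_X_power_nth if_distrib[of "\<lambda>x. _ * x"] flip: power_add)
         (intro sum.cong, auto)
    also have "\<dots> = in_u doubling $ i $ j"
    proof (cases "j = 0")
      case True
      have "(\<Sum>q\<le>i. if p + q = i then Theta1 $ p $ q else 0) = Theta1 $ p $ (i - p)" if "p \<le> i" for p
      proof -
        have "(\<Sum>q\<le>i. if p + q = i then Theta1 $ p $ q else 0) = (\<Sum>q\<le>i. if q = i - p then Theta1 $ p $ q else 0)"
          using that by (intro sum.cong) auto
        then show ?thesis by simp
      qed
      with True show ?thesis by (simp add: in_u_nth doubling_def)
    qed (simp add: in_u_nth)
    finally show "subst2 Theta1 (in_u fps_X) (in_u fps_X) $ i $ j = in_u doubling $ i $ j" .
  qed
  have phi: "phi \<in> ord1 1" and X: "fps_X \<in> ord1 1" and 0: "(0 :: 'a fps) \<in> ord1 1"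
    by (simp_all add: ord1_1 phi0)
  have U: "in_u fps_X \<in> ord2 1" "in_v fps_X \<in> ord2 1" "in_u phi \<in> ord2 1" "in_v phi \<in> ord2 1"
    by (simp_all add: ord2_uv phi0)
  have "doubling oo phi = subst_uni (subst2 Theta1 (in_u fps_X) (in_u fps_X)) phi 0"
    by (simp add: * uni.sb_in_u[OF phi 0] uni_s1)
  also have "\<dots> = subst_uni Theta1 phi phi"
    by (simp add: uni.sb_subst2[OF U(1) U(1) phi 0] uni.sb_u[OF phi 0])
  also have "\<dots> = subst_uni (subst2 Theta1 (in_u phi) (in_v phi)) fps_X fps_X"
    by (simp add: uni.sb_subst2[OF U(3,4) X X] uni.sb_in_u[OF X X] uni.sb_in_v[OF X X] uni_s1)
  also have "\<dots> = (phi oo (fps_X + fps_X)) + (phi oo 0)"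
    by (simp add: Theta1_phi uni.sb_add[OF X X] uni.sb_subst1[OF _ X X] ord2_uv uni_s1
        uni.sb_diff[OF X X] uni.sb_u[OF X X] uni.sb_v[OF X X])
  also have "phi oo (0 :: 'a fps) = 0"
    by (simp add: phi0)
  also have "fps_X + fps_X = fps_const 2 * (fps_X :: 'a fps)"
    by (simp add: mult_2[symmetric] numeral_fps_const)
  finally show ?thesis by simp
qed

lemma doubling0: "doubling $ 0 = 0" and doubling1: "doubling $ 1 = 4"
proof -
  show 0: "doubling $ 0 = 0"
    using arg_cong[OF doubling_phi, of "\<lambda>h. h $ 0"] by (simp add: phi0)
  have "(doubling oo phi) $ 2 = - doubling $ 1"
    using phi_start 0 quadratic_start_power(1)[OF phi_start, of 2 2]
    by (simp add: fps_compose_nth numeral_2_eq_2 quadratic_start_def)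
  moreover have "(phi oo (fps_const 2 * fps_X)) $ 2 = - 4"
    using phi_start by (simp add: quadratic_start_def)
  ultimately show "doubling $ 1 = 4"
    by (simp add: doubling_phi)
qed

theorem B_doubling: "B oo doubling = fps_const 4 * B"
proof (rule compose_quadratic_inj[OF phi_start])
  have "(B oo doubling) oo phi = B oo (doubling oo phi)"
    by (rule compose_assoc[OF doubling0 phi0])
  also have "\<dots> = (B oo phi) oo (fps_const 2 * fps_X)"
    by (simp add: doubling_phi compose_assoc phi0)
  also have "\<dots> = - (fps_const 4 * fps_X ^ 2)"
    by (simp add: B_phi fps_compose_uminus compose_power X_compose power_mult_distrib fps_const_power)
  finally show "(B oo doubling) oo phi = (fps_const 4 * B) oo phi"
    by (simp add: compose_mult phi0 compose_const B_phi)
qed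

text \<open>For odd \<open>n\<close> the pairs \<open>(p, n - p)\<close> and
  \<open>(n - p, p)\<close> are distinct, and they contribute equally because \<open>Theta1\<close>
  is symmetric.\<close>

lemma doubling_odd:
  assumes "odd n" shows "doubling $ n = of_int 2 * (\<Sum>p\<in>{p. 2 * p < n}. Theta1 $ p $ (n - p))"
proof -
  have "{..n} = {p. 2 * p < n} \<union> (\<lambda>p. n - p) ` {p. 2 * p < n}"
  proof (intro equalityI subsetI)
    fix p assume p: "p \<in> {..n}"
    show "p \<in> {p. 2 * p < n} \<union> (\<lambda>p. n - p) ` {p. 2 * p < n}"
    proof (cases "2 * p < n")
      case False
      from assms obtain b where "n = 2 * b + 1" by (rule oddE)
      then have "2 * (n - p) < n" "p = n - (n - p)"
        using p False by simp_all arith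
      then show ?thesis by blast
    qed simp
  qed auto
  moreover have "finite {p. 2 * p < n}"
    by (rule finite_subset[of _ "{..n}"]) auto
  moreover have "{p. 2 * p < n} \<inter> (\<lambda>p. n - p) ` {p. 2 * p < n} = {}"
    by auto
  moreover have "inj_on (\<lambda>p. n - p) {p. 2 * p < n}"
    by (auto simp: inj_on_def)
  ultimately have "doubling $ n = (\<Sum>p\<in>{p. 2 * p < n}. Theta1 $ p $ (n - p)) +
      (\<Sum>p\<in>{p. 2 * p < n}. Theta1 $ (n - p) $ (n - (n - p)))"
    by (simp add: doubling_def sum.union_disjoint sum.reindex)
  also have "(\<Sum>p\<in>{p. 2 * p < n}. Theta1 $ (n - p) $ (n - (n - p))) = (\<Sum>p\<in>{p. 2 * p < n}. Theta1 $ p $ (n - p))"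
    by (intro sum.cong refl) (auto simp: Theta1_symmetric)
  finally show ?thesis by simp
qed

end

section \<open>Denominators\<close>

text \<open>One notion for all subgroups met below: homogeneous parts of cobordism and of
  \<open>\<Lambda>\<close>, their localizations and, as a constant family, an ungraded subring.
  Integrality and degree are thereby settled in a single argument.\<close>

locale graded_family =
  fixes E :: "int \<Rightarrow> 'a::comm_ring_1 set"
  assumes one_E: "1 \<in> E 0"
    and zero_E: "0 \<in> E w"
    and diff_E: "x \<in> E w \<Longrightarrow> y \<in> E w \<Longrightarrow> x - y \<in> E w"
    and mult_E: "x \<in> E v \<Longrightarrow> y \<in> E w \<Longrightarrow> x * y \<in> E (v + w)"
begin

lemma uminus_E: "x \<in> E w \<Longrightarrow> - x \<in> E w"
  using diff_E[OF zero_E] by fastforce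

lemma add_E: "x \<in> E w \<Longrightarrow> y \<in> E w \<Longrightarrow> x + y \<in> E w"
  using diff_E[OF _ uminus_E] by fastforce

lemma sum_E: "(\<And>i. i \<in> A \<Longrightarrow> h i \<in> E w) \<Longrightarrow> sum h A \<in> E w"
  by (induction A rule: infinite_finite_induct) (auto intro: zero_E add_E)

lemma mult_E': "x \<in> E v \<Longrightarrow> y \<in> E w \<Longrightarrow> v + w = u \<Longrightarrow> x * y \<in> E u"
  using mult_E by blast

lemma power_E: "x \<in> E 0 \<Longrightarrow> x ^ n \<in> E 0"
  by (induction n) (auto intro: one_E mult_E')

lemma of_nat_E: "of_nat n \<in> E 0"
  by (induction n) (auto intro: zero_E one_E add_E)

lemma of_int_E: "of_int k \<in> E 0"
  by (cases k rule: int_cases2) (auto intro: of_nat_E uminus_E)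

lemma of_nat_mult_E: "x \<in> E w \<Longrightarrow> of_nat n * x \<in> E w"
  by (rule mult_E'[OF of_nat_E]) auto

lemma of_int_mult_E: "x \<in> E w \<Longrightarrow> of_int n * x \<in> E w"
  by (rule mult_E'[OF of_int_E]) auto

lemma minus_one_power_mult_E: "x \<in> E w \<Longrightarrow> (- 1) ^ n * x \<in> E w"
  by (rule mult_E'[OF power_E[OF uminus_E[OF one_E]]]) auto

text \<open>\<open>c\<close> is the weight carried by the variable and \<open>s\<close> that of the
  whole series. \<open>F\<close> has type \<open>(1, 1)\<close>; the laws in
  \<open>x = u ubar\<close> will have types \<open>(2, 2)\<close> and \<open>(2, 4)\<close>.\<close>

definition hom1 :: "int \<Rightarrow> int \<Rightarrow> 'a fps \<Rightarrow> bool"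
  where "hom1 c s h \<longleftrightarrow> (\<forall>i. h $ i \<in> E (c * int i - s))"

definition hom2 :: "int \<Rightarrow> int \<Rightarrow> 'a fps fps \<Rightarrow> bool"
  where "hom2 c s H \<longleftrightarrow> (\<forall>i j. H $ i $ j \<in> E (c * (int i + int j) - s))"

lemma hom1_nth: "hom1 c s h \<Longrightarrow> h $ i \<in> E (c * int i - s)"
  by (simp add: hom1_def)

lemma hom2_nth: "hom2 c s H \<Longrightarrow> H $ i $ j \<in> E (c * (int i + int j) - s)"
  by (simp add: hom2_def)

text \<open>Bounding the degree lets recursively determined coefficients be treated one at a time.\<close>

lemma mult_nth_E:
  assumes "\<And>i. i \<le> n \<Longrightarrow> h $ i \<in> E (c * int i - s)" "\<And>i. i \<le> n \<Longrightarrow> k $ i \<in> E (c * int i - t)"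
  shows "(h * k) $ n \<in> E (c * int n - (s + t))"
  unfolding fps_mult_nth
  by (intro sum_E mult_E'[OF assms(1) assms(2)]) (auto simp: of_nat_diff algebra_simps)

lemma one_nth_E: "(1 :: 'a fps) $ n \<in> E (c * int n)"
  by (cases n) (auto intro: zero_E one_E)

lemma power_nth_E:
  assumes "\<And>i. i \<le> n \<Longrightarrow> h $ i \<in> E (c * int i - s)"
  shows "i \<le> n \<Longrightarrow> (h ^ p) $ i \<in> E (c * int i - int p * s)"
proof (induction p arbitrary: i)
  case 0
  then show ?case using one_nth_E[of i] by simp
next
  case (Suc p)
  have "(h * h ^ p) $ i \<in> E (c * int i - (s + int p * s))"
    by (intro mult_nth_E) (use assms Suc in auto)
  then show ?case by (simp add: algebra_simps)
qed

lemma hom1_mult: "hom1 c s h \<Longrightarrow> hom1 c t k \<Longrightarrow> hom1 c (s + t) (h * k)"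
  unfolding hom1_def by (intro allI mult_nth_E) auto

lemma hom1_power: "hom1 c s h \<Longrightarrow> hom1 c (int p * s) (h ^ p)"
  unfolding hom1_def by (intro allI power_nth_E[OF _ order_refl]) auto

lemma hom2_add: "hom2 c s H \<Longrightarrow> hom2 c s K \<Longrightarrow> hom2 c s (H + K)"
  by (simp add: hom2_def add_E)

lemma hom2_1: "hom2 c 0 1"
proof -
  have "(1 :: 'a fps fps) $ i $ j = (if i = 0 \<and> j = 0 then 1 else 0)" for i j
    by (cases i) auto
  then show ?thesis by (auto simp: hom2_def intro: one_E zero_E)
qed

lemma hom2_mult:
  assumes "hom2 c s H" "hom2 c t K" shows "hom2 c (s + t) (H * K)"
  unfolding hom2_def fps_mult_nth fps_sum_nth
proof (intro allI sum_E)
  fix i j k l :: nat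
  assume "k \<in> {0..i}" "l \<in> {0..j}"
  then show "H $ k $ l * K $ (i - k) $ (j - l) \<in> E (c * (int i + int j) - (s + t))"
    by (intro mult_E'[OF hom2_nth[OF assms(1)] hom2_nth[OF assms(2)]])
       (auto simp: of_nat_diff algebra_simps)
qed

lemma hom2_power: "hom2 c s H \<Longrightarrow> hom2 c (int p * s) (H ^ p)"
proof (induction p)
  case (Suc p)
  then show ?case using hom2_mult[of c s H "int p * s" "H ^ p"] by (simp add: algebra_simps)
qed (simp add: hom2_1)

lemma hom2_subst2:
  assumes H: "hom2 b s H" and X: "hom2 c b X" and Y: "hom2 c b Y"
  shows "hom2 c s (subst2 H X Y)"
  unfolding hom2_def subst2_def fps_nth_Abs_fps
proof (intro allI sum_E)
  fix i j p q
  have "hom2 c (int p * b + int q * b) (X ^ p * Y ^ q)"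
    by (intro hom2_mult hom2_power X Y)
  then show "H $ p $ q * (X ^ p * Y ^ q) $ i $ j \<in> E (c * (int i + int j) - s)"
    using H by (intro mult_E'[where v = "b * (int p + int q) - s" and w = "c * (int i + int j) - (int p * b + int q * b)"])
      (auto simp: hom2_def algebra_simps)
qed

lemma hom2_in_u: "hom1 c s h \<Longrightarrow> hom2 c s (in_u h)"
  by (auto simp: hom1_def hom2_def in_u_nth zero_E)

lemma hom2_in_v: "hom1 c s h \<Longrightarrow> hom2 c s (in_v h)"
  by (auto simp: hom1_def hom2_def in_v_nth zero_E)

lemma hom1_X: "hom1 c c fps_X"
  by (auto simp: hom1_def fps_X_def zero_E one_E)

lemma hom2_subst1:
  assumes "hom1 b s h" "hom2 c b X" shows "hom2 c s (subst1 h X)"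
  unfolding bi_s1[symmetric] bi.s1_def
  by (rule hom2_subst2[OF hom2_in_u[OF assms(1)] assms(2)]) (simp add: hom2_def zero_E)

text \<open>The weight \<open>2 * c\<close> of \<open>x\<close> gives every correction term of the
  triangular recursion the weight of \<open>H $ p $ q\<close>. With a constant family this becomes a
  descent of integrality.\<close>

lemma hom2_quadratic:
  assumes x: "quadratic_start x" "hom1 c (2 * c) x"
    and Z: "hom2 c s (subst2 H (in_u x) (in_v x))"
  shows "hom2 (2 * c) s H"
proof -
  have "H $ p $ q \<in> E (2 * c * (int p + int q) - s)" for p q
  proof (induction "p + q" arbitrary: p q rule: less_induct)
    case less
    have "H $ p' $ q' * ((x ^ p') $ (2 * p) * (x ^ q') $ (2 * q)) \<in> E (2 * c * (int p + int q) - s)"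
      if "p' \<le> p" "q' \<le> q" "(p', q') \<noteq> (p, q)" for p' q'
    proof -
      have "p' + q' < p + q" using that by auto
      note IH = less[OF this]
      have "(x ^ p') $ (2 * p) \<in> E (c * int (2 * p) - int p' * (2 * c))"
        "(x ^ q') $ (2 * q) \<in> E (c * int (2 * q) - int q' * (2 * c))"
        by (rule hom1_nth[OF hom1_power[OF x(2)]])+
      from mult_E'[OF IH mult_E[OF this]] show ?thesis
        by (auto simp: algebra_simps)
    qed
    then have *: "(\<Sum>(p', q')\<in>{..p} \<times> {..q} - {(p, q)}.
        H $ p' $ q' * ((x ^ p') $ (2 * p) * (x ^ q') $ (2 * q))) \<in> E (2 * c * (int p + int q) - s)"
      by (intro sum_E) auto
    have "subst2 H (in_u x) (in_v x) $ (2 * p) $ (2 * q) \<in> E (c * (int (2 * p) + int (2 * q)) - s)"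
      using Z unfolding hom2_def by blast
    then show ?case
      unfolding subst2_quadratic_nth[OF x(1), of H p q]
      using * by (intro minus_one_power_mult_E diff_E) (auto simp: algebra_simps)
  qed
  then show ?thesis by (simp add: hom2_def)
qed

end

section \<open>Denominators at the odd primes\<close>

lemma ex_fps_sqrt:
  fixes A :: "'a::comm_ring_1 fps"
  assumes half: "(2 :: 'a) * h = 1" and A: "A $ 0 = 1"
  shows "\<exists>L. L $ 0 = 1 \<and> L * L = A"
proof -
  have "\<exists>l. \<forall>n. l n = (if n = 0 then 1 else h * (A $ n - (\<Sum>i\<in>{1..<n}. l i * l (n - i))))"
    (is "\<exists>l. \<forall>n. l n = ?R l n")
  proof -
    define l where "l = wfrec less_than ?R"
    have "l n = ?R l n" for n
    proof -
      have "l n = ?R (cut l less_than n) n"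
        unfolding l_def by (rule wfrec[OF wf_less_than])
      also have "(\<Sum>i\<in>{1..<n}. cut l less_than n i * cut l less_than n (n - i)) = (\<Sum>i\<in>{1..<n}. l i * l (n - i))"
        by (intro sum.cong) (auto simp: cut_apply)
      finally show ?thesis by simp
    qed
    then show ?thesis by blast
  qed
  then obtain l where l: "\<And>n. l n = ?R l n" by blast
  have "(Abs_fps l * Abs_fps l) $ n = A $ n" for n
  proof (cases "n = 0")
    case True
    then show ?thesis using l[of 0] A by simp
  next
    case False
    then have "{0..n} = insert 0 (insert n {1..<n})" by auto
    then have "(Abs_fps l * Abs_fps l) $ n = 2 * l n + (\<Sum>i\<in>{1..<n}. l i * l (n - i))"
      using False l[of 0] by (simp add: fps_mult_nth)
    also have "2 * l n = (2 * h) * (A $ n - (\<Sum>i\<in>{1..<n}. l i * l (n - i)))"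
      using False l[of n] by (simp add: mult.assoc)
    finally show ?thesis by (simp add: half)
  qed
  then show ?thesis
    using l[of 0] by (intro exI[of _ "Abs_fps l"]) (simp add: fps_eq_iff)
qed

lemma fps_unit_cancel:
  fixes L :: "'a::comm_ring_1 fps"
  assumes L: "L $ 0 = 1" and eq: "L * a = L * b" shows "a = b"
proof -
  have "(a - b) $ n = 0" for n
  proof (induction n rule: less_induct)
    case (less n)
    have "0 = (L * (a - b)) $ n"
      by (simp add: algebra_simps eq)
    also have "\<dots> = L $ 0 * (a - b) $ n + (\<Sum>i=1..n. L $ i * (a - b) $ (n - i))"
      unfolding fps_mult_nth by (subst sum.atLeast_Suc_atMost) auto
    also have "(\<Sum>i=1..n. L $ i * (a - b) $ (n - i)) = 0"
      using less by (intro sum.neutral) auto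
    finally show ?case using L by simp
  qed
  then show ?thesis by (simp add: fps_eq_iff)
qed

lemma fps_X_cancel: "fps_X * a = fps_X * b \<Longrightarrow> a = (b :: 'a::comm_ring_1 fps)"
proof (rule fps_ext)
  fix n assume "fps_X * a = fps_X * b"
  from arg_cong[OF this, of "\<lambda>h. h $ Suc n"] show "a $ n = b $ n" by simp
qed

text \<open>Writing \<open>B = x L^2\<close> collapses the equation to \<open>q K^2 = 4\<close>,
  which no longer contains a derivative. Hence \<open>K\<close> is integral once 2 can be cancelled,
  and denominators arise only in passing from \<open>K\<close> back to \<open>L\<close>.\<close>

lemma (in graded_family) quartic_ode_denominators:
  assumes half: "\<And>x w. 2 * x \<in> E w \<Longrightarrow> x \<in> E w" "(2 :: 'a) * h = 1"
    and P: "P $ 0 = 0" "\<And>k. P $ Suc k \<in> E (int k)"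
    and ode: "P * (fps_deriv B) ^ 2 = - (fps_const 4 * B)"
    and B: "B $ 0 = 0" "B $ 1 = 1"
    and N: "\<And>i. i \<le> k \<Longrightarrow> (2 * i + 1) dvd N"
  shows "of_nat (2 * (k + 1) * N) * B $ (k + 1) \<in> E (int k)"
proof -
  define q where "q = - fps_shift 1 P"
  have Pq: "P = - (fps_X * q)"
    unfolding q_def using P(1) by (intro fps_ext) (simp add: fps_X_mult_nth)
  have "(fps_shift 1 B) $ 0 = 1"
    using B by simp
  from ex_fps_sqrt[OF half(2) this] obtain L where L: "L $ 0 = 1" "L * L = fps_shift 1 B"
    by blast
  have BL: "B = fps_X * (L * L)"
    unfolding L(2) using B(1) by (intro fps_ext) (simp add: fps_X_mult_nth)
  \<comment> \<open>For \<open>x = y^2\<close> the square root of \<open>B\<close> is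
    \<open>y L(y^2)\<close>, and \<open>K(y^2)\<close> is its derivative in
    \<open>y\<close>.\<close>
  define K where "K = L + 2 * (fps_X * fps_deriv L)"
  have dB: "fps_deriv B = L * K"
    unfolding BL K_def by (simp add: algebra_simps)
  have "fps_X * (L * (L * (q * (K * K)))) = fps_X * (L * (L * fps_const 4))"
    using ode unfolding dB unfolding Pq BL power2_eq_square by (simp add: mult_ac)
  then have qK: "q * (K * K) = fps_const 4"
    by (blast dest: fps_X_cancel fps_unit_cancel[OF L(1)])
  have four: "4 * x \<in> E w \<Longrightarrow> x \<in> E w" for x w
    using half(1)[of "2 * x" w] half(1)[of x w] by (simp add: mult.assoc[symmetric])
  have q: "q $ i \<in> E (int i)" for i
    using P(2)[of i] by (simp add: q_def uminus_E)
  have K0: "K $ 0 = 1"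
    using L(1) by (simp add: K_def)
  have q0: "q $ 0 = 4"
    using arg_cong[OF qK, of "\<lambda>h. h $ 0"] K0 by simp
  have V: "(K * K) $ n \<in> E (int n)" for n
  proof (induction n rule: less_induct)
    case (less n)
    have "fps_const 4 $ n = (\<Sum>i=0..n. q $ i * (K * K) $ (n - i))"
      unfolding qK[symmetric] fps_mult_nth[of q] ..
    also have "\<dots> = 4 * (K * K) $ n + (\<Sum>i=1..n. q $ i * (K * K) $ (n - i))"
      by (subst sum.atLeast_Suc_atMost) (auto simp: q0)
    finally have eq: "4 * (K * K) $ n = fps_const 4 $ n - (\<Sum>i=1..n. q $ i * (K * K) $ (n - i))"
      by (simp add: algebra_simps)
    have "fps_const (4 :: 'a) $ n \<in> E (int n)"
      using of_nat_E[of 4] by (cases n) (auto intro: zero_E)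
    moreover have "(\<Sum>i=1..n. q $ i * (K * K) $ (n - i)) \<in> E (int n)"
      by (intro sum_E mult_E'[OF q less]) auto
    ultimately show ?case
      by - (rule four, unfold eq, rule diff_E)
  qed
  have K: "K $ n \<in> E (int n)" for n
  proof (induction n rule: less_induct)
    case (less n)
    show ?case
    proof (cases "n = 0")
      case False
      then have "{0..n} = insert 0 (insert n {1..<n})" by auto
      then have "(K * K) $ n = 2 * K $ n + (\<Sum>i\<in>{1..<n}. K $ i * K $ (n - i))"
        using False K0 by (simp add: fps_mult_nth)
      then have eq: "2 * K $ n = (K * K) $ n - (\<Sum>i\<in>{1..<n}. K $ i * K $ (n - i))"
        by simp
      have "(\<Sum>i\<in>{1..<n}. K $ i * K $ (n - i)) \<in> E (int n)"
        by (intro sum_E mult_E'[OF less less]) auto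
      then show ?thesis
        by - (rule half(1), unfold eq, rule diff_E[OF V])
    qed (simp add: K0 one_E)
  qed
  have KL: "K $ n = of_nat (2 * n + 1) * L $ n" for n
  proof -
    have "(2 * (fps_X * fps_deriv L)) $ n = 2 * (fps_X * fps_deriv L) $ n"
      by (simp add: numeral_fps_const)
    also have "(fps_X * fps_deriv L) $ n = of_nat n * L $ n"
      by (cases n) (auto simp del: of_nat_Suc)
    finally show ?thesis by (simp add: K_def algebra_simps)
  qed
  have NL: "of_nat N * L $ i \<in> E (int i)" if i: "i \<le> k" for i
  proof -
    obtain d where "N = (2 * i + 1) * d" using N[OF i] by (auto elim: dvdE)
    then have "of_nat N * L $ i = of_nat d * K $ i"
      by (simp only: KL of_nat_mult mult_ac)
    then show ?thesis by (simp add: K of_nat_mult_E)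
  qed
  have "of_nat (2 * (k + 1) * N) * (L $ i * L $ (k - i)) \<in> E (int k)" if i: "i \<le> k" for i
  proof -
    \<comment> \<open>Each summand clears one of the two denominators exactly, so a single factor
      \<open>N\<close> suffices for the other.\<close>
    have "2 * (k + 1) = (2 * i + 1) + (2 * (k - i) + 1)"
      using i by simp
    then have "2 * (k + 1) * N = (2 * i + 1) * N + (2 * (k - i) + 1) * N"
      by (simp only: add_mult_distrib)
    then have eq: "of_nat (2 * (k + 1) * N) =
        (of_nat (2 * i + 1) * of_nat N + of_nat (2 * (k - i) + 1) * of_nat N :: 'a)"
      by (metis of_nat_add of_nat_mult)
    have "of_nat (2 * (k + 1) * N) * (L $ i * L $ (k - i)) =
        K $ i * (of_nat N * L $ (k - i)) + (of_nat N * L $ i) * K $ (k - i)"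
      unfolding eq KL by (simp only: distrib_left distrib_right mult_ac)
    also have "\<dots> \<in> E (int k)"
      using i by (intro add_E mult_E'[OF K NL] mult_E'[OF NL K]) auto
    finally show ?thesis .
  qed
  moreover have "B $ (k + 1) = (\<Sum>i=0..k. L $ i * L $ (k - i))"
    unfolding BL by (subst fps_X_mult_nth) (simp add: fps_mult_nth)
  ultimately show ?thesis
    by (simp only: sum_distrib_left) (intro sum_E, simp only: atLeastAtMost_iff)
qed

text \<open>Comparing coefficients of \<open>x^m\<close> in \<open>B(D) = 4 B\<close> and
  multiplying by \<open>m\<close> expresses \<open>4 m B $ m\<close>, up to the odd factor
  \<open>1 - 4^(m-1)\<close>, by the terms \<open>k B $ k\<close> with \<open>k < m\<close>. Their
  coefficients are divisible by 4 unless \<open>2 * k \<le> m\<close>, where only 2 is guaranteed;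
  such \<open>k\<close> lie below the previous power of 2, and the induction hypothesis there
  supplies the missing factor.\<close>

lemma (in graded_family) doubling_denominators:
  fixes D :: "'a fps"
  assumes odd_cancel: "\<And>c x w. odd c \<Longrightarrow> of_int c * x \<in> E w \<Longrightarrow> x \<in> E w" and half: "(2 :: 'a) * h = 1"
    and D: "D $ 0 = 0" "D $ 1 = 4" "\<And>k. D $ Suc k \<in> E (int k)"
    and D_odd: "\<And>k. odd k \<Longrightarrow> \<exists>y\<in>E (int k - 1). D $ k = 2 * y"
    and BD: "B oo D = fps_const 4 * B"
    and B: "B $ 0 = 0" "B $ 1 = 1"
  shows "1 \<le> m \<Longrightarrow> m < 2 ^ Suc r \<Longrightarrow> of_nat (2 ^ r * m) * B $ m \<in> E (int m - 1)"
proof -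
  have two_cancel: "2 * x = 2 * y \<Longrightarrow> x = y" for x y :: 'a
    using half by (metis mult.commute mult.left_commute mult.right_neutral)
  have four_cancel: "4 * x = 4 * y \<Longrightarrow> x = y" for x y :: 'a
    using two_cancel[of x y] two_cancel[of "2 * x" "2 * y"] by (simp add: mult.assoc[symmetric])
  \<comment> \<open>\<open>low s h\<close>: the series has weight \<open>s\<close> and modulo 2
    starts in degree at least \<open>2 * s\<close>. \<open>D\<close> satisfies this for
    \<open>s = 1\<close> because its linear coefficient 4 is even.\<close>
  define low :: "nat \<Rightarrow> 'a fps \<Rightarrow> bool" where
    "low s h \<longleftrightarrow> (\<forall>j. h $ j \<in> E (int j - int s) \<and> (j < 2 * s \<longrightarrow> (\<exists>y\<in>E (int j - int s). h $ j = 2 * y)))" for s h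
  have low_mult: "low (s + t) (a * b)" if a: "low s a" and b: "low t b" for s t a b
  proof -
    have "(a * b) $ j \<in> E (int j - int (s + t))" for j
      using mult_nth_E[of j a 1 "int s" b "int t"] a b by (simp add: low_def)
    moreover have "\<exists>y\<in>E (int j - int (s + t)). (a * b) $ j = 2 * y" if j: "j < 2 * (s + t)" for j
    proof -
      have "\<exists>y\<in>E (int j - int (s + t)). a $ i * b $ (j - i) = 2 * y" if i: "i \<in> {0..j}" for i
      proof (cases "i < 2 * s")
        case True
        then obtain y where y: "y \<in> E (int i - int s)" "a $ i = 2 * y" using a by (auto simp: low_def)
        have "b $ (j - i) \<in> E (int (j - i) - int t)" using b by (simp add: low_def)
        from mult_E[OF y(1) this] i show ?thesis
          by (intro bexI[of _ "y * b $ (j - i)"]) (auto simp: y(2) mult_ac of_nat_diff algebra_simps)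
      next
        case False
        then have "j - i < 2 * t" using i j by auto
        then obtain y where y: "y \<in> E (int (j - i) - int t)" "b $ (j - i) = 2 * y" using b by (auto simp: low_def)
        have "a $ i \<in> E (int i - int s)" using a by (simp add: low_def)
        from mult_E[OF this y(1)] i show ?thesis
          by (intro bexI[of _ "a $ i * y"]) (auto simp: y(2) mult_ac of_nat_diff algebra_simps)
      qed
      then obtain y where "\<And>i. i \<in> {0..j} \<Longrightarrow> y i \<in> E (int j - int (s + t)) \<and> a $ i * b $ (j - i) = 2 * y i"
        by metis
      then show ?thesis
        by (intro bexI[of _ "\<Sum>i=0..j. y i"] sum_E) (auto simp: fps_mult_nth sum_distrib_left)
    qed
    ultimately show ?thesis by (simp add: low_def)
  qed
  have two_E: "2 \<in> E 0" using of_nat_E[of 2] by simp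
  have D_E: "D $ j \<in> E (int j - 1)" for j
    using D(1) D(3)[of "j - 1"] by (cases j) (auto intro: zero_E)
  have less2: "j < 2 \<longleftrightarrow> j = 0 \<or> j = 1" for j :: nat by auto
  have D_low: "low 1 D"
    unfolding low_def using D_E D(1,2) two_E by (auto simp: less2 intro: bexI[of _ 0] bexI[of _ 2] zero_E)
  have D_pow: "low p (D ^ p)" for p
  proof (induction p)
    case 0
    show ?case using one_nth_E[of _ 1] by (simp add: low_def)
  next
    case (Suc p)
    then show ?case using low_mult[OF D_low] by simp
  qed
  have "\<exists>y\<in>E (int j - 1). of_nat j * D $ j = 2 * y" for j
  proof (cases "even j")
    case True
    then obtain i where "j = 2 * i" by (rule evenE)
    then show ?thesis
      by (intro bexI[of _ "of_nat i * D $ j"] of_nat_mult_E D_E) (simp add: mult.assoc)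
  next
    case False
    then obtain y where "y \<in> E (int j - 1)" "D $ j = 2 * y" using D_odd by blast
    then show ?thesis
      by (intro bexI[of _ "of_nat j * y"] of_nat_mult_E) (simp_all add: mult_ac)
  qed
  then obtain J where J: "\<And>j. J j \<in> E (int j - 1)" "\<And>j. of_nat j * D $ j = 2 * J j"
    by metis
  have J01: "J 0 = 0" "J 1 = 2"
    using J(2)[of 0] J(2)[of 1] D by (auto intro: two_cancel)
  have J_low: "low 1 (Abs_fps J)"
    unfolding low_def using J(1) J01 by (auto simp: less2 intro: bexI[of _ 0] bexI[of _ 1] zero_E one_E)
  \<comment> \<open>From \<open>x (D^k)' = k D^(k-1) x D'\<close> and \<open>x D' = 2 J\<close>, the
    coefficient of \<open>x^m\<close> in \<open>D^k\<close> times \<open>m\<close> is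
    \<open>2 * k * c k m\<close>. By \<open>low\<close>, \<open>c k m\<close> is even when
    \<open>m < 2 * k\<close>.\<close>
  define c where "c k m = (D ^ (k - 1) * Abs_fps J) $ m" for k m
  have c_low: "low k (D ^ (k - 1) * Abs_fps J)" if "k \<ge> 1" for k
    using low_mult[OF D_pow[of "k - 1"] J_low] that by simp
  have c: "of_nat m * (D ^ k) $ m = of_nat k * (2 * c k m)" for k m
  proof -
    have "fps_X * fps_deriv (D ^ k) = fps_const (of_nat k) * (D ^ (k - 1) * (fps_X * fps_deriv D))"
      by (simp add: fps_deriv_power mult_ac)
    also have "fps_X * fps_deriv D = fps_const 2 * Abs_fps J"
    proof (rule fps_ext)
      fix j show "(fps_X * fps_deriv D) $ j = (fps_const 2 * Abs_fps J) $ j"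
        using J(2)[of j] J01(1) by (cases j) (auto simp del: of_nat_Suc)
    qed
    finally have "fps_X * fps_deriv (D ^ k) = fps_const (of_nat k) * (fps_const 2 * (D ^ (k - 1) * Abs_fps J))"
      by (simp add: mult_ac)
    from arg_cong[OF this, of "\<lambda>h. h $ m"] show ?thesis
      by (cases m) (simp_all add: c_def del: of_nat_Suc)
  qed
  show "1 \<le> m \<Longrightarrow> m < 2 ^ Suc r \<Longrightarrow> of_nat (2 ^ r * m) * B $ m \<in> E (int m - 1)"
  proof (induction m arbitrary: r rule: less_induct)
    case (less m)
    show ?case
    proof (cases "m = 1")
      case True
      then show ?thesis using of_nat_E[of "2 ^ r"] B(2) by simp
    next
      case False
      then have m: "m \<ge> 2" using less.prems by simp
      define \<gamma> where "\<gamma> k = of_nat k * B $ k" for k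
      have "4 * B $ m = (\<Sum>k=0..m. B $ k * (D ^ k) $ m)"
        using arg_cong[OF BD, of "\<lambda>h. h $ m"] by (simp add: fps_compose_nth)
      then have "4 * \<gamma> m = (\<Sum>k=0..m. B $ k * (of_nat m * (D ^ k) $ m))"
        by (simp add: \<gamma>_def sum_distrib_left mult_ac)
      also have "{0..m} = insert m (insert 0 {1..<m})" using m by auto
      also have "(\<Sum>k\<in>\<dots>. B $ k * (of_nat m * (D ^ k) $ m)) =
          B $ m * (of_nat m * (D ^ m) $ m) + (\<Sum>k\<in>{1..<m}. B $ k * (of_nat m * (D ^ k) $ m))"
        using m B(1) by simp
      also have "(D ^ m) $ m = 4 ^ m"
        using startsby_zero_power_nth_same[OF D(1), of m] D(2) by simp
      also have "(\<Sum>k\<in>{1..<m}. B $ k * (of_nat m * (D ^ k) $ m)) = (\<Sum>k\<in>{1..<m}. 2 * (\<gamma> k * c k m))"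
        by (intro sum.cong refl) (simp add: c \<gamma>_def mult_ac)
      finally have eq: "4 * \<gamma> m = 4 ^ m * \<gamma> m + (\<Sum>k\<in>{1..<m}. 2 * (\<gamma> k * c k m))"
        by (simp add: \<gamma>_def mult_ac)
      have "\<exists>y\<in>E (int m - 1). of_nat (2 ^ r) * (2 * (\<gamma> k * c k m)) = 4 * y" if k: "k \<in> {1..<m}" for k
      proof (cases "m < 2 * k")
        case True
        then obtain y where y: "y \<in> E (int m - int k)" "c k m = 2 * y"
          using c_low[of k] k by (auto simp: low_def c_def)
        have "of_nat (2 ^ r * k) * B $ k \<in> E (int k - 1)"
          using less k by auto
        then have "of_nat (2 ^ r * k) * B $ k * y \<in> E (int m - 1)"
          by (rule mult_E'[OF _ y(1)]) simp
        then show ?thesis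
          by (intro bexI) (auto simp: y(2) \<gamma>_def mult_ac)
      next
        case False
        then have "2 * k \<le> m" by simp
        \<comment> \<open>\<open>r = 0\<close> would mean \<open>m < 2\<close>, contradicting
          \<open>1 \<le> k\<close> and \<open>2 * k \<le> m\<close>. The bound
          \<open>m < 2 ^ Suc r\<close> halves to \<open>k < 2 ^ r\<close>.\<close>
        then obtain r' where r': "r = Suc r'" using less.prems k by (cases r) auto
        have "of_nat (2 ^ r' * k) * B $ k \<in> E (int k - 1)"
          using k less.prems \<open>2 * k \<le> m\<close> r' by (intro less.IH) auto
        moreover have "c k m \<in> E (int m - int k)"
          using c_low[of k] k by (simp add: low_def c_def)
        ultimately have "of_nat (2 ^ r' * k) * B $ k * c k m \<in> E (int m - 1)"
          by (rule mult_E') simp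
        then show ?thesis
          by (intro bexI) (auto simp: r' \<gamma>_def mult_ac)
      qed
      then obtain y where y: "\<And>k. k \<in> {1..<m} \<Longrightarrow> y k \<in> E (int m - 1) \<and> of_nat (2 ^ r) * (2 * (\<gamma> k * c k m)) = 4 * y k"
        by metis
      have ym: "(\<Sum>k\<in>{1..<m}. y k) \<in> E (int m - 1)"
        using y by (intro sum_E) blast
      have "4 * (of_nat (2 ^ r) * \<gamma> m) = of_nat (2 ^ r) * (4 ^ m * \<gamma> m) + (\<Sum>k\<in>{1..<m}. of_nat (2 ^ r) * (2 * (\<gamma> k * c k m)))"
        using arg_cong[OF eq, of "\<lambda>x. of_nat (2 ^ r) * x"] by (simp only: distrib_left sum_distrib_left mult.left_commute)
      also have "(\<Sum>k\<in>{1..<m}. of_nat (2 ^ r) * (2 * (\<gamma> k * c k m))) = 4 * (\<Sum>k\<in>{1..<m}. y k)"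
        using y by (simp add: sum_distrib_left)
      also have "(4 :: 'a) ^ m = 4 * 4 ^ (m - 1)"
        using m by (simp flip: power_Suc)
      finally have "4 * (of_nat (2 ^ r) * \<gamma> m) = 4 * (4 ^ (m - 1) * (of_nat (2 ^ r) * \<gamma> m) + (\<Sum>k\<in>{1..<m}. y k))"
        by (simp only: distrib_left mult_ac)
      then have "of_nat (2 ^ r) * \<gamma> m = 4 ^ (m - 1) * (of_nat (2 ^ r) * \<gamma> m) + (\<Sum>k\<in>{1..<m}. y k)"
        by (rule four_cancel)
      then have "(1 - 4 ^ (m - 1)) * (of_nat (2 ^ r) * \<gamma> m) = (\<Sum>k\<in>{1..<m}. y k)"
        by (subst left_diff_distrib, subst mult_1_left, subst diff_eq_eq, subst add.commute, assumption)
      with ym have "of_int (1 - 4 ^ (m - 1)) * (of_nat (2 ^ r) * \<gamma> m) \<in> E (int m - 1)"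
        by simp
      moreover have "odd (1 - 4 ^ (m - 1) :: int)"
        using m by simp
      ultimately have "of_nat (2 ^ r) * \<gamma> m \<in> E (int m - 1)"
        by (rule odd_cancel[rotated])
      then show ?thesis by (simp add: \<gamma>_def mult_ac)
    qed
  qed
qed

section \<open>Membership in the coefficient ring\<close>

context graded_family
begin

lemma graded_localization:
  assumes S: "1 \<in> S" "\<And>a b. a \<in> S \<Longrightarrow> b \<in> S \<Longrightarrow> a * b \<in> S"
  shows "graded_family (\<lambda>w. {x. \<exists>k::int\<in>S. of_int k * x \<in> E w})"
proof
  show "1 \<in> {x. \<exists>k\<in>S. of_int k * x \<in> E 0}"
    using S(1) one_E by force
  show "0 \<in> {x. \<exists>k\<in>S. of_int k * x \<in> E w}" for w
    using S(1) zero_E by force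
  fix x y v w
  assume "x \<in> {x. \<exists>k\<in>S. of_int k * x \<in> E v}" and y: "y \<in> {x. \<exists>k\<in>S. of_int k * x \<in> E w}"
  then obtain a b where ab: "a \<in> S" "b \<in> S" "of_int a * x \<in> E v" "of_int b * y \<in> E w"
    by blast
  have "of_int (a * b) * (x * y) = of_int a * x * (of_int b * y)"
    by (simp add: mult_ac)
  then show "x * y \<in> {x. \<exists>k\<in>S. of_int k * x \<in> E (v + w)}"
    using mult_E[OF ab(3,4)] S(2)[OF ab(1,2)] by (metis (mono_tags, lifting) mem_Collect_eq)
next
  fix x y w
  assume "x \<in> {x. \<exists>k\<in>S. of_int k * x \<in> E w}" and y: "y \<in> {x. \<exists>k\<in>S. of_int k * x \<in> E w}"
  then obtain a b where ab: "a \<in> S" "b \<in> S" "of_int a * x \<in> E w" "of_int b * y \<in> E w"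
    by blast
  have "of_int (a * b) * (x - y) = of_int b * (of_int a * x) - of_int a * (of_int b * y)"
    by (simp add: algebra_simps)
  then have "of_int (a * b) * (x - y) \<in> E w"
    using diff_E[OF of_int_mult_E[OF ab(3), of b] of_int_mult_E[OF ab(4), of a]] by simp
  then show "x - y \<in> {x. \<exists>k\<in>S. of_int k * x \<in> E w}"
    using S(2)[OF ab(1,2)] by blast
qed

lemma localization_subset:
  assumes "1 \<in> S" "x \<in> E w" shows "x \<in> {x. \<exists>k::int\<in>S. of_int k * x \<in> E w}"
  using assms by force

end

lemma generated_subring_0: "0 \<in> generated_subring S"
  using generated_subring.diff[OF generated_subring.one generated_subring.one] by simp

section \<open>Weights of the two-valued law\<close>

locale graded_two_valued_group = two_valued_group F g f ubar B Theta1 Theta2 + graded_family E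
  for F :: "'a::comm_ring_1 fps fps" and g f ubar B Theta1 Theta2 and E :: "int \<Rightarrow> 'a set" +
  assumes F: "hom2 1 1 F" and F_0: "\<And>i. F $ 0 $ i = (if i = 1 then 1 else 0)"
begin

lemma ubar_root: "subst_uni F fps_X ubar = 0"
proof -
  have X: "fps_X \<in> ord1 1" "ubar \<in> ord1 1"
    by (simp_all add: ord1_1 ubar0)
  have "g oo ubar = - g"
    unfolding inverse using compose_assoc[of f "- g" g]
    by (simp add: exp g0 X_compose)
  then show ?thesis
    using uni.sb_logarithm[OF g0 exp(2) log_sum F_ord X] by (simp add: uni_s1 exp(1))
qed

text \<open>The expression \<open>f oo (- g)\<close> hides integrality, since \<open>f\<close> and
  \<open>g\<close> have denominators. In degree \<open>n\<close> the equation
  \<open>F(u, ubar) = 0\<close> contains \<open>ubar $ n\<close> alone from \<open>p = 0\<close>;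
  all other terms carry a factor \<open>u\<close> and so involve earlier coefficients only.\<close>

lemma hom1_ubar: "hom1 1 1 ubar"
  unfolding hom1_def
proof (intro allI)
  fix n
  show "ubar $ n \<in> E (1 * int n - 1)"
  proof (induction n rule: less_induct)
    case (less n)
    have "0 = (\<Sum>p\<le>n. \<Sum>q\<le>n. F $ p $ q * (fps_X ^ p * ubar ^ q) $ n)"
      using arg_cong[OF ubar_root, of "\<lambda>h. h $ n"] by (simp add: subst_uni_def)
    also have "\<dots> = (\<Sum>q\<le>n. F $ 0 $ q * (ubar ^ q) $ n) + (\<Sum>p\<in>{1..n}. \<Sum>q\<le>n. F $ p $ q * (fps_X ^ p * ubar ^ q) $ n)"
      by (simp add: sum.atMost_shift sum.atLeast1_atMost_eq lessThan_Suc_atMost)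
    also have "(\<Sum>q\<le>n. F $ 0 $ q * (ubar ^ q) $ n) = ubar $ n"
      using ubar0 by (cases "n = 0") (auto simp: F_0 if_distrib[of "\<lambda>x. x * _"] cong: if_cong)
    finally have "ubar $ n = - (\<Sum>p\<in>{1..n}. \<Sum>q\<le>n. F $ p $ q * (fps_X ^ p * ubar ^ q) $ n)"
      by (simp add: eq_neg_iff_add_eq_0)
    also have "\<dots> \<in> E (1 * int n - 1)"
    proof (intro uminus_E sum_E)
      fix p q assume p: "p \<in> {1..n}"
      have "(ubar ^ q) $ (n - p) \<in> E (1 * int (n - p) - int q * 1)"
        by (rule power_nth_E[of "n - p"]) (use less p in auto)
      then have "(fps_X ^ p * ubar ^ q) $ n \<in> E (1 * int (n - p) - int q * 1)"
        using p by (simp add: fps_X_power_mult_nth)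
      from mult_E[OF hom2_nth[OF F, of p q] this]
      show "F $ p $ q * (fps_X ^ p * ubar ^ q) $ n \<in> E (1 * int n - 1)"
        using p by (simp add: of_nat_diff)
    qed
    finally show ?case .
  qed
qed

lemma hom2_z: "hom2 1 2 (z_plus F ubar)" "hom2 1 2 (z_minus F ubar)"
proof -
  have "hom2 1 1 (subst2 F (in_u a) (in_v b))" if "hom1 1 1 a" "hom1 1 1 b" for a b
    by (intro hom2_subst2[OF F] hom2_in_u hom2_in_v that)
  from this[OF hom1_X hom1_X] this[OF hom1_X hom1_ubar] this[OF hom1_ubar hom1_X] this[OF hom1_ubar hom1_ubar]
  show "hom2 1 2 (z_plus F ubar)" "hom2 1 2 (z_minus F ubar)"
    using hom2_mult[of 1 1 _ 1] by (auto simp: z_plus_def z_minus_def)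
qed

lemma hom2_Theta: "hom2 2 2 Theta1" "hom2 2 4 Theta2"
proof -
  have "quadratic_start (fps_X * ubar)"
  proof -
    have "ubar $ 1 = - 1"
      using f1 g0 g1 by (simp add: inverse fps_compose_nth)
    then show ?thesis by (simp add: quadratic_start_def ubar0 numeral_2_eq_2)
  qed
  moreover have "hom1 1 (2 * 1) (fps_X * ubar)"
    using hom1_mult[OF hom1_X[of 1] hom1_ubar] by simp
  ultimately have "hom2 (2 * 1) s H" if "hom2 1 s (subst2 H (in_u (fps_X * ubar)) (in_v (fps_X * ubar)))" for s H
    using that by (rule hom2_quadratic)
  from this[of 2 Theta1] this[of 4 Theta2] show "hom2 2 2 Theta1" "hom2 2 4 Theta2"
    using two_valued hom2_add[OF hom2_z] hom2_mult[OF hom2_z] by (auto simp: two_valued_law_def)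
qed

text \<open>Weights are halved because \<open>x\<close> has twice the weight of \<open>u\<close>:
  when \<open>E\<close> is the family of cobordism groups, index \<open>w\<close> means degree
  \<open>- 4 * w\<close>.\<close>

definition graded_part :: "int \<Rightarrow> 'a set"
  where "graded_part w = coefficient_ring Theta1 Theta2 \<inter> E (2 * w)"

lemma graded_part: "graded_family graded_part"
proof
  show "1 \<in> graded_part 0"
    by (simp add: graded_part_def coefficient_ring_def generated_subring.one one_E)
  show "0 \<in> graded_part w" for w
    by (simp add: graded_part_def coefficient_ring_def generated_subring_0 zero_E)
  show "x - y \<in> graded_part w" if "x \<in> graded_part w" "y \<in> graded_part w" for x y w
    using that by (simp add: graded_part_def coefficient_ring_def generated_subring.diff diff_E)
  show "x * y \<in> graded_part (v + w)" if "x \<in> graded_part v" "y \<in> graded_part w" for x y v w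
    using that mult_E[of x "2 * v" y "2 * w"]
    by (simp add: graded_part_def coefficient_ring_def generated_subring.mult)
qed

lemma Theta_graded_part:
  "Theta1 $ i $ j \<in> graded_part (int i + int j - 1)" "Theta2 $ i $ j \<in> graded_part (int i + int j - 2)"
proof -
  have "Theta1 $ i $ j \<in> coefficient_ring Theta1 Theta2" "Theta2 $ i $ j \<in> coefficient_ring Theta1 Theta2"
    unfolding coefficient_ring_def by (rule generated_subring.base; blast)+
  then show "Theta1 $ i $ j \<in> graded_part (int i + int j - 1)" "Theta2 $ i $ j \<in> graded_part (int i + int j - 2)"
    using hom2_nth[OF hom2_Theta(1), of i j] hom2_nth[OF hom2_Theta(2), of i j]
    by (simp_all add: graded_part_def algebra_simps)
qed

interpretation gp: graded_family graded_part
  by (rule graded_part)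

lemma half: obtains h where "(2 :: 'a) * h = 1"
proof -
  obtain h where "1 = of_int 2 * (h :: 'a)"
    using units[of 2] by (auto elim: dvdE)
  then show ?thesis using that[of h] by simp
qed

lemma quartic_graded: "quartic $ 0 = 0" "quartic $ Suc k \<in> graded_part (int k)"
proof -
  have "phi $ Suc 0 = 0" using phi_odd[of 1] by simp
  then have "(quartic oo phi) $ 0 = 0"
    by (simp add: quartic_phi fps_power_zeroth)
  then show "quartic $ 0 = 0" by simp
  show "quartic $ Suc k \<in> graded_part (int k)"
    using gp.diff_E[OF Theta_graded_part(2)[of 1 "Suc k", simplified] Theta_graded_part(1)[of 1 k, simplified]]
    by (simp add: quartic_def)
qed

lemma doubling_graded: "doubling $ Suc k \<in> graded_part (int k)"
proof -
  have "Theta1 $ p $ (Suc k - p) \<in> graded_part (int k)" if "p \<le> Suc k" for p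
    using Theta_graded_part(1)[of p "Suc k - p"] that by (simp add: of_nat_diff)
  then have "(\<Sum>p\<le>Suc k. Theta1 $ p $ (Suc k - p)) \<in> graded_part (int k)"
    by (intro gp.sum_E) simp
  then show ?thesis by (simp add: doubling_def)
qed

lemma power_of_2_multiple:
  "\<exists>s. of_int (2 ^ s) * (of_nat (2 * (k + 1) * Lcm {1..2 * k + 2}) * B $ (k + 1)) \<in> graded_part (int k)"
proof -
  let ?S = "range (\<lambda>s::nat. 2 ^ s :: int)"
  let ?E = "\<lambda>w. {x. \<exists>k::int\<in>?S. of_int k * x \<in> graded_part w}"
  have S: "1 \<in> ?S" "\<And>a b. a \<in> ?S \<Longrightarrow> b \<in> ?S \<Longrightarrow> a * b \<in> ?S"
    by (auto intro: range_eqI[of _ _ 0] simp flip: power_add)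
  interpret loc: graded_family ?E
    by (rule gp.graded_localization[OF S])
  obtain h where h: "(2 :: 'a) * h = 1" by (rule half)
  have 1: "x \<in> ?E w" if x: "2 * x \<in> ?E w" for x w
  proof -
    obtain s where "of_int (2 ^ s) * (2 * x) \<in> graded_part w" using x by blast
    then have "of_int (2 ^ Suc s) * x \<in> graded_part w" by (simp add: mult_ac)
    then show ?thesis by blast
  qed
  have 2: "quartic $ Suc i \<in> ?E (int i)" for i
    by (rule gp.localization_subset[OF S(1) quartic_graded(2)])
  have 3: "2 * i + 1 dvd Lcm {1..2 * k + 2}" if "i \<le> k" for i
    using that by (intro dvd_Lcm) auto
  have "of_nat (2 * (k + 1) * Lcm {1..2 * k + 2}) * B $ (k + 1) \<in> ?E (int k)"
    by (rule loc.quartic_ode_denominators[OF 1 h quartic_graded(1) 2 quartic_ode B(1,2) 3])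
  then show ?thesis by blast
qed

lemma odd_multiple:
  assumes "k + 1 < 2 ^ Suc r"
  shows "\<exists>c. odd c \<and> of_int c * (of_nat (2 ^ r * (k + 1)) * B $ (k + 1)) \<in> graded_part (int k)"
proof -
  let ?S = "{c::int. odd c}"
  let ?E = "\<lambda>w. {x. \<exists>k::int\<in>?S. of_int k * x \<in> graded_part w}"
  have S: "1 \<in> ?S" "\<And>a b. a \<in> ?S \<Longrightarrow> b \<in> ?S \<Longrightarrow> a * b \<in> ?S"
    by auto
  interpret loc: graded_family ?E
    by (rule gp.graded_localization[OF S])
  obtain h where h: "(2 :: 'a) * h = 1" by (rule half)
  have 1: "x \<in> ?E w" if c: "odd c" "of_int c * x \<in> ?E w" for c x w
  proof -
    obtain d where "odd d" "of_int d * (of_int c * x) \<in> graded_part w" using c(2) by blast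
    then have "odd (d * c)" "of_int (d * c) * x \<in> graded_part w" using c(1) by (auto simp: mult.assoc)
    then show ?thesis by blast
  qed
  have 2: "doubling $ Suc i \<in> ?E (int i)" for i
    by (rule gp.localization_subset[OF S(1) doubling_graded])
  have 3: "\<exists>y\<in>?E (int i - 1). doubling $ i = 2 * y" if "odd i" for i
  proof -
    have "Theta1 $ p $ (i - p) \<in> graded_part (int i - 1)" if "2 * p < i" for p
      using Theta_graded_part(1)[of p "i - p"] that by (simp add: of_nat_diff)
    then have "(\<Sum>p\<in>{p. 2 * p < i}. Theta1 $ p $ (i - p)) \<in> graded_part (int i - 1)"
      by (intro gp.sum_E) simp
    from gp.localization_subset[OF S(1) this] doubling_odd[OF that] show ?thesis
      by (intro bexI[of _ "\<Sum>p\<in>{p. 2 * p < i}. Theta1 $ p $ (i - p)"]) simp_all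
  qed
  have "of_nat (2 ^ r * (k + 1)) * B $ (k + 1) \<in> ?E (int (k + 1) - 1)"
    by (rule loc.doubling_denominators[OF 1 h doubling0 doubling1 2 3 B_doubling B(1,2) _ assms]) auto
  then show ?thesis by auto
qed

theorem d_factor_B: "of_nat (d_factor k) * B $ (k + 1) \<in> graded_part (int k)"
proof -
  let ?C = "of_nat (d_factor k) * B $ (k + 1)" and ?L = "Lcm {1..2 * k + 2}"
  have "2 dvd ?L" by (intro dvd_Lcm) auto
  then have d: "2 * d_factor k = (k + 1) * ?L"
    unfolding d_factor_def by simp
  obtain s where s: "of_int (2 ^ s) * (of_nat (2 * (k + 1) * ?L) * B $ (k + 1)) \<in> graded_part (int k)"
    using power_of_2_multiple by blast
  have "2 * (k + 1) * ?L = 4 * d_factor k"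
    using d by simp
  then have "of_int (2 ^ s) * (of_nat (2 * (k + 1) * ?L) * B $ (k + 1)) = of_int (2 ^ (s + 2)) * ?C"
    by (simp only:) (simp add: mult_ac)
  with s have 2: "of_int (2 ^ (s + 2)) * ?C \<in> graded_part (int k)" by simp
  \<comment> \<open>The largest power of 2 up to \<open>k + 1\<close>; its double is at most
    \<open>2 * k + 2\<close> and therefore divides the least common multiple.\<close>
  obtain r where r: "2 ^ r \<le> k + 1" "k + 1 < 2 ^ Suc r"
    using ex_power_ivl1[of 2 "k + 1"] by auto
  have "2 ^ Suc r dvd ?L"
    using r by (intro dvd_Lcm) auto
  then obtain l where l: "?L = 2 ^ Suc r * l" by (rule dvdE)
  have "2 * d_factor k = 2 * (l * (2 ^ r * (k + 1)))"
    unfolding d l by (simp only: power_Suc mult_ac)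
  then have d': "d_factor k = l * (2 ^ r * (k + 1))"
    by simp
  obtain c where c: "odd c" "of_int c * (of_nat (2 ^ r * (k + 1)) * B $ (k + 1)) \<in> graded_part (int k)"
    using odd_multiple[OF r(2)] by blast
  have "of_int c * ?C = of_nat l * (of_int c * (of_nat (2 ^ r * (k + 1)) * B $ (k + 1)))"
    unfolding d' of_nat_mult[of l] by (simp only: mult_ac)
  then have 3: "of_int c * ?C \<in> graded_part (int k)"
    using gp.of_nat_mult_E[OF c(2), of l] by simp
  have "coprime (2 ^ (s + 2)) c"
    using c(1) by (metis coprime_left_2_iff_odd coprime_power_left_iff)
  then obtain u v where "u * 2 ^ (s + 2) + v * c = 1"
    using bezout_int[of "2 ^ (s + 2)" c] by auto
  then have "?C = of_int (u * 2 ^ (s + 2) + v * c) * ?C" by simp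
  also have "\<dots> = of_int u * (of_int (2 ^ (s + 2)) * ?C) + of_int v * (of_int c * ?C)"
    by (simp only: of_int_add of_int_mult distrib_right mult.assoc)
  also have "\<dots> \<in> graded_part (int k)"
    by (intro gp.add_E gp.of_int_mult_E 2 3)
  finally show ?thesis .
qed

end

section \<open>The grading of the cobordism ring\<close>

lemma rationalized_units:
  assumes "k \<noteq> 0" shows "(of_int k :: 'a::{comm_ring_1, ring_char_0} rationalized) dvd 1"
proof -
  have "of_int k * fraction (1 :: 'a) k = 1"
    using fraction_mult[OF assms, of "1 :: 'a"] is_ring_hom_to_rationalized[where 'a = 'a]
    by (simp add: is_ring_hom_def)
  then show ?thesis by (rule dvdI[OF sym])
qed

lemma monom_degree_superset:
  assumes "finite S" "Poly_Mapping.keys m \<subseteq> S"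
  shows "monom_degree m = (\<Sum>(i, j)\<in>S. int (Poly_Mapping.lookup m (i, j)) * (2 - 2 * (int i + int j)))"
  unfolding monom_degree_def using assms
  by (intro sum.mono_neutral_left) (auto simp: in_keys_iff)

lemma monom_degree_add: "monom_degree (m + m') = monom_degree m + monom_degree m'"
proof -
  let ?S = "Poly_Mapping.keys m \<union> Poly_Mapping.keys m'"
  have "Poly_Mapping.keys (m + m') \<subseteq> ?S"
    by (rule Poly_Mapping.keys_add)
  then show ?thesis
    by (simp add: monom_degree_superset[where S = ?S] lookup_add distrib_right sum.distrib case_prod_unfold)
qed

lemma cobordism_groupI:
  "(\<And>m. m \<in> Poly_Mapping.keys p \<Longrightarrow> monom_degree m = d) \<Longrightarrow> x = to_rationalized (abs_lazard p) \<Longrightarrow>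
    x \<in> cobordism_group d"
  by (auto simp: cobordism_group_def)

lemma graded_cobordism: "graded_family (\<lambda>w. cobordism_group (- 2 * w))"
proof
  note hom = is_ring_hom_to_rationalized[where 'a = lazard] is_ring_hom_abs_lazard
  show "1 \<in> cobordism_group (- 2 * 0)"
  proof (rule cobordism_groupI[of 1])
    show "monom_degree m = - 2 * 0" if "m \<in> Poly_Mapping.keys (1 :: lazard_poly)" for m
      using that by (simp add: monom_degree_def flip: single_one)
  qed (use hom in \<open>simp add: is_ring_hom_def\<close>)
  show "0 \<in> cobordism_group (- 2 * w)" for w
    by (rule cobordism_groupI[of 0]) (simp_all add: is_ring_hom_0 hom)
  fix x y v w
  assume "x \<in> cobordism_group (- 2 * v)" "y \<in> cobordism_group (- 2 * w)"
  then obtain p q where p: "\<And>m. m \<in> Poly_Mapping.keys p \<Longrightarrow> monom_degree m = - 2 * v"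
    and q: "\<And>m. m \<in> Poly_Mapping.keys q \<Longrightarrow> monom_degree m = - 2 * w"
    and xy: "x = to_rationalized (abs_lazard p)" "y = to_rationalized (abs_lazard q)"
    by (auto simp: cobordism_group_def)
  show "x * y \<in> cobordism_group (- 2 * (v + w))"
  proof (rule cobordism_groupI[of "p * q"])
    fix m assume "m \<in> Poly_Mapping.keys (p * q)"
    then obtain a b where "m = a + b" "a \<in> Poly_Mapping.keys p" "b \<in> Poly_Mapping.keys q"
      using keys_mult[of p q] by blast
    then show "monom_degree m = - 2 * (v + w)"
      by (simp add: monom_degree_add p q)
  qed (simp add: xy is_ring_hom_mult hom)
next
  note hom = is_ring_hom_to_rationalized[where 'a = lazard] is_ring_hom_abs_lazard
  fix x y w
  assume "x \<in> cobordism_group (- 2 * w)" "y \<in> cobordism_group (- 2 * w)"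
  then obtain p q where p: "\<And>m. m \<in> Poly_Mapping.keys p \<Longrightarrow> monom_degree m = - 2 * w"
    and q: "\<And>m. m \<in> Poly_Mapping.keys q \<Longrightarrow> monom_degree m = - 2 * w"
    and xy: "x = to_rationalized (abs_lazard p)" "y = to_rationalized (abs_lazard q)"
    by (auto simp: cobordism_group_def)
  show "x - y \<in> cobordism_group (- 2 * w)"
  proof (rule cobordism_groupI[of "p - q"])
    fix m assume "m \<in> Poly_Mapping.keys (p - q)"
    then have "m \<in> Poly_Mapping.keys p \<union> Poly_Mapping.keys q"
      using Poly_Mapping.keys_diff[of p q] by blast
    then show "monom_degree m = - 2 * w"
      using p[of m] q[of m] by blast
  qed (simp add: xy is_ring_hom_diff hom)
qed

lemma formal_group_law_cobordism: "formal_group_law cobordism_fgl"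
  unfolding cobordism_fgl_def
  by (rule formal_group_law_map[OF is_ring_hom_to_rationalized formal_group_law_universal])

lemma cobordism_fgl_degree: "cobordism_fgl $ i $ j \<in> cobordism_group (2 - 2 * (int i + int j))"
proof (rule cobordism_groupI)
  show "cobordism_fgl $ i $ j =
      to_rationalized (abs_lazard (Poly_Mapping.single (Poly_Mapping.single (i, j) 1) 1))"
    by (simp add: cobordism_fgl_def universal_fgl_def generic_series_def)
qed (simp add: monom_degree_def)

section \<open>Divisibility of binomial coefficients\<close>

text \<open>Among the \<open>p\<close> consecutive factors \<open>p n + 1, ..., p n + p\<close> only
  the last is divisible by \<open>p\<close>, and it contributes 1 plus the exponent of
  \<open>n + 1\<close>.\<close>

lemma multiplicity_fact_mult_prime:
  assumes p: "prime (p :: nat)"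
  shows "multiplicity p (fact (p * n)) = n + multiplicity p (fact n :: nat)"
proof (induction n)
  case 0
  show ?case by simp
next
  case (Suc n)
  have "fact (p * Suc n) = fact (p * n) * (\<Prod>i=1..p. p * n + i :: nat)"
  proof -
    have "fact (p * Suc n) = (\<Prod>{1..p * n + p})"
      by (simp add: fact_prod algebra_simps)
    also have "{1..p * n + p} = {1..p * n} \<union> {p * n + 1..p * n + p}" by auto
    also have "\<Prod>\<dots> = \<Prod>{1..p * n} * \<Prod>{p * n + 1..p * n + p}"
      by (rule prod.union_disjoint) auto
    also have "\<Prod>{p * n + 1..p * n + p} = (\<Prod>i=1..p. p * n + i)"
      using prod.shift_bounds_cl_nat_ivl[of "\<lambda>x. x" 1 "p * n" p] by (simp add: add.commute)
    finally show ?thesis by (simp add: fact_prod)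
  qed
  also have "(\<Prod>i=1..p. p * n + i) = (\<Prod>i\<in>{1..<p}. p * n + i) * (p * Suc n)"
  proof -
    have "{1..p} = insert p {1..<p}" using prime_gt_0_nat[OF p] by auto
    then show ?thesis by (simp add: algebra_simps)
  qed
  also have "multiplicity p (fact (p * n) * ((\<Prod>i\<in>{1..<p}. p * n + i) * (p * Suc n))) =
      multiplicity p (fact (p * n) :: nat) + (multiplicity p (\<Prod>i\<in>{1..<p}. p * n + i) + multiplicity p (p * Suc n))"
    using p by (subst prime_elem_multiplicity_mult_distrib; (subst prime_elem_multiplicity_mult_distrib)?)
      (auto simp: prime_gt_0_nat)
  also have "multiplicity p (\<Prod>i\<in>{1..<p}. p * n + i) = 0"
  proof (rule not_dvd_imp_multiplicity_0)
    show "\<not> p dvd (\<Prod>i\<in>{1..<p}. p * n + i)"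
      using p by (auto simp: prime_dvd_prod_iff dvd_add_right_iff dest: dvd_imp_le)
  qed
  also have "multiplicity p (p * Suc n) = 1 + multiplicity p (Suc n)"
    using p by (subst prime_elem_multiplicity_mult_distrib) (auto simp: prime_gt_0_nat prime_nat_iff)
  finally have "multiplicity p (fact (p * Suc n)) =
      multiplicity p (fact (p * n) :: nat) + (0 + (1 + multiplicity p (Suc n)))" .
  moreover have "multiplicity p (fact (Suc n) :: nat) = multiplicity p (Suc n) + multiplicity p (fact n :: nat)"
    using p unfolding fact_Suc of_nat_id by (subst prime_elem_multiplicity_mult_distrib) auto
  ultimately show ?case
    using Suc by simp
qed

text \<open>The additional exponents \<open>n\<close>, \<open>k\<close> and \<open>n - k\<close> of
  the three factorials cancel.\<close>

lemma multiplicity_choose_mult_prime: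
  assumes p: "prime (p :: nat)" and k: "k \<le> n"
  shows "multiplicity p ((p * n) choose (p * k)) = multiplicity p (n choose k)"
proof -
  have *: "multiplicity p (fact b :: nat) + multiplicity p (fact (a - b) :: nat) + multiplicity p (a choose b) =
      multiplicity p (fact a :: nat)" if "b \<le> a" for a b
    using p that arg_cong[OF binomial_fact_lemma[OF that], of "multiplicity p"]
    by (simp add: prime_elem_multiplicity_mult_distrib)
  have "p * k \<le> p * n" "p * n - p * k = p * (n - k)"
    using k by (simp_all add: right_diff_distrib')
  with *[of "p * k" "p * n"] *[OF k] k show ?thesis
    by (simp add: multiplicity_fact_mult_prime[OF p])
qed

lemma multiplicity_choose_prime_power:
  assumes p: "prime (p :: nat)" and k: "k \<le> n"
  shows "multiplicity p ((p ^ a * n) choose (p ^ a * k)) = multiplicity p (n choose k)"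
proof (induction a)
  case (Suc a)
  then show ?case
    using multiplicity_choose_mult_prime[OF p, of "p ^ a * k" "p ^ a * n"] k by (simp add: mult.assoc)
qed simp

lemma central_binomial_Suc:
  "Suc k * (2 * Suc k choose Suc k) = 2 * ((2 * k + 1) * (2 * k choose k))"
proof -
  have a: "Suc k * (2 * Suc k choose Suc k) = (2 * Suc k) * ((2 * k + 1) choose k)"
    using Suc_times_binomial_eq[of "2 * k + 1" k] by (simp add: mult.commute)
  have "Suc k * ((2 * k + 1) choose Suc k) = (2 * k + 1) * (2 * k choose k)"
    using Suc_times_binomial_eq[of "2 * k" k] by (simp add: mult.commute)
  moreover have "(2 * k + 1) choose Suc k = (2 * k + 1) choose k"
    using binomial_symmetric[of "Suc k" "2 * k + 1"] by simp
  ultimately have b: "Suc k * ((2 * k + 1) choose k) = (2 * k + 1) * (2 * k choose k)" by simp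
  show ?thesis
    using a b by (simp add: mult.assoc)
qed

text \<open>Supplies a term whose denominator holds the full \<open>p\<close>-part of the least
  common multiple. The \<open>p\<close>-part of \<open>m\<close> is split off first, so that it
  divides both \<open>k\<close> and \<open>m - k\<close>; scaling by it leaves the exponent of a
  central binomial coefficient unchanged.\<close>

lemma ex_maximal_central_binomial:
  fixes p m :: nat
  assumes p: "prime p" and m: "m \<ge> 1" and R: "p ^ R \<le> 2 * m"
  shows "\<exists>k\<ge>1. k \<le> m \<and> p ^ multiplicity p m dvd k \<and> p ^ multiplicity p m dvd m - k \<and>
    R \<le> multiplicity p (k * (2 * k choose k))"
proof -
  define a where "a = multiplicity p m"
  have pa: "p ^ a dvd m" by (simp add: a_def multiplicity_dvd)
  then obtain m' where m': "m = p ^ a * m'" by (rule dvdE)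
  have m'1: "m' \<ge> 1" using m m' by (cases m') auto
  have p0: "p > 0" using p by (rule prime_gt_0_nat)
  have "\<exists>k'\<ge>1. k' \<le> m' \<and> R \<le> a + multiplicity p (k' * (2 * k' choose k'))"
  proof (cases "R \<le> a")
    case True
    then show ?thesis using m'1 by (intro exI[of _ 1]) auto
  next
    case False
    define s where "s = R - a"
    have Ra: "R = a + s" using False by (simp add: s_def)
    have "p ^ a * p ^ s \<le> p ^ a * (2 * m')"
      using R by (simp add: m' Ra power_add mult_ac)
    then have ps: "p ^ s \<le> 2 * m'" using p0 by simp
    show ?thesis
    proof (cases "p = 2")
      case True
      have s: "s > 0" using False by (simp add: s_def)
      \<comment> \<open>The factor \<open>k'\<close> supplies exponent \<open>s - 1\<close>, and the
        binomial coefficient one more, as does \<open>2 choose 1\<close>.\<close>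
      define k' where "k' = (2::nat) ^ (s - 1)"
      have "2 * k' = 2 ^ s" using s by (simp add: k'_def flip: power_Suc)
      then have 1: "k' \<ge> 1" "k' \<le> m'" using ps True by (auto simp: k'_def)
      have "multiplicity 2 (2 * k' choose k') = 1"
        using multiplicity_choose_prime_power[of 2 1 2 "s - 1"] by (simp add: k'_def mult.commute)
      then have "multiplicity p (k' * (2 * k' choose k')) = s"
        using s 1 by (simp add: True prime_elem_multiplicity_mult_distrib k'_def)
      then show ?thesis using 1 Ra by auto
    next
      case p2: False
      then have "odd p" using p primes_dvd_imp_eq two_is_prime_nat by blast
      then have odd: "odd (p ^ s)" by simp
      \<comment> \<open>Chosen so that \<open>2 * k' - 1 = p ^ s\<close>, a factor that
        \<open>central_binomial_Suc\<close> exhibits. Parity gives \<open>k' \<le> m'\<close>: the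
        odd number \<open>p ^ s\<close> cannot equal \<open>2 * m'\<close>.\<close>
      define k' where "k' = (p ^ s + 1) div 2"
      have k': "2 * k' = p ^ s + 1" using odd by (simp add: k'_def)
      then have 1: "k' \<ge> 1" using p0 by (cases k') auto
      have 2: "k' \<le> m'"
      proof -
        have "p ^ s \<noteq> 2 * m'" using odd by (metis dvd_triv_left)
        then show ?thesis using ps k' by linarith
      qed
      obtain j where j: "k' = Suc j" using 1 by (cases k') auto
      then have "2 * j + 1 = p ^ s" using k' by simp
      then have "p ^ s dvd k' * (2 * k' choose k')"
        unfolding j central_binomial_Suc by simp
      then have "s \<le> multiplicity p (k' * (2 * k' choose k'))"
        using p 1 by (intro multiplicity_geI) (auto simp: prime_nat_iff)
      then show ?thesis using 1 2 Ra by auto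
    qed
  qed
  then obtain k' where k': "k' \<ge> 1" "k' \<le> m'" "R \<le> a + multiplicity p (k' * (2 * k' choose k'))"
    by blast
  have "multiplicity p (p ^ a * k' * (2 * (p ^ a * k') choose (p ^ a * k'))) =
      a + multiplicity p (k' * (2 * k' choose k'))"
  proof -
    have "2 * (p ^ a * k') = p ^ a * (2 * k')" by simp
    then have "multiplicity p (2 * (p ^ a * k') choose (p ^ a * k')) = multiplicity p (2 * k' choose k')"
      using multiplicity_choose_prime_power[OF p, of k' "2 * k'" a] by (simp only:)
    then show ?thesis
      using p k'(1) p0 by (simp add: prime_elem_multiplicity_mult_distrib prime_elem_multiplicity_power_distrib)
  qed
  then show ?thesis
    unfolding a_def[symmetric] using k' p0
    by (intro exI[of _ "p ^ a * k'"]) (auto simp: m' simp flip: right_diff_distrib')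
qed

lemma multiplicity_Lcm_le:
  assumes p: "prime (p :: nat)" and R: "N < p ^ Suc R"
  shows "multiplicity p (Lcm {1..N}) \<le> R"
proof (rule ccontr)
  assume "\<not> ?thesis"
  then have dvd: "p ^ Suc R dvd Lcm {1..N}"
    by (intro multiplicity_dvd') simp
  obtain x where x: "x \<in> {1..N}" "p ^ Suc R dvd x"
  proof -
    have "\<exists>x\<in>{1..N}. p ^ Suc R dvd x"
      using dvd
    proof (induction N)
      case 0
      then show ?case using p by (simp add: prime_nat_iff)
    next
      case (Suc N)
      show ?case
      proof (rule ccontr)
        assume n: "\<not> ?case"
        then have "\<not> p ^ Suc R dvd Lcm {1..N}" "\<not> p ^ Suc R dvd Suc N"
          using Suc.IH by auto
        then have *: "multiplicity p (Lcm {1..N}) < Suc R" "multiplicity p (Suc N) < Suc R"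
          by (meson multiplicity_dvd' not_less)+
        have "Lcm {1..Suc N} = lcm (Suc N) (Lcm {1..N})"
          by (simp add: atLeastAtMostSuc_conv)
        then have "multiplicity p (Lcm {1..Suc N}) = max (multiplicity p (Suc N)) (multiplicity p (Lcm {1..N}))"
          using p by (simp add: multiplicity_lcm Lcm_0_iff)
        moreover have "Suc R \<le> multiplicity p (Lcm {1..Suc N})"
          using Suc.prems p by (intro multiplicity_geI) (auto simp: Lcm_0_iff prime_nat_iff)
        ultimately show False using * by simp
      qed
    qed
    then show ?thesis using that by blast
  qed
  then show False using R dvd_imp_le[of "p ^ Suc R" x] by auto
qed

text \<open>\<open>(k choose j) / (k\<^sup>2 * (2 * k choose k))\<close> is half the coefficient of \<open>t\<^sup>j x\<^sup>m\<close> in \<open>B(x + t x\<^sup>e\<^sup>+\<^sup>1)\<close>,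
  with \<open>B\<close> taken for the multiplicative group.\<close>

lemma ex_extremal_coefficient:
  fixes p m :: nat
  assumes p: "prime p" and m: "m \<ge> 1"
  shows "\<exists>k j e. k \<ge> 1 \<and> e \<ge> 1 \<and> k + j * e = m \<and> j \<le> k \<and>
    multiplicity p (m * Lcm {1..2 * m} * (k choose j)) \<le> multiplicity p (k\<^sup>2 * (2 * k choose k))"
proof -
  define a where "a = multiplicity p m"
  obtain R where R: "p ^ R \<le> 2 * m" "2 * m < p ^ Suc R"
    using ex_power_ivl1[of p "2 * m"] m prime_ge_2_nat[OF p] by auto
  obtain k where k: "k \<ge> 1" "k \<le> m" "p ^ a dvd k" "p ^ a dvd m - k" "R \<le> multiplicity p (k * (2 * k choose k))"
    using ex_maximal_central_binomial[OF p m R(1)] by (auto simp: a_def)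
  have L: "multiplicity p (Lcm {1..2 * m}) \<le> R"
    by (rule multiplicity_Lcm_le[OF p R(2)])
  \<comment> \<open>One factor \<open>k\<close> of the square pays for \<open>m\<close> and
    \<open>k choose j\<close>; the remaining \<open>k * (2 * k choose k)\<close> pays for the least
    common multiple.\<close>
  have bound: "multiplicity p (m * Lcm {1..2 * m} * (k choose j)) \<le> multiplicity p (k\<^sup>2 * (2 * k choose k))"
    if "j \<le> k" "a + multiplicity p (k choose j) \<le> multiplicity p k" for j
  proof -
    have "multiplicity p (m * Lcm {1..2 * m} * (k choose j)) =
        a + multiplicity p (Lcm {1..2 * m}) + multiplicity p (k choose j)"
      using p m that by (simp add: prime_elem_multiplicity_mult_distrib Lcm_0_iff a_def)
    also have "\<dots> \<le> multiplicity p k + multiplicity p (k * (2 * k choose k))"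
      using L k(5) that by linarith
    also have "\<dots> = multiplicity p (k\<^sup>2 * (2 * k choose k))"
      using p k(1) by (simp add: prime_elem_multiplicity_mult_distrib power2_eq_square)
    finally show ?thesis .
  qed
  show ?thesis
  proof (cases "k = m")
    case True
    then show ?thesis
      using m bound[of 0] by (intro exI[of _ k] exI[of _ 0] exI[of _ 1]) (simp add: a_def)
  next
    case False
    \<comment> \<open>With \<open>j = p ^ a\<close> the exponent of \<open>k choose j\<close> is
      that of \<open>k\<close> minus \<open>a\<close>, so together with the exponent
      \<open>a\<close> of \<open>m\<close> it uses up exactly one factor \<open>k\<close>.\<close>
    from k(3) obtain k' where k': "k = p ^ a * k'" by (rule dvdE)
    from k(4) obtain e where e: "m - k = p ^ a * e" by (rule dvdE)
    have "k' \<ge> 1" using k(1) k' by (cases k') auto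
    then have "multiplicity p (k choose p ^ a) = multiplicity p k'"
      using multiplicity_choose_prime_power[OF p, of 1 k' a] by (simp add: k')
    moreover have "multiplicity p k = a + multiplicity p k'"
      using p \<open>k' \<ge> 1\<close> by (simp add: k' prime_elem_multiplicity_mult_distrib prime_elem_multiplicity_power_distrib prime_gt_0_nat)
    moreover have "e \<ge> 1" using e False k(2) by (cases e) auto
    moreover have "p ^ a \<le> k" using k(1,3) by (intro dvd_imp_le) auto
    moreover have "k + p ^ a * e = m" using e k(2) by simp
    ultimately show ?thesis
      using k(1) bound[of "p ^ a"] by (intro exI[of _ k] exI[of _ "p ^ a"] exI[of _ e]) simp
  qed
qed

section \<open>Formal group laws with a given logarithm\<close>

lemma subst1_0: "g $ 0 = 0 \<Longrightarrow> subst1 g 0 = (0 :: 'a::comm_ring_1 fps fps)"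
  using bi.s1_J[of 0 g] by (auto simp: subst1_def fps_eq_iff power_0_left if_distrib[of "\<lambda>x. _ * x $ _ $ _"] cong: if_cong)

text \<open>After applying \<open>g\<close> the axioms become those of addition; associativity needs
  the three-variable instance \<open>tri\<close>.\<close>

lemma formal_group_law_logarithm:
  fixes f g :: "'a::comm_ring_1 fps"
  assumes f: "f $ 0 = 0" and g: "g $ 0 = 0" and fg: "f oo g = fps_X" and gf: "g oo f = fps_X"
  defines "F \<equiv> subst1 f (in_u g + in_v g)"
  shows "formal_group_law F" "subst1 g F = in_u g + in_v g"
proof -
  have ord: "in_u g + in_v g \<in> ord2 1"
    using g by (simp add: ord2_1 in_u_nth in_v_nth)
  show log: "subst1 g F = in_u g + in_v g"
    unfolding F_def using bi.s1_compose[OF f ord, of g] bi.s1_X[OF ord] by (simp add: bi_s1 gf)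
  have F: "F \<in> ord2 1"
    unfolding F_def using bi.s1_J[OF ord f] by (simp add: bi_s1)
  note * = bi.sb_logarithm[OF g fg log F, unfolded bi_s1]
  have uv: "in_u fps_X \<in> ord2 1" "in_v fps_X \<in> ord2 1" "(0 :: 'a fps fps) \<in> ord2 1"
    by (simp_all add: ord2_1 in_u_nth in_v_nth)
  have guv: "subst1 g (in_u fps_X) = in_u g" "subst1 g (in_v fps_X) = in_v g"
    by (simp_all flip: in_u_compose in_v_compose)
  have "subst2 F (in_u fps_X) 0 = in_u fps_X"
    unfolding *[OF uv(1,3)] guv by (simp add: subst1_0 g fg flip: in_u_compose)
  moreover have "subst2 F 0 (in_v fps_X) = in_v fps_X"
    unfolding *[OF uv(3,2)] guv by (simp add: subst1_0 g fg flip: in_v_compose)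
  moreover have "subst2 F (in_v fps_X) (in_u fps_X) = F"
    unfolding *[OF uv(2,1)] guv by (simp add: F_def add.commute)
  moreover have "assoc_left F = assoc_right F"
  proof -
    note tri = tri.sb_logarithm[OF g fg log F]
    let ?x = "fps_X :: 'a fps fps fps" and ?y = "fps_const fps_X :: 'a fps fps fps"
      and ?z = "fps_const (fps_const fps_X) :: 'a fps fps fps"
    have xyz: "?x \<in> ord3 1" "?y \<in> ord3 1" "?z \<in> ord3 1"
      by (simp_all add: ord3_def)
    have J: "subst3 F X Y \<in> ord3 1" and G: "tri.s1 g (subst3 F X Y) = tri.s1 g X + tri.s1 g Y"
      if "X \<in> ord3 1" "Y \<in> ord3 1" for X Y
    proof -
      have S: "tri.s1 g X + tri.s1 g Y \<in> ord3 1"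
        by (intro tri.J_add tri.s1_J that g)
      show "subst3 F X Y \<in> ord3 1"
        unfolding tri[OF that] by (rule tri.s1_J[OF S f])
      show "tri.s1 g (subst3 F X Y) = tri.s1 g X + tri.s1 g Y"
        unfolding tri[OF that] using tri.s1_compose[OF f S, of g] tri.s1_X[OF S] by (simp add: gf)
    qed
    show ?thesis
      unfolding assoc_left_def assoc_right_def
      by (simp only: tri[OF J[OF xyz(1,2)] xyz(3)] tri[OF xyz(1) J[OF xyz(2,3)]]
          G[OF xyz(1,2)] G[OF xyz(2,3)] add.assoc)
  qed
  ultimately show "formal_group_law F"
    by (simp add: formal_group_law_def)
qed

text \<open>\<open>l = g' oo f\<close> is additive, and the coefficient of \<open>u v^(j+1)\<close>
  in \<open>l(u + v)\<close> forces \<open>(j + 2) l $ (j + 2) = 0\<close>. This later identifies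
  the image of \<open>g\<close> under a homomorphism with the prescribed logarithm.\<close>

lemma logarithm_unique:
  fixes f g g' :: "'a::comm_ring_1 fps"
  assumes units: "\<And>k::int. k \<noteq> 0 \<Longrightarrow> (of_int k :: 'a) dvd 1"
    and f: "f $ 0 = 0" "f $ 1 = 1" and g: "g $ 0 = 0" and fg: "f oo g = fps_X" "g oo f = fps_X"
    and g': "g' $ 0 = 0" "g' $ 1 = 1" "subst1 g' (subst1 f (in_u g + in_v g)) = in_u g' + in_v g'"
  shows "g' = g"
proof -
  define l where "l = g' oo f"
  have uv: "in_u f \<in> ord2 1" "in_v f \<in> ord2 1" "in_u g + in_v g \<in> ord2 1" "in_u fps_X + in_v fps_X \<in> (ord2 1 :: 'a fps fps set)"
    using f g by (simp_all add: ord2_1 in_u_nth in_v_nth)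
  have F: "subst1 f (in_u g + in_v g) \<in> ord2 1"
    using bi.s1_J[OF uv(3) f(1)] by (simp add: bi_s1)
  have "subst2 (subst1 g' (subst1 f (in_u g + in_v g))) (in_u f) (in_v f) = in_u l + in_v l"
    unfolding g'(3) l_def
    by (simp add: bi.sb_add[OF uv(1,2)] bi.sb_in_u[OF uv(1,2)] bi.sb_in_v[OF uv(1,2)] bi_s1 in_u_compose in_v_compose f)
  moreover have "subst2 (subst1 g' (subst1 f (in_u g + in_v g))) (in_u f) (in_v f) = subst1 l (in_u fps_X + in_v fps_X)"
  proof -
    have "subst2 (in_u g + in_v g) (in_u f) (in_v f) = in_u fps_X + in_v fps_X"
      using fg(2) f(1)
      by (simp add: bi.sb_add[OF uv(1,2)] bi.sb_in_u[OF uv(1,2)] bi.sb_in_v[OF uv(1,2)] bi_s1 flip: in_u_compose in_v_compose)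
    then show ?thesis
      unfolding l_def using bi.s1_compose[OF f(1) uv(4), of g']
      by (simp add: bi.sb_subst1[OF F uv(1,2)] bi.sb_subst1[OF uv(3,1,2)] bi_s1)
  qed
  ultimately have eq: "subst1 l (in_u fps_X + in_v fps_X) = in_u l + in_v l" by simp
  have "l $ n = fps_X $ n" for n
  proof -
    consider "n = 0" | "n = 1" | j where "n = Suc (Suc j)"
      by (metis One_nat_def not0_implies_Suc)
    then show ?thesis
    proof cases
      case 3
      have "of_nat (Suc (Suc j) choose 1) * l $ Suc (Suc j) = 0"
        using arg_cong[OF eq, of "\<lambda>h. h $ 1 $ Suc j"] subst1_linear_nth[of l 1 1 "Suc j"]
        by (simp add: in_u_nth in_v_nth)
      then have "of_int (int (Suc (Suc j))) * l $ Suc (Suc j) = 0"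
        by simp
      moreover obtain y where "1 = of_int (int (Suc (Suc j))) * (y :: 'a)"
        using units[of "int (Suc (Suc j))"] by (auto elim: dvdE)
      ultimately have "l $ Suc (Suc j) = 0"
        by (metis mult.commute mult.left_commute mult_1 mult_zero_right)
      then show ?thesis using 3 by simp
    qed (use f g' in \<open>simp_all add: l_def fps_compose_nth\<close>)
  qed
  then have "g' oo f = fps_X" by (simp add: l_def[symmetric] fps_eq_iff)
  then have "(g' oo f) oo g = g"
    by (simp add: X_compose g)
  then show ?thesis
    by (simp add: compose_assoc f g fg)
qed

section \<open>Homomorphisms out of the rationalization\<close>

lemma ex_rationalized_hom:
  fixes h :: "'a::{comm_ring_1, ring_char_0} \<Rightarrow> 'b::comm_ring_1"
  assumes h: "is_ring_hom h" and units: "\<And>k::int. k \<noteq> 0 \<Longrightarrow> (of_int k :: 'b) dvd 1"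
  shows "\<exists>H. is_ring_hom H \<and> (\<forall>a. H (to_rationalized a) = h a)"
proof -
  note to = is_ring_hom_to_rationalized[where 'a = 'a]
  have cancel: "x = y" if k: "k \<noteq> 0" "of_int k * x = of_int k * (y :: 'b)" for k x y
  proof -
    obtain u where u: "1 = of_int k * (u :: 'b)" using units[OF k(1)] by (rule dvdE)
    have "x = u * (of_int k * x)" "y = u * (of_int k * y)"
      using u by (metis mult.assoc mult.commute mult_1)+
    with k(2) show ?thesis by simp
  qed
  have den: "\<exists>m a. m \<noteq> 0 \<and> of_int m * x = to_rationalized a" for x :: "'a rationalized"
    by (metis rationalized_cases fraction_mult)
  \<comment> \<open>The value is characterized by all fractions representing \<open>x\<close> at
    once. Two of them agree only up to a nonzero integer \<open>k\<close>, which is cancelled in the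
    target.\<close>
  have "\<exists>y. \<forall>m a. of_int m * x = to_rationalized a \<longrightarrow> of_int m * y = h a" for x
  proof -
    obtain m a where m: "m \<noteq> 0" "of_int m * x = to_rationalized a" using den by blast
    obtain u where u: "1 = of_int m * (u :: 'b)" using units[OF m(1)] by (rule dvdE)
    define y where "y = u * h a"
    have my: "of_int m * y = h a"
      using u by (simp add: y_def flip: mult.assoc)
    have "of_int n * y = h b" if n: "of_int n * x = to_rationalized b" for n b
    proof -
      have "to_rationalized (of_int n * a - of_int m * b) = of_int n * (of_int m * x) - of_int m * (of_int n * x)"
        by (simp add: is_ring_hom_diff[OF to] is_ring_hom_mult[OF to] is_ring_hom_of_int[OF to] m n)
      also have "\<dots> = 0" by (simp add: mult.left_commute)
      finally obtain k :: int where k: "k \<noteq> 0" "of_int k * (of_int n * a - of_int m * b) = 0"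
        unfolding to_rationalized_eq_0_iff by blast
      have "of_int k * (of_int n * h a - of_int m * h b) = h (of_int k * (of_int n * a - of_int m * b))"
        by (simp add: is_ring_hom_diff[OF h] is_ring_hom_mult[OF h] is_ring_hom_of_int[OF h])
      then have "of_int k * (of_int n * h a - of_int m * h b) = of_int k * 0"
        by (simp add: k is_ring_hom_0[OF h])
      then have "of_int n * h a - of_int m * h b = 0"
        by (rule cancel[OF k(1)])
      then have "of_int m * (of_int n * y) = of_int m * h b"
        by (simp add: my[symmetric] mult.left_commute)
      then show ?thesis by (rule cancel[OF m(1)])
    qed
    then show ?thesis by blast
  qed
  then obtain H where H: "\<And>x m a. of_int m * x = to_rationalized a \<Longrightarrow> of_int m * H x = h a"
    by metis
  have 1: "H (to_rationalized a) = h a" for a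
    using H[of 1 "to_rationalized a" a] by simp
  have "H 1 = 1"
    using 1[of 1] to h by (simp add: is_ring_hom_def)
  moreover have "H (x + y) = H x + H y \<and> H (x * y) = H x * H y" for x y
  proof -
    obtain m a where m: "m \<noteq> 0" "of_int m * x = to_rationalized a" using den by blast
    obtain n b where n: "n \<noteq> 0" "of_int n * y = to_rationalized b" using den by blast
    have "of_int (m * n) * (x + y) = of_int n * (of_int m * x) + of_int m * (of_int n * y)"
      "of_int (m * n) * (x * y) = (of_int m * x) * (of_int n * y)"
      by (simp_all add: algebra_simps)
    moreover have "to_rationalized (c + d) = to_rationalized c + to_rationalized d" for c d :: 'a
      using to by (simp add: is_ring_hom_def)
    ultimately have "of_int (m * n) * (x + y) = to_rationalized (of_int n * a + of_int m * b)"
      "of_int (m * n) * (x * y) = to_rationalized (a * b)"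
      by (simp_all add: m n is_ring_hom_mult[OF to] is_ring_hom_of_int[OF to])
    from this[THEN H] have "of_int (m * n) * H (x + y) = h (of_int n * a + of_int m * b)"
      "of_int (m * n) * H (x * y) = h (a * b)" .
    moreover have "h (c + d) = h c + h d" for c d
      using h by (simp add: is_ring_hom_def)
    ultimately have "of_int (m * n) * H (x + y) = of_int n * (of_int m * H x) + of_int m * (of_int n * H y)"
      "of_int (m * n) * H (x * y) = (of_int m * H x) * (of_int n * H y)"
      by (simp_all add: H[OF m(2)] H[OF n(2)] is_ring_hom_mult[OF h] is_ring_hom_of_int[OF h])
    then have "of_int (m * n) * H (x + y) = of_int (m * n) * (H x + H y)"
      "of_int (m * n) * H (x * y) = of_int (m * n) * (H x * H y)"
      by (simp_all add: algebra_simps)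
    moreover have "m * n \<noteq> 0" using m n by simp
    ultimately show ?thesis using cancel by blast
  qed
  ultimately show ?thesis
    using 1 by (intro exI[of _ H]) (auto simp: is_ring_hom_def)
qed

context
  fixes H :: "'a::comm_ring_1 \<Rightarrow> 'b::comm_ring_1"
  assumes H: "is_ring_hom H"
begin

lemma map_fps_compose: "map_fps H (a oo b) = map_fps H a oo map_fps H b"
  unfolding fps_eq_iff fps_compose_nth map_fps_nth is_ring_hom_sum[OF H]
  by (simp add: is_ring_hom_mult[OF H] flip: is_ring_hom_power[OF is_ring_hom_map_fps[OF H]])

lemma map_in_u: "map_fps (map_fps H) (in_u h) = in_u (map_fps H h)"
  and map_in_v: "map_fps (map_fps H) (in_v h) = in_v (map_fps H h)"
  by (auto simp: fps_eq_iff in_u_nth in_v_nth is_ring_hom_0[OF H])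

lemma map_subst1: "map_fps (map_fps H) (subst1 h X) = subst1 (map_fps H h) (map_fps (map_fps H) X)"
  using map_subst2[OF H, of "in_u h" X 0]
  by (simp add: bi_s1[symmetric] bi.s1_def map_in_u is_ring_hom_0[OF is_ring_hom_map_fps[OF is_ring_hom_map_fps[OF H]]])

lemma two_valued_group_map:
  assumes "two_valued_group F g f ubar B Theta1 Theta2"
    and units': "\<And>k::int. k \<noteq> 0 \<Longrightarrow> (of_int k :: 'b) dvd 1"
  shows "two_valued_group (map_fps (map_fps H) F) (map_fps H g) (map_fps H f) (map_fps H ubar) (map_fps H B)
    (map_fps (map_fps H) Theta1) (map_fps (map_fps H) Theta2)"
proof -
  interpret two_valued_group F g f ubar B Theta1 Theta2 by fact
  note H1 = is_ring_hom_map_fps[OF H]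
  note H2 = is_ring_hom_map_fps[OF H1]
  have add: "map_fps (map_fps H) (a + b) = map_fps (map_fps H) a + map_fps (map_fps H) b" for a b
    using H2 by (simp add: is_ring_hom_def)
  have uminus: "map_fps H (- a) = - map_fps H a" for a
    using is_ring_hom_diff[OF H1, of 0 a] by (simp add: is_ring_hom_0[OF H1])
  have one: "H 1 = 1" using H by (simp add: is_ring_hom_def)
  have z: "map_fps (map_fps H) (z_plus F ubar) = z_plus (map_fps (map_fps H) F) (map_fps H ubar)"
    "map_fps (map_fps H) (z_minus F ubar) = z_minus (map_fps (map_fps H) F) (map_fps H ubar)"
    by (simp_all add: z_plus_def z_minus_def is_ring_hom_mult[OF H2] map_subst2[OF H] map_in_u map_in_v map_fps_X[OF H])
  show ?thesis
  proof
    show "k \<noteq> 0 \<Longrightarrow> (of_int k :: 'b) dvd 1" for k by (rule units')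
    show "map_fps (map_fps H) F $ 0 $ 0 = 0" by (simp add: F0 is_ring_hom_0[OF H])
    show "is_logarithm (map_fps (map_fps H) F) (map_fps H g)"
      using g0 g1 arg_cong[OF log_sum, of "map_fps (map_fps H)"]
      by (simp add: is_logarithm_def is_ring_hom_0[OF H] one map_subst1 add map_in_u map_in_v)
    show "map_fps H f $ 0 = 0" by (simp add: exp is_ring_hom_0[OF H])
    show "map_fps H f oo map_fps H g = fps_X" "map_fps H g oo map_fps H f = fps_X"
      by (simp_all add: exp map_fps_X[OF H] flip: map_fps_compose)
    show "map_fps H ubar = map_fps H f oo - map_fps H g"
      by (simp add: inverse map_fps_compose uminus)
    show "map_fps H B $ 0 = 0" "map_fps H B $ 1 = 1"
      using B(1,2) by (simp_all add: is_ring_hom_0[OF H] one)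
    show "map_fps H B oo fps_X * map_fps H ubar = - (map_fps H g)\<^sup>2"
      using arg_cong[OF B(3), of "map_fps H"]
      by (simp add: map_fps_compose is_ring_hom_mult[OF H1] map_fps_X[OF H] uminus is_ring_hom_power[OF H1])
    show "two_valued_law (map_fps (map_fps H) F) (map_fps H ubar) (map_fps (map_fps H) Theta1) (map_fps (map_fps H) Theta2)"
      using two_valued arg_cong[of _ _ "map_fps (map_fps H)"]
      by (simp add: two_valued_law_def map_subst2[OF H, symmetric] map_in_u[symmetric] map_in_v[symmetric]
          map_fps_X[OF H, symmetric] is_ring_hom_mult[OF H1, symmetric] z[symmetric] add[symmetric]
          is_ring_hom_mult[OF H2, symmetric])
  qed
qed

end

text \<open>Realizes a prescribed \<open>phi\<close> by a formal group. In
  \<open>psi = - w^2 R^2\<close> with \<open>R $ 0 = 1\<close>, evenness leaves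
  \<open>R(- w)\<close> equal to \<open>R\<close> or \<open>- R\<close>, and the constant term
  selects \<open>R\<close>. Then \<open>f = w R\<close> is odd and
  \<open>f(w) f(- w) = - f(w)^2\<close>.\<close>

lemma ex_odd_fps_factor:
  fixes psi :: "'k::field_char_0 fps"
  assumes start: "quadratic_start psi" and even: "psi oo - fps_X = psi"
  shows "\<exists>f g. f $ 0 = 0 \<and> f $ 1 = 1 \<and> g $ 0 = 0 \<and> f oo g = fps_X \<and> g oo f = fps_X \<and>
    f * (f oo - fps_X) = psi"
proof -
  define A where "A = - fps_shift 2 psi"
  have psi: "psi = - (fps_X ^ 2 * A)"
  proof (rule fps_ext)
    fix n :: nat
    have "n = 0 \<or> n = 1 \<or> n = (n - 2) + 2" by arith
    then consider "n = 0" | "n = 1" | m where "n = m + 2" by blast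
    then show "psi $ n = (- (fps_X ^ 2 * A)) $ n"
      using start by cases (auto simp: A_def quadratic_start_def fps_X_power_mult_nth)
  qed
  have "A $ 0 = 1"
    using start by (simp add: A_def quadratic_start_def numeral_2_eq_2)
  from ex_fps_sqrt[OF _ this, of "1 / 2"] obtain R where R: "R $ 0 = 1" "R * R = A"
    by auto
  have X: "(fps_X oo - fps_X) = (- fps_X :: 'k fps)"
    by (simp add: X_compose)
  have "A oo - fps_X = A"
  proof -
    have "fps_X ^ 2 * (A oo - fps_X) = fps_X ^ 2 * A"
      using even unfolding psi by (simp add: fps_compose_uminus compose_mult compose_power X)
    then show ?thesis by simp
  qed
  then have "(R oo - fps_X) ^ 2 = R ^ 2"
    by (simp add: power2_eq_square R(2) flip: compose_mult)
  then have "R oo - fps_X = R \<or> R oo - fps_X = - R"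
    by (simp add: power2_eq_iff)
  moreover have "(R oo - fps_X) $ 0 \<noteq> (- R) $ 0"
    using R(1) by simp
  ultimately have R_even: "R oo - fps_X = R" by metis
  define f where "f = fps_X * R"
  have f: "f $ 0 = 0" "f $ 1 = 1"
    using R(1) by (simp_all add: f_def)
  have "f * (f oo - fps_X) = psi"
    by (simp add: f_def compose_mult X R_even psi R(2)[symmetric] power2_eq_square mult_ac)
  moreover have "fps_inv f oo f = fps_X" "f oo fps_inv f = fps_X"
    using f by (simp_all add: fps_inv fps_inv_right)
  moreover have "fps_inv f $ 0 = 0"
    by (simp add: fps_inv_def)
  ultimately show ?thesis
    using f by blast
qed

section \<open>The multiplicative group\<close>

text \<open>This is \<open>f(w) f(- w)\<close> for \<open>f(w) = e^w - 1\<close>, the exponential of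
  \<open>u + v + u v\<close>.\<close>

definition mult_phi :: "'k::field_char_0 fps"
  where "mult_phi = fps_const 2 - fps_exp 1 - fps_exp (- 1)"

text \<open>The series of \<open>4 arcsin(sqrt x / 2)^2\<close>; as
  \<open>mult_phi = - 4 sinh(w / 2)^2\<close>, its value there is \<open>- w^2\<close>. For
  \<open>k = 0\<close> division by zero yields the constant term 0.\<close>

definition mult_B :: "'k::field_char_0 fps"
  where "mult_B = Abs_fps (\<lambda>k. 2 / of_nat (k\<^sup>2 * (2 * k choose k)))"

lemma mult_phi_start: "quadratic_start (mult_phi :: 'k::field_char_0 fps)"
  by (simp add: quadratic_start_def mult_phi_def power2_eq_square)

lemma fps_exp_mult_neg: "fps_exp 1 * fps_exp (- 1) = (1 :: 'k::field_char_0 fps)"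
  by (simp flip: fps_exp_add_mult)

lemma mult_phi_even: "mult_phi oo - fps_X = (mult_phi :: 'k::field_char_0 fps)"
proof -
  have "fps_exp c oo - fps_X = fps_exp (- c :: 'k)" for c
    by (simp add: fps_compose_uminus' fps_eq_iff power_minus[of c])
  then show ?thesis
    by (simp add: mult_phi_def fps_compose_sub_distrib compose_const)
qed

lemma mult_B_Suc:
  "of_nat (k\<^sup>2) * (mult_B :: 'k::field_char_0 fps) $ k + (if k = 0 then 2 else 0) = of_nat (2 * (k + 1) * (2 * k + 1)) * mult_B $ Suc k"
proof (cases "k = 0")
  case False
  have "(Suc k)\<^sup>2 * (2 * Suc k choose Suc k) = 2 * (k + 1) * (2 * k + 1) * (2 * k choose k)"
    unfolding power2_eq_square mult.assoc central_binomial_Suc by (simp only: Suc_eq_plus1 mult_ac)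
  then have "(mult_B :: 'k fps) $ Suc k = 2 / of_nat (2 * (k + 1) * (2 * k + 1) * (2 * k choose k))"
    by (simp only: mult_B_def fps_nth_Abs_fps)
  moreover have "2 * (k + 1) * (2 * k + 1) > (0::nat)" "(2 * k choose k) > 0" by auto
  ultimately show ?thesis
    using False by (simp add: mult_B_def del: of_nat_Suc mult_Suc_right of_nat_add of_nat_power)
qed (simp add: mult_B_def)

text \<open>Obtained from \<open>B(phi) = - w^2\<close> by differentiating twice, with
  \<open>phi'^2 = phi^2 - 4 phi\<close> and \<open>phi'' = phi - 2\<close>; on coefficients it is
  the recursion \<open>mult_B_Suc\<close>.\<close>

lemma mult_B_ode:
  "(fps_X ^ 2 - fps_const 4 * fps_X) * fps_deriv (fps_deriv mult_B) + (fps_X - fps_const 2) * fps_deriv mult_B =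
    (- fps_const 2 :: 'k::field_char_0 fps)"
proof (rule fps_ext)
  fix k
  let ?b = "mult_B :: 'k fps"
  have "((fps_X ^ 2 - fps_const 4 * fps_X) * fps_deriv (fps_deriv ?b) + (fps_X - fps_const 2) * fps_deriv ?b) $ k =
      of_nat (k\<^sup>2) * ?b $ k - of_nat (2 * (k + 1) * (2 * k + 1)) * ?b $ Suc k"
  proof -
    have 1: "(fps_X ^ 2 * fps_deriv (fps_deriv ?b)) $ k = of_nat k * of_nat (k - 1) * ?b $ k"
    proof -
      have "k = 0 \<or> k = 1 \<or> k = Suc (Suc (k - 2))" by arith
      then consider "k = 0" | "k = 1" | j where "k = Suc (Suc j)" by blast
      then show ?thesis by cases (simp_all add: fps_X_power_mult_nth)
    qed
    have 2: "(fps_X * fps_deriv (fps_deriv ?b)) $ k = of_nat k * of_nat (k + 1) * ?b $ Suc k"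
      by (cases k) simp_all
    have 3: "(fps_X * fps_deriv ?b) $ k = of_nat k * ?b $ k"
      by (cases k) simp_all
    have 4: "of_nat k * of_nat (k - 1) + of_nat k = (of_nat (k\<^sup>2) :: 'k)"
      by (cases k) (simp_all add: power2_eq_square algebra_simps)
    have "((fps_X ^ 2 - fps_const 4 * fps_X) * fps_deriv (fps_deriv ?b) + (fps_X - fps_const 2) * fps_deriv ?b) $ k =
        (of_nat k * of_nat (k - 1) + of_nat k) * ?b $ k - (4 * of_nat k * of_nat (k + 1) + 2 * of_nat (k + 1)) * ?b $ Suc k"
      by (simp add: left_diff_distrib mult.assoc 1 2 3 del: of_nat_Suc) (simp add: algebra_simps)
    then show ?thesis
      unfolding 4 by (simp add: algebra_simps)
  qed
  also have "\<dots> = (- fps_const 2) $ k"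
    using mult_B_Suc[of k, where 'k = 'k] by (cases k) (auto simp: algebra_simps simp del: of_nat_Suc)
  finally show "((fps_X ^ 2 - fps_const 4 * fps_X) * fps_deriv (fps_deriv ?b) + (fps_X - fps_const 2) * fps_deriv ?b) $ k =
      (- fps_const 2) $ k" .
qed

text \<open>The differential equation gives \<open>y = mult_B oo mult_phi\<close> the second
  derivative \<open>- 2\<close>, and its two initial coefficients vanish.\<close>

lemma mult_B_phi: "mult_B oo mult_phi = (- (fps_X ^ 2) :: 'k::field_char_0 fps)"
proof -
  let ?p = "mult_phi :: 'k fps" and ?b = "mult_B :: 'k fps"
  have p0: "?p $ 0 = 0" by (simp add: mult_phi_def)
  have d1: "fps_deriv ?p = fps_exp (- 1) - fps_exp 1"
    by (simp add: mult_phi_def flip: fps_const_neg)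
  have d2: "fps_deriv (fps_deriv ?p) = ?p - fps_const 2"
    unfolding d1 by (simp add: mult_phi_def flip: fps_const_neg)
  have d1sq: "(fps_deriv ?p) ^ 2 = ?p ^ 2 - fps_const 4 * ?p"
  proof -
    have *: "(b - a)\<^sup>2 = (fps_const 2 - a - b)\<^sup>2 - fps_const 4 * (fps_const 2 - a - b)" if "a * b = 1" for a b :: "'k fps"
      using that by (simp add: power2_eq_square algebra_simps numeral_fps_const[symmetric])
    show ?thesis
      unfolding d1 unfolding mult_phi_def by (rule *[OF fps_exp_mult_neg])
  qed
  define y where "y = ?b oo ?p"
  have dy: "fps_deriv y = (fps_deriv ?b oo ?p) * fps_deriv ?p"
    unfolding y_def by (rule chain_rule[OF p0])
  have "fps_deriv (fps_deriv y) = (fps_deriv (fps_deriv ?b) oo ?p) * (fps_deriv ?p) ^ 2 + (fps_deriv ?b oo ?p) * fps_deriv (fps_deriv ?p)"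
    unfolding dy by (simp add: chain_rule[OF p0] power2_eq_square algebra_simps)
  also have "\<dots> = ((fps_X ^ 2 - fps_const 4 * fps_X) * fps_deriv (fps_deriv ?b) + (fps_X - fps_const 2) * fps_deriv ?b) oo ?p"
    unfolding d1sq d2
    by (simp add: fps_compose_add_distrib compose_mult[OF p0] fps_compose_sub_distrib compose_power[OF p0] X_compose[OF p0]
        compose_const mult.commute)
  also have "\<dots> = - fps_const 2"
    unfolding mult_B_ode by (simp add: fps_compose_uminus compose_const)
  finally have y2: "fps_deriv (fps_deriv y) = - fps_const 2" .
  have b0: "?b $ 0 = 0" by (simp add: mult_B_def)
  have "y $ n = (- (fps_X ^ 2)) $ n" for n
  proof -
    have "n = 0 \<or> n = 1 \<or> n = Suc (Suc (n - 2))" by arith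
    then consider "n = 0" | "n = 1" | j where "n = Suc (Suc j)" by blast
    then show ?thesis
    proof cases
      case 1
      then show ?thesis by (simp add: y_def b0)
    next
      case 2
      then show ?thesis
        using mult_phi_start[where 'k = 'k] by (simp add: y_def fps_compose_nth b0 quadratic_start_def)
    next
      case 3
      have "of_nat (j + 1) * (of_nat (j + 2) * y $ Suc (Suc j)) = (- fps_const 2) $ j"
        using arg_cong[OF y2, of "\<lambda>h. h $ j"] by (simp del: of_nat_Suc)
      then have "of_nat (j + 1) * of_nat (j + 2) * (y $ Suc (Suc j) + (if j = 0 then 1 else 0)) = 0"
        by (cases j) (simp_all add: algebra_simps)
      then have "y $ Suc (Suc j) + (if j = 0 then 1 else 0) = 0"
        by (simp del: of_nat_Suc of_nat_add)
      then show ?thesis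
        using 3 by (simp add: fps_X_power_nth eq_neg_iff_add_eq_0 split: if_splits)
    qed
  qed
  then show ?thesis by (simp add: y_def[symmetric] fps_eq_iff)
qed

lemma (in graded_family) compose_nth_E:
  assumes "\<And>i. h $ i \<in> E 0" "\<And>i. a $ i \<in> E 0"
  shows "(h oo a) $ n \<in> E 0"
proof -
  have "(a ^ p) $ i \<in> E 0" for p i
    using power_nth_E[of i a 0 0 i p] assms(2) by simp
  then show ?thesis
    unfolding fps_compose_nth by (intro sum_E mult_E'[OF assms(1)]) auto
qed

lemma fps_exp_sum:
  "subst1 (fps_exp c) (in_u fps_X + fps_const (fps_const s) * in_v fps_X) =
    in_u (fps_exp c) * in_v (fps_exp (s * c :: 'k::field_char_0))"
proof (intro fps_ext)
  fix i j
  have "of_nat (i + j choose i) / fact (i + j) = (1 / (fact i * fact j) :: 'k)"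
    using binomial_fact[of i "i + j", where 'a = 'k] by simp
  then have "of_nat (i + j choose i) / fact (i + j) * (s ^ j * c ^ (i + j)) =
      1 / (fact i * fact j) * (s ^ j * c ^ (i + j))"
    by (rule arg_cong)
  then show "subst1 (fps_exp c) (in_u fps_X + fps_const (fps_const s) * in_v fps_X) $ i $ j =
      (in_u (fps_exp c) * in_v (fps_exp (s * c))) $ i $ j"
    unfolding subst1_linear_nth in_u_in_v_nth by (simp add: power_add power_mult_distrib ac_simps)
qed

text \<open>\<open>l\<close> is the logarithm of \<open>1 + x\<close>; in the coordinate
  \<open>x\<close> both \<open>e^w\<close> and \<open>e^(-w)\<close> have integer
  coefficients.\<close>

lemma fps_exp_compose_log:
  obtains l :: "'k::field_char_0 fps" where "l $ 0 = 0" "l $ 1 = 1" "fps_exp 1 oo l = 1 + fps_X"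
    "fps_exp (- 1) oo l = Abs_fps (\<lambda>n. (- 1) ^ n)"
proof -
  define a :: "'k fps" where "a = fps_exp 1 - 1"
  define l where "l = fps_inv a"
  have a: "a $ 0 = 0" "a $ 1 = 1" by (simp_all add: a_def)
  then have al: "a oo l = fps_X"
    unfolding l_def by (intro fps_inv_right) auto
  have l0: "l $ 0 = 0" by (simp add: l_def fps_inv_def)
  have l1: "l $ 1 = 1"
    using arg_cong[OF al, of "\<lambda>h. h $ 1"] a l0 by (simp add: fps_compose_nth)
  have e: "fps_exp 1 oo l = 1 + fps_X"
    using al by (simp add: a_def fps_compose_sub_distrib algebra_simps)
  have "(1 + fps_X) * (fps_exp (- 1) oo l) = 1"
    unfolding e[symmetric] by (simp add: fps_exp_mult_neg flip: compose_mult[OF l0])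
  moreover have "(1 + fps_X) * Abs_fps (\<lambda>n. (- 1) ^ n) = (1 :: 'k fps)"
  proof (rule fps_ext)
    fix n show "((1 + fps_X) * Abs_fps (\<lambda>n. (- 1) ^ n)) $ n = (1 :: 'k fps) $ n"
      by (cases n) (simp_all add: distrib_right)
  qed
  ultimately have "fps_exp (- 1) oo l = Abs_fps (\<lambda>n. (- 1) ^ n)"
    by (rule fps_unit_cancel[of "1 + fps_X", OF _ trans[OF _ sym], rotated]) simp
  with l0 l1 e show ?thesis by (rule that)
qed

text \<open>In the coordinate \<open>e^w = 1 + x\<close> the series \<open>phi(w)\<close>,
  \<open>phi(w + t)\<close> and \<open>phi(w - t)\<close> are \<open>sigma\<close> applied to series
  with integer coefficients, although \<open>f\<close> may have denominators. The triangular
  recursion then descends to the law.\<close>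

lemma Theta_subring:
  fixes F :: "'k::field_char_0 fps fps"
  assumes "two_valued_group F g f ubar B Theta1 Theta2" and "graded_family (\<lambda>_. A)"
    and f: "f * (f oo - fps_X) = sigma oo mult_phi"
    and sigma: "sigma $ 0 = 0" "\<And>i. sigma $ i \<in> A"
  shows "Theta1 $ i $ j \<in> A" "Theta2 $ i $ j \<in> A"
proof -
  interpret two_valued_group F g f ubar B Theta1 Theta2 by fact
  interpret graded_family "\<lambda>_. A" by fact
  obtain l :: "'k fps" where l: "l $ 0 = 0" "l $ 1 = 1" "fps_exp 1 oo l = 1 + fps_X"
    "fps_exp (- 1) oo l = Abs_fps (\<lambda>n. (- 1) ^ n)"
    by (rule fps_exp_compose_log)
  have phi: "phi = sigma oo mult_phi" unfolding phi_def by (rule f)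
  define xi where "xi = phi oo l"
  have p0: "(mult_phi :: 'k fps) $ 0 = 0" by (simp add: mult_phi_def)
  have two: "2 \<in> A" using of_nat_E[of 2] by simp
  have one: "1 \<in> A" and zero: "0 \<in> A" by (rule one_E zero_E)+
  have minus_one: "(- 1) ^ i \<in> A" for i by (intro power_E uminus_E one)
  have a_E: "hom1 1 0 (fps_exp 1 oo l)"
    unfolding l hom1_def by (auto simp: fps_X_def intro: one zero)
  have b_E: "hom1 1 0 (fps_exp (- 1) oo l)"
    unfolding l hom1_def by (simp add: minus_one)
  have "xi = sigma oo (mult_phi oo l)"
    unfolding xi_def phi by (rule compose_assoc[OF p0 l(1)])
  moreover have "(mult_phi oo l) $ i \<in> A" for i
    unfolding mult_phi_def using a_E b_E
    by (simp add: fps_compose_sub_distrib compose_const hom1_def) (auto intro!: diff_E uminus_E two zero)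
  ultimately have "xi $ i \<in> A" for i
    using compose_nth_E[of sigma "mult_phi oo l"] sigma(2) by simp
  \<comment> \<open>The family is constant, so the weights merely match the shape of
    \<open>hom2_quadratic\<close>.\<close>
  then have xi_E: "hom1 1 (2 * 1) xi" by (simp add: hom1_def)
  have xi_start: "quadratic_start xi"
    using phi_start l(1,2) by (simp add: xi_def quadratic_start_def fps_compose_nth numeral_2_eq_2 fps_mult_nth)
  have L: "in_u l \<in> ord2 1" "in_v l \<in> ord2 1"
    using l(1) by (simp_all add: ord2_uv)
  have S: "subst2 (subst1 phi (in_u fps_X + fps_const (fps_const s) * in_v fps_X)) (in_u l) (in_v l) =
      subst1 sigma (fps_const (fps_const 2) - in_u (fps_exp 1 oo l) * in_v (fps_exp s oo l) -
        in_u (fps_exp (- 1) oo l) * in_v (fps_exp (- s) oo l))" for s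
  proof -
    let ?Z = "in_u fps_X + fps_const (fps_const s) * in_v fps_X :: 'k fps fps"
    have Z: "?Z \<in> ord2 1" by (simp add: ord2_1 in_u_nth in_v_nth)
    have "subst1 phi ?Z = subst1 sigma (subst1 mult_phi ?Z)"
      unfolding phi using bi.s1_compose[OF p0 Z, of sigma] by (simp add: bi_s1)
    also have e: "subst1 mult_phi ?Z = fps_const (fps_const 2) - in_u (fps_exp 1) * in_v (fps_exp s) -
        in_u (fps_exp (- 1)) * in_v (fps_exp (- s))"
      unfolding mult_phi_def bi_s1[symmetric] bi.s1_diff[OF Z] bi.s1_const[OF Z]
      unfolding bi_s1 fps_exp_sum by simp
    finally have "subst2 (subst1 phi ?Z) (in_u l) (in_v l) = subst1 sigma (subst2 (subst1 mult_phi ?Z) (in_u l) (in_v l))"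
      using bi.sb_subst1[of "subst1 mult_phi ?Z", OF _ L, of sigma] bi.s1_J[OF Z p0] by (simp add: e bi_s1)
    also have "subst2 (subst1 mult_phi ?Z) (in_u l) (in_v l) = fps_const (fps_const 2) - in_u (fps_exp 1 oo l) * in_v (fps_exp s oo l) -
        in_u (fps_exp (- 1) oo l) * in_v (fps_exp (- s) oo l)"
      unfolding e
      by (simp add: bi.sb_diff[OF L] bi.sb_mult[OF L] bi.sb_const[OF L] bi.sb_in_u[OF L] bi.sb_in_v[OF L] bi_s1 in_u_compose in_v_compose l(1))
    finally show ?thesis .
  qed
  have hom: "hom2 1 0 (subst1 sigma (fps_const (fps_const 2) - in_u a * in_v b - in_u c * in_v d))"
    if "hom1 1 0 a" "hom1 1 0 b" "hom1 1 0 c" "hom1 1 0 d" for a b c d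
  proof -
    have "hom2 1 0 (fps_const (fps_const 2))"
      by (simp add: hom2_def two zero)
    moreover have "hom2 1 0 (in_u a * in_v b)" "hom2 1 0 (in_u c * in_v d)"
      using hom2_mult[of 1 0 _ 0] that by (auto intro: hom2_in_u hom2_in_v)
    ultimately have "hom2 1 0 (fps_const (fps_const 2) - in_u a * in_v b - in_u c * in_v d)"
      by (simp add: hom2_def diff_E)
    then show ?thesis
      using sigma(2) by (intro hom2_subst1[of 0]) (simp_all add: hom1_def)
  qed
  define Z1 where "Z1 = subst2 (subst1 phi sum_uv) (in_u l) (in_v l)"
  define Z2 where "Z2 = subst2 (subst1 phi diff_uv) (in_u l) (in_v l)"
  have Z: "hom2 1 0 Z1" "hom2 1 0 Z2"
    using S[of 1] S[of "- 1"] hom[OF a_E a_E b_E b_E] hom[OF a_E b_E b_E a_E]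
    by (simp_all add: Z1_def Z2_def flip: fps_const_neg)
  have xi: "subst2 (subst2 H (in_u phi) (in_v phi)) (in_u l) (in_v l) = subst2 H (in_u xi) (in_v xi)" for H
    by (subst bi.sb_subst2)
       (simp_all add: L ord2_uv phi0 l(1) xi_def bi.sb_in_u bi.sb_in_v bi_s1 in_u_compose in_v_compose)
  have "subst2 Theta1 (in_u xi) (in_v xi) = Z1 + Z2" "subst2 Theta2 (in_u xi) (in_v xi) = Z1 * Z2"
    unfolding xi[symmetric] Theta1_phi Theta2_phi Z1_def Z2_def by (simp_all add: bi.sb_add[OF L] bi.sb_mult[OF L])
  then have "hom2 1 0 (subst2 Theta1 (in_u xi) (in_v xi))" "hom2 1 0 (subst2 Theta2 (in_u xi) (in_v xi))"
    using hom2_add[OF Z] hom2_mult[OF Z] by simp_all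
  from this[THEN hom2_quadratic[OF xi_start xi_E]]
  show "Theta1 $ i $ j \<in> A" "Theta2 $ i $ j \<in> A"
    by (simp_all add: hom2_def)
qed

section \<open>Primitivity\<close>

definition p_integral :: "nat \<Rightarrow> rat \<Rightarrow> bool"
  where "p_integral p r \<longleftrightarrow> (\<exists>c::int. \<not> int p dvd c \<and> of_int c * r \<in> \<int>)"

lemma p_integral_of_int: "p > 1 \<Longrightarrow> p_integral p (of_int k)"
  unfolding p_integral_def by (intro exI[of _ 1]) auto

lemma p_integral_diff:
  assumes p: "prime p" and r: "p_integral p r" "p_integral p s"
  shows "p_integral p (r - s)"
proof -
  obtain c d :: int where cd: "\<not> int p dvd c" "\<not> int p dvd d" "of_int c * r \<in> \<int>" "of_int d * s \<in> \<int>"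
    using r unfolding p_integral_def by blast
  have "of_int (c * d) * (r - s) = of_int d * (of_int c * r) - of_int c * (of_int d * s)"
    by (simp add: algebra_simps)
  then have "of_int (c * d) * (r - s) \<in> \<int>"
    using cd by (auto intro!: Ints_diff Ints_mult)
  moreover have "\<not> int p dvd c * d"
    using cd p by (simp add: prime_dvd_mult_iff)
  ultimately show ?thesis unfolding p_integral_def by blast
qed

lemma p_integral_mult:
  assumes p: "prime p" and r: "p_integral p r" "p_integral p s"
  shows "p_integral p (r * s)"
proof -
  obtain c d :: int where cd: "\<not> int p dvd c" "\<not> int p dvd d" "of_int c * r \<in> \<int>" "of_int d * s \<in> \<int>"
    using r unfolding p_integral_def by blast
  have "of_int (c * d) * (r * s) = (of_int c * r) * (of_int d * s)"
    by (simp add: algebra_simps)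
  then have "of_int (c * d) * (r * s) \<in> \<int>"
    using Ints_mult[OF cd(3,4)] by (simp only:)
  moreover have "\<not> int p dvd c * d"
    using cd p by (simp add: prime_dvd_mult_iff)
  ultimately show ?thesis unfolding p_integral_def by blast
qed

text \<open>Power series in \<open>t = fls_X\<close> over the localization of the integers at
  \<open>p\<close>. They sit inside Laurent series because \<open>ex_odd_fps_factor\<close> works
  over a field of characteristic 0.\<close>

definition p_integral_series :: "nat \<Rightarrow> rat fls set"
  where "p_integral_series p = fps_to_fls ` {z. \<forall>i. p_integral p (z $ i)}"

lemma graded_p_integral_series:
  assumes p: "prime p" shows "graded_family (\<lambda>_. p_integral_series p)"
proof
  have p1: "p > 1" using p by (rule prime_gt_1_nat)
  show "1 \<in> p_integral_series p"
    unfolding p_integral_series_def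
    using p_integral_of_int[OF p1, of 0] p_integral_of_int[OF p1, of 1] by (intro image_eqI[of _ _ 1]) auto
  show 0: "0 \<in> p_integral_series p"
    unfolding p_integral_series_def using p_integral_of_int[OF p1, of 0] by (intro image_eqI[of _ _ 0]) auto
  fix x y assume "x \<in> p_integral_series p" "y \<in> p_integral_series p"
  then obtain a b where ab: "x = fps_to_fls a" "y = fps_to_fls b" "\<And>i. p_integral p (a $ i)" "\<And>i. p_integral p (b $ i)"
    by (auto simp: p_integral_series_def)
  show "x - y \<in> p_integral_series p"
    unfolding p_integral_series_def
    using ab p_integral_diff[OF p] by (intro image_eqI[of _ _ "a - b"]) auto
  have sum: "p_integral p (sum h I)" if "\<And>i. i \<in> I \<Longrightarrow> p_integral p (h i)" for h :: "nat \<Rightarrow> rat" and I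
    using that
  proof (induction I rule: infinite_finite_induct)
    case (insert i I)
    then have "p_integral p (h i)" "p_integral p (sum h I)" by simp_all
    from p_integral_diff[OF p this(1) p_integral_diff[OF p p_integral_of_int[OF p1, of 0] this(2)]]
    show ?case using insert by simp
  qed (use p_integral_of_int[OF p1, of 0] in auto)
  have "p_integral p ((a * b) $ i)" for i
    unfolding fps_mult_nth by (intro sum p_integral_mult[OF p] ab)
  then show "x * y \<in> p_integral_series p"
    unfolding p_integral_series_def
    using ab by (intro image_eqI[of _ _ "a * b"]) (auto simp: fls_times_fps_to_fls)
qed

text \<open>In \<open>s = x - t s^(e+1)\<close> the coefficient of degree \<open>n\<close> on the
  right involves only earlier ones, as \<open>s\<close> has no constant term and
  \<open>e \<ge> 1\<close>.\<close>

lemma compositional_inverse_subring: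
  fixes t :: "'k::comm_ring_1"
  assumes A: "graded_family (\<lambda>_. A)" and t: "t \<in> A" and e: "e \<ge> 1"
    and s: "s $ 0 = 0" "(fps_X + fps_const t * fps_X ^ (e + 1)) oo s = fps_X"
  shows "s $ n \<in> A"
proof (induction n rule: less_induct)
  case (less n)
  interpret graded_family "\<lambda>_. A" by fact
  have "s + fps_const t * s ^ (e + 1) = fps_X"
    using s(2) by (simp add: fps_compose_add_distrib compose_mult[OF s(1)] compose_const compose_power[OF s(1)]
        X_compose[OF s(1)] del: power_Suc)
  then have "(s + fps_const t * (s * s ^ e)) $ n = fps_X $ n"
    by (simp only: power_Suc Suc_eq_plus1[symmetric])
  then have "s $ n + t * (s * s ^ e) $ n = fps_X $ n"
    by (simp only: fps_add_nth fps_mult_left_const_nth)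
  then have "s $ n = fps_X $ n - t * (s * s ^ e) $ n"
    by (simp only: eq_diff_eq)
  moreover have "fps_X $ n \<in> A"
    using one_E zero_E by (simp add: fps_X_def)
  moreover have "(s * s ^ e) $ n \<in> A"
    unfolding fps_mult_nth
  proof (rule sum_E)
    fix i assume i: "i \<in> {0..n}"
    consider "i = 0" | "i = n" | "0 < i" "i < n" using i by force
    then show "s $ i * (s ^ e) $ (n - i) \<in> A"
    proof cases
      case 1
      then show ?thesis using s zero_E by simp
    next
      case 2
      then show ?thesis using s zero_E e by (simp add: fps_power_zeroth power_0_left)
    next
      case 3
      then have "(s ^ e) $ (n - i) \<in> A"
        using power_nth_E[of "n - i" s "n - i" e] less by simp
      then show ?thesis
        using less 3 mult_E by blast
    qed
  qed
  ultimately show ?case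
    using t by (simp add: diff_E mult_E)
qed

lemma perturbed_power_nth:
  fixes t :: "'k::comm_ring_1"
  shows "((fps_X + fps_const t * fps_X ^ (e + 1)) ^ q) $ m =
    (\<Sum>i\<le>q. if q + i * e = m then of_nat (q choose i) * t ^ i else 0)"
proof -
  have "(fps_X + fps_const t * fps_X ^ (e + 1)) ^ q = (\<Sum>i\<le>q. of_nat (q choose i) * (fps_const t * fps_X ^ (e + 1)) ^ i * fps_X ^ (q - i))"
    by (subst add.commute) (rule binomial_ring)
  also have "\<dots> = (\<Sum>i\<le>q. fps_const (of_nat (q choose i) * t ^ i) * fps_X ^ (q + i * e))"
  proof (intro sum.cong refl)
    fix i assume "i \<in> {..q}"
    then have "(e + 1) * i + (q - i) = q + i * e" by (simp add: algebra_simps)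
    then have "fps_X ^ (q + i * e) = (fps_X ^ (e + 1)) ^ i * (fps_X ^ (q - i) :: 'k fps)"
      by (simp only: power_mult[symmetric] power_add[symmetric])
    then show "of_nat (q choose i) * (fps_const t * fps_X ^ (e + 1)) ^ i * fps_X ^ (q - i) =
        fps_const (of_nat (q choose i) * t ^ i) * fps_X ^ (q + i * e)"
      by (simp only: power_mult_distrib fps_const_power fps_of_nat[symmetric] fps_const_mult[symmetric] mult.assoc)
  qed
  finally show ?thesis
    by (simp add: fps_sum_nth fps_X_power_nth if_distrib[of "\<lambda>x. _ * x"] eq_commute cong: if_cong)
qed

text \<open>In degree \<open>m\<close> the power \<open>t^j\<close> arises only from the summand
  \<open>q = m - j * e = k\<close>, so no other coefficient of \<open>mult_B\<close> can cancel
  it.\<close>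

lemma mult_B_compose_nth:
  assumes k: "k + j * e = m" "k \<ge> 1" "j \<le> k"
  shows "((mult_B oo (fps_X + fps_const fls_X * fps_X ^ (e + 1))) $ m) $$ int j =
    (2 * of_nat (k choose j) / of_nat (k\<^sup>2 * (2 * k choose k)) :: rat)"
proof -
  define b where "b q = 2 / (of_nat (q\<^sup>2 * (2 * q choose q)) :: rat)" for q :: nat
  have b: "mult_B $ q = fls_const (b q)" for q
  proof (cases "q = 0")
    case False
    then have nz: "of_nat (q\<^sup>2 * (2 * q choose q)) \<noteq> (0 :: rat)" "of_nat (q\<^sup>2 * (2 * q choose q)) \<noteq> (0 :: rat fls)"
      by (simp_all del: of_nat_mult of_nat_power)
    have "fls_const (b q) * of_nat (q\<^sup>2 * (2 * q choose q)) = fls_const (b q * of_nat (q\<^sup>2 * (2 * q choose q)))"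
      by (simp only: fls_of_nat fls_const_mult_const)
    also have "\<dots> = 2"
      using nz(1) by (simp only: b_def nonzero_eq_divide_eq[symmetric] nonzero_divide_eq_eq times_divide_eq_left nonzero_mult_div_cancel_right) simp
    finally have "fls_const (b q) = 2 / of_nat (q\<^sup>2 * (2 * q choose q))"
      by (simp only: nonzero_eq_divide_eq[OF nz(2)])
    then show ?thesis
      by (simp only: mult_B_def fps_nth_Abs_fps)
  qed (simp add: mult_B_def b_def)
  have sum_nth: "(\<Sum>i\<in>I. h i) $$ l = (\<Sum>i\<in>I. h i $$ l)" for h :: "nat \<Rightarrow> rat fls" and I l
    by (induction I rule: infinite_finite_induct) auto
  have "((mult_B oo (fps_X + fps_const fls_X * fps_X ^ (e + 1))) $ m) $$ int j =
      (\<Sum>q=0..m. b q * (\<Sum>i\<le>q. if i = j then (if q + i * e = m then of_nat (q choose i) else 0) else 0))"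
    unfolding fps_compose_nth b perturbed_power_nth sum_nth fls_mult_const_nth
    by (intro sum.cong refl arg_cong2[where f = "(*)"]) (auto simp: fls_of_nat)
  also have "\<dots> = (\<Sum>q=0..m. if q = k then b k * of_nat (k choose j) else 0)"
    using k by (intro sum.cong refl) (auto simp: sum.delta)
  also have "\<dots> = b k * of_nat (k choose j)"
    using k by simp
  finally show ?thesis by (simp add: b_def)
qed

text \<open>A suitable homomorphism sends \<open>c\<close> to a p-integral series for a prime
  \<open>p\<close> dividing \<open>k\<close>, so every coefficient of the right side gains a factor
  \<open>p\<close>. By \<open>ex_extremal_coefficient\<close> some coefficient on the left has
  p-exponent at most 0.\<close>

theorem scaled_coefficient_not_divisible:
  assumes data: "two_valued_group cobordism_fgl g f ubar B Theta1 Theta2"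
    and k: "k > 1" and c: "c \<in> coefficient_ring Theta1 Theta2"
    and eq: "of_nat (d_factor n) * B $ (n + 1) = of_int k * c"
  shows False
proof -
  obtain p where p: "prime p" "int p dvd k"
  proof -
    have "\<not> is_unit k" using k by simp
    moreover have "k \<noteq> 0" using k by simp
    ultimately obtain q where q: "q dvd k" "prime q" using prime_divisor_exists by blast
    have "0 \<le> q \<and> prime (nat q)"
      by (rule prime_int_nat_transfer[THEN iffD1, OF q(2)])
    then show ?thesis using that[of "nat q"] q(1) by simp
  qed
  let ?m = "n + 1"
  obtain \<kappa> j e where ex: "\<kappa> \<ge> 1" "e \<ge> 1" "\<kappa> + j * e = ?m" "j \<le> \<kappa>"
    "multiplicity p (?m * Lcm {1..2 * ?m} * (\<kappa> choose j)) \<le> multiplicity p (\<kappa>\<^sup>2 * (2 * \<kappa> choose \<kappa>))"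
    using ex_extremal_coefficient[OF p(1), of ?m] by auto
  define A where "A = p_integral_series p"
  have A: "graded_family (\<lambda>_. A)"
    unfolding A_def by (rule graded_p_integral_series[OF p(1)])
  interpret A: graded_family "\<lambda>_. A" by (rule A)
  have t: "fls_X \<in> A"
    unfolding A_def p_integral_series_def
    using p_integral_of_int[of p 0] p_integral_of_int[of p 1] prime_gt_1_nat[OF p(1)]
    by (intro image_eqI[of _ _ fps_X]) auto
  define theta :: "rat fls fps" where "theta = fps_X + fps_const fls_X * fps_X ^ (e + 1)"
  define sigma where "sigma = fps_inv theta"
  have theta: "theta $ 0 = 0" "theta $ 1 = 1"
    using ex(2) by (simp_all add: theta_def)
  have inv: "theta oo sigma = fps_X" "sigma oo theta = fps_X"
    unfolding sigma_def using theta by (auto intro!: fps_inv fps_inv_right)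
  have s0: "sigma $ 0 = 0" by (simp add: sigma_def fps_inv_def)
  have s1: "sigma $ 1 = 1"
    using arg_cong[OF inv(1), of "\<lambda>h. h $ 1"] theta s0 by (simp add: fps_compose_nth)
  have sigma_A: "sigma $ i \<in> A" for i
    by (rule compositional_inverse_subring[OF A t ex(2) s0 inv(1)[unfolded theta_def]])
  have p0: "(mult_phi :: rat fls fps) $ 0 = 0" by (simp add: mult_phi_def)
  have "quadratic_start (sigma oo mult_phi)"
    using mult_phi_start[where 'k = "rat fls"] s0 s1
    by (simp add: quadratic_start_def fps_compose_nth numeral_2_eq_2 fps_mult_nth)
  moreover have "(sigma oo mult_phi) oo - fps_X = sigma oo mult_phi"
    by (simp add: compose_assoc p0 mult_phi_even)
  ultimately obtain f0 g0 where fg: "f0 $ 0 = 0" "f0 $ 1 = 1" "g0 $ 0 = 0" "f0 oo g0 = fps_X" "g0 oo f0 = fps_X"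
      "f0 * (f0 oo - fps_X) = sigma oo mult_phi"
    using ex_odd_fps_factor by blast
  define F0 where "F0 = subst1 f0 (in_u g0 + in_v g0)"
  have F0: "formal_group_law F0"
    unfolding F0_def by (rule formal_group_law_logarithm[OF fg(1,3,4,5)])
  have units: "k \<noteq> 0 \<Longrightarrow> (of_int k :: rat fls) dvd 1" for k :: int
    by (simp add: dvd_field_iff)
  \<comment> \<open>Universality defines the map on the Lazard ring; it extends to fractions because
    nonzero integers are invertible in rational Laurent series.\<close>
  obtain H where H: "is_ring_hom H" "\<And>a. H (to_rationalized a) = classifying_map F0 a"
    using ex_rationalized_hom[OF is_ring_hom_classifying_map[OF F0] units] by blast
  have HF: "map_fps (map_fps H) cobordism_fgl = F0"
    using map_classifying_map[OF F0] by (simp add: cobordism_fgl_def fps_eq_iff H(2))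
  have dataK: "two_valued_group F0 (map_fps H g) (map_fps H f) (map_fps H ubar) (map_fps H B)
      (map_fps (map_fps H) Theta1) (map_fps (map_fps H) Theta2)"
    using two_valued_group_map[OF H(1) data units] by (simp add: HF)
  interpret K: two_valued_group F0 "map_fps H g" "map_fps H f" "map_fps H ubar" "map_fps H B"
      "map_fps (map_fps H) Theta1" "map_fps (map_fps H) Theta2"
    by (rule dataK)
  \<comment> \<open>\<open>H\<close> was chosen only to carry the group law to \<open>F0\<close>;
    uniqueness of the logarithm fixes the images of \<open>g\<close> and \<open>f\<close>, and with
    them \<open>K.phi\<close>.\<close>
  have g: "map_fps H g = g0"
    by (rule logarithm_unique[OF units fg(1,2,3,4,5) K.g0 K.g1 K.log_sum[unfolded F0_def]])
  have f: "map_fps H f = f0"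
  proof -
    have "(map_fps H f oo g0) oo f0 = map_fps H f"
      by (simp add: compose_assoc fg)
    moreover have "map_fps H f oo g0 = fps_X"
      using K.exp(2) by (simp add: g)
    ultimately show ?thesis by (simp add: X_compose fg)
  qed
  have phi: "K.phi = sigma oo mult_phi"
    using K.phi_def fg(6) by (simp only: f)
  have HTheta: "H (Theta1 $ i $ l) \<in> A" "H (Theta2 $ i $ l) \<in> A" for i l
    using Theta_subring[OF dataK A _ s0 sigma_A, of i l] fg(6) by (simp_all add: f)
  have HA: "H c \<in> A"
    using c unfolding coefficient_ring_def
  proof (induction rule: generated_subring.induct)
    case one
    then show ?case using H(1) A.one_E by (simp add: is_ring_hom_def)
  qed (auto simp: HTheta is_ring_hom_diff[OF H(1)] is_ring_hom_mult[OF H(1)] intro: A.diff_E A.mult_E)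
  \<comment> \<open>Both composites equal \<open>- w^2\<close>. Once \<open>mult_phi\<close> is
    cancelled, composing with \<open>theta\<close> removes \<open>sigma\<close>.\<close>
  have "(map_fps H B oo sigma) oo mult_phi = mult_B oo mult_phi"
    using K.B_phi by (simp add: compose_assoc[OF s0 p0] phi mult_B_phi)
  then have "map_fps H B oo sigma = mult_B"
    by (rule compose_quadratic_inj[OF mult_phi_start])
  then have "mult_B oo theta = map_fps H B"
    using compose_assoc[OF s0 theta(1), of "map_fps H B"] by (simp add: inv)
  then have HB: "H (B $ ?m) = (mult_B oo theta) $ ?m"
    by simp
  have "of_nat (d_factor n) * H (B $ ?m) = of_int k * H c"
  proof -
    have "H (of_nat (d_factor n)) = of_nat (d_factor n)"
      using is_ring_hom_of_int[OF H(1), of "int (d_factor n)"] by simp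
    then show ?thesis
      using arg_cong[OF eq, of H] by (simp add: is_ring_hom_mult[OF H(1)] is_ring_hom_of_int[OF H(1)])
  qed
  then have "(of_nat (d_factor n) * H (B $ ?m)) $$ int j = (of_int k * H c) $$ int j"
    by simp
  moreover have "(of_nat (d_factor n) * x) $$ l = of_nat (d_factor n) * x $$ l" for x :: "rat fls" and l
    by (simp add: fls_of_nat)
  moreover have "(of_int k * x) $$ l = of_int k * x $$ l" for x :: "rat fls" and l
    by (simp add: fls_of_int)
  ultimately have coeff: "of_nat (d_factor n) * (2 * of_nat (\<kappa> choose j) / of_nat (\<kappa>\<^sup>2 * (2 * \<kappa> choose \<kappa>))) = of_int k * (H c $$ int j)"
    using mult_B_compose_nth[OF ex(3,1,4)] by (simp only: HB theta_def)
  obtain z where z: "H c = fps_to_fls z" "p_integral p (z $ j)"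
    using HA by (auto simp: A_def p_integral_series_def)
  then obtain a w where a: "\<not> int p dvd a" "of_int a * (z $ j) = of_int w"
    unfolding p_integral_def by (auto elim: Ints_cases)
  \<comment> \<open>Since \<open>2 * d_factor n = ?m * Lcm {1..2 * ?m}\<close>, the coefficient of
    \<open>t^j\<close> is \<open>U / V\<close>. The choice of \<open>\<kappa>\<close>,
    \<open>j\<close>, \<open>e\<close> bounds the exponent of \<open>p\<close> in \<open>U\<close>
    by that in \<open>V\<close>, while \<open>a U = V k w\<close>, with \<open>p\<close> dividing
    \<open>k\<close> but not \<open>a\<close>, makes it larger.\<close>
  define U where "U = ?m * Lcm {1..2 * ?m} * (\<kappa> choose j)"
  define V where "V = \<kappa>\<^sup>2 * (2 * \<kappa> choose \<kappa>)"
  have V: "V > 0" using ex(1) by (simp add: V_def)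
  have "U \<noteq> 0" using ex(4) unfolding U_def by (simp add: Lcm_0_iff)
  then have U: "U > 0" by simp
  have "2 dvd Lcm {1..2 * ?m}" by (intro dvd_Lcm) auto
  then have d: "2 * d_factor n = ?m * Lcm {1..2 * ?m}"
    unfolding d_factor_def by simp
  have "(of_nat U :: rat) = of_nat V * (of_nat (d_factor n) * (2 * of_nat (\<kappa> choose j) / of_nat V))"
    using V unfolding U_def d[symmetric] by (simp add: mult_ac)
  also have "\<dots> = of_nat V * (of_int k * z $ j)"
    unfolding V_def coeff z(1) by simp
  finally have "of_int a * (of_nat U :: rat) = of_nat V * (of_int k * (of_int a * z $ j))"
    by (simp add: mult_ac)
  also have "\<dots> = of_nat V * (of_int k * of_int w)"
    by (simp only: a)
  finally have "of_int (a * int U) = (of_int (int V * (k * w)) :: rat)"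
    by simp
  then have aU: "a * int U = int V * (k * w)"
    by (simp only: of_int_eq_iff)
  have "int p ^ multiplicity p V dvd int V"
    by (metis multiplicity_dvd of_nat_dvd_iff of_nat_power)
  moreover have "int p dvd k * w" using p(2) by simp
  ultimately have "int p ^ multiplicity p V * int p dvd a * int U"
    unfolding aU by (rule mult_dvd_mono)
  moreover have "coprime (int p ^ multiplicity p V * int p) a"
    using a(1) p(1) by (simp add: prime_imp_coprime)
  ultimately have "int p ^ Suc (multiplicity p V) dvd int U"
    by (simp add: coprime_dvd_mult_right_iff mult.commute)
  then have "p ^ Suc (multiplicity p V) dvd U"
    by (metis of_nat_dvd_iff of_nat_power)
  then have "Suc (multiplicity p V) \<le> multiplicity p U"
    using U p(1) by (intro multiplicity_geI) (auto simp: prime_nat_iff)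
  then show False
    using ex(5) by (simp add: U_def V_def)
qed

theorem theorem2p4p2:
  fixes g f ubar B :: "lazard rationalized fps"
    and Theta1 Theta2 :: "lazard rationalized fps fps"
    and \<Lambda> :: "lazard rationalized set"
    and C :: "nat \<Rightarrow> lazard rationalized"
    and n :: nat
  assumes log: "is_logarithm cobordism_fgl g"
    and exp: "f $ 0 = 0" "f oo g = fps_X" "g oo f = fps_X"
    and inverse: "ubar = f oo (- g)"
    and B: "B $ 0 = 0" "B $ 1 = 1" "B oo (fps_X * ubar) = - (g ^ 2)"
    and two_valued: "two_valued_law cobordism_fgl ubar Theta1 Theta2"
    and \<Lambda>: "\<Lambda> = coefficient_ring Theta1 Theta2"
    and C: "\<And>n. C n = of_nat (d_factor n) * B $ (n + 1)"
    and n: "n \<ge> 1"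
  shows "C n \<in> \<Lambda> \<inter> cobordism_group (- 4 * int n) \<and>
    \<not> (\<exists>k::int. k > 1 \<and> (\<exists>c\<in>\<Lambda>. C n = of_int k * c))"
proof -
  note F = formal_group_law_nth_0[OF formal_group_law_cobordism]
  have group: "two_valued_group cobordism_fgl g f ubar B Theta1 Theta2"
    by unfold_locales (use assms F rationalized_units in auto)
  interpret graded_family "\<lambda>w. cobordism_group (- 2 * w)"
    by (rule graded_cobordism)
  \<comment> \<open>Weight \<open>w\<close> means degree \<open>- 2 * w\<close>, so the degree
    \<open>2 - 2 * (i + j)\<close> is weight \<open>i + j - 1\<close>.\<close>
  have hom: "hom2 1 1 cobordism_fgl"
    unfolding hom2_def using cobordism_fgl_degree by (simp add: algebra_simps)
  interpret graded_two_valued_group cobordism_fgl g f ubar B Theta1 Theta2 "\<lambda>w. cobordism_group (- 2 * w)"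
    by (intro graded_two_valued_group.intro group graded_cobordism graded_two_valued_group_axioms.intro hom F)
  have "C n \<in> \<Lambda> \<inter> cobordism_group (- 4 * int n)"
    using d_factor_B[of n] unfolding graded_part_def C \<Lambda> by simp
  moreover have "\<not> (\<exists>k::int. k > 1 \<and> (\<exists>c\<in>\<Lambda>. C n = of_int k * c))"
    using scaled_coefficient_not_divisible[OF group] by (auto simp: C \<Lambda>)
  ultimately show ?thesis by blast
qed

end
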